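(* Let $Z$ be a perfect Polish space and let $P$ be a dynamical property. Then the set of actions in $A_\mu(G,X,\nu)$ having $P$ is residual in $A_\mu(G,X,\nu)$ endowed with the very weak topology if and only if the set of measures $\eta\in\mathcal{P}_\mu(Z^G)$ such that $G\curvearrowright(Z^G,\eta)$ has $P$ is residual in $\mathcal{P}_\mu(Z^G)$.
   Context: $G$ is a countable discrete group; $\mu$ is a probability measure on $G$ whose support generates $G$ as a semigroup. A dynamical property is a class of nonsingular $G$-actions on probability spaces that is invariant under measurable conjugacy (a $G$-equivariant measure-space isomorphism mod null sets). $G$ acts on $Z^G$ by $(gx)(k)=x(g^{-1}k)$; $\mathcal{P}_\mu(Z^G)$ is the set of Borel probability measures $\eta$ on $Z^G$ with $\sum_g\mu(g)g_*\eta=\eta$, with the weak* topology. $(X,\nu)$ is a standard nonatomic Lebesgue probability space; $\mathrm{Aut}^*(X,\nu)$ is the group of invertible nonsingular transformations of $(X,\nu)$ mod a.e. equality. For $T\in\mathrm{Aut}^*(X,\nu)$, $U_{T,1}f=\frac{dT_*\nu}{d\nu}\cdot f\circ T^{-1}$. The very weak topology on $\mathrm{Aut}^*(X,\nu)$ (induced by the weak operator topology on isometries of $L^1$) is given by $T_n\to T$ iff $\int U_{T_n,1}\mathbf 1_A\cdot\mathbf 1_B\,d\nu\to\int U_{T,1}\mathbf 1_A\cdot\mathbf 1_B\,d\nu$ for all measurable $A,B$. $A_\mu(G,X,\nu)$ is the set of homomorphisms $a:G\to\mathrm{Aut}^*(X,\nu)$ with $\sum_g\mu(g)a(g)_*\nu=\nu$,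 topologized by pointwise convergence. Residual means containing a countable intersection of dense open sets. *)

theory Defs
  imports "HOL-Analysis.Analysis" "HOL-Probability.Probability"
begin

text \<open>Groups are written additively: the countable discrete group G is a type
  of class group_add (not necessarily commutative) and countable.\<close>

inductive_set gen_semigroup :: "'g::group_add set \<Rightarrow> 'g set" for S where
  base: "s \<in> S \<Longrightarrow> s \<in> gen_semigroup S"
| plus: "a \<in> gen_semigroup S \<Longrightarrow> b \<in> gen_semigroup S \<Longrightarrow> a + b \<in> gen_semigroup S"

definition residual_in :: "'a topology \<Rightarrow> 'a set \<Rightarrow> bool" where
  "residual_in T S \<longleftrightarrow>
     (\<exists>U :: nat \<Rightarrow> 'a set. (\<forall>n. openin T (U n) \<and> T closure_of (U n) = topspace T)
        \<and> (\<Inter>n. U n) \<subseteq> S)"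

definition nonsingular_action :: "'a measure \<Rightarrow> ('g::group_add \<Rightarrow> 'a \<Rightarrow> 'a) \<Rightarrow> bool" where
  "nonsingular_action M \<alpha> \<longleftrightarrow> prob_space M \<and>
     (\<forall>g. \<alpha> g \<in> measurable M M \<and>
          (\<forall>A\<in>sets M. emeasure M (\<alpha> g -` A \<inter> space M) = 0 \<longleftrightarrow> emeasure M A = 0)) \<and>
     (AE x in M. \<alpha> 0 x = x) \<and>
     (\<forall>g h. AE x in M. \<alpha> (g + h) x = \<alpha> g (\<alpha> h x))"

definition conjugate ::
  "'a measure \<Rightarrow> ('g::group_add \<Rightarrow> 'a \<Rightarrow> 'a) \<Rightarrow> 'b measure \<Rightarrow> ('g \<Rightarrow> 'b \<Rightarrow> 'b) \<Rightarrow> bool" where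
  "conjugate M1 \<alpha>1 M2 \<alpha>2 \<longleftrightarrow> nonsingular_action M1 \<alpha>1 \<and> nonsingular_action M2 \<alpha>2 \<and>
     (\<exists>\<phi> \<psi>. \<phi> \<in> measurable M1 M2 \<and> \<psi> \<in> measurable M2 M1 \<and> distr M1 M2 \<phi> = M2 \<and>
        (AE x in M1. \<psi> (\<phi> x) = x) \<and> (AE y in M2. \<phi> (\<psi> y) = y) \<and>
        (\<forall>g. AE x in M1. \<phi> (\<alpha>1 g x) = \<alpha>2 g (\<phi> x)))"

text \<open>A dynamical property P, given by its restrictions PX (actions on the type of X)
  and PZ (actions on the type of Z^G): a class of nonsingular actions invariant under
  measurable conjugacy (within each type and across the two types).\<close>
definition dynamical_property ::
  "('a measure \<Rightarrow> ('g::group_add \<Rightarrow> 'a \<Rightarrow> 'a) \<Rightarrow> bool) \<Rightarrow>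
   ('b measure \<Rightarrow> ('g \<Rightarrow> 'b \<Rightarrow> 'b) \<Rightarrow> bool) \<Rightarrow> bool" where
  "dynamical_property PX PZ \<longleftrightarrow>
     (\<forall>M \<alpha>. PX M \<alpha> \<longrightarrow> nonsingular_action M \<alpha>) \<and>
     (\<forall>M \<alpha>. PZ M \<alpha> \<longrightarrow> nonsingular_action M \<alpha>) \<and>
     (\<forall>M1 \<alpha>1 M2 \<alpha>2. conjugate M1 \<alpha>1 M2 \<alpha>2 \<longrightarrow> (PX M1 \<alpha>1 \<longleftrightarrow> PX M2 \<alpha>2)) \<and>
     (\<forall>M1 \<alpha>1 M2 \<alpha>2. conjugate M1 \<alpha>1 M2 \<alpha>2 \<longrightarrow> (PZ M1 \<alpha>1 \<longleftrightarrow> PZ M2 \<alpha>2)) \<and>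
     (\<forall>M1 \<alpha>1 M2 \<alpha>2. conjugate M1 \<alpha>1 M2 \<alpha>2 \<longrightarrow> (PX M1 \<alpha>1 \<longleftrightarrow> PZ M2 \<alpha>2))"

definition shift_action :: "'g::group_add \<Rightarrow> ('g \<Rightarrow> 'z) \<Rightarrow> ('g \<Rightarrow> 'z)" where
  "shift_action g x = (\<lambda>k. x (- g + k))"

definition P_mu :: "'g::{group_add,countable} pmf \<Rightarrow> ('g \<Rightarrow> 'z::topological_space) measure set" where
  "P_mu \<mu> = {\<eta>. sets \<eta> = sets (borel :: ('g \<Rightarrow> 'z) measure) \<and> prob_space \<eta> \<and>
     (\<forall>E\<in>sets \<eta>. emeasure \<eta> E =
        (\<integral>\<^sup>+ g. emeasure (distr \<eta> borel (shift_action g)) E \<partial>(measure_pmf \<mu>)))}"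

definition P_mu_topology :: "'g::{group_add,countable} pmf \<Rightarrow> ('g \<Rightarrow> 'z::topological_space) measure topology" where
  "P_mu_topology \<mu> = pullback_topology (P_mu \<mu>)
     (\<lambda>\<eta> (f :: ('g \<Rightarrow> 'z) \<Rightarrow> real).
        if continuous_on UNIV f \<and> bounded (range f) then (\<integral>x. f x \<partial>\<eta>) else 0)
     euclidean"

text \<open>Aut*(X,nu): invertible nonsingular transformations (representatives).\<close>
definition aut_star :: "'a measure \<Rightarrow> ('a \<Rightarrow> 'a) set" where
  "aut_star M = {T. T \<in> measurable M M \<and>
     (\<forall>A\<in>sets M. emeasure M (T -` A \<inter> space M) = 0 \<longleftrightarrow> emeasure M A = 0) \<and>
     (\<exists>S. S \<in> measurable M M \<and> (AE x in M. S (T x) = x) \<and> (AE x in M. T (S x) = x))}"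

definition aut_inv :: "'a measure \<Rightarrow> ('a \<Rightarrow> 'a) \<Rightarrow> ('a \<Rightarrow> 'a)" where
  "aut_inv M T = (SOME S. S \<in> measurable M M \<and> (AE x in M. S (T x) = x) \<and> (AE x in M. T (S x) = x))"

definition U1 :: "'a measure \<Rightarrow> ('a \<Rightarrow> 'a) \<Rightarrow> ('a \<Rightarrow> real) \<Rightarrow> 'a \<Rightarrow> real" where
  "U1 M T f x = enn2real (RN_deriv M (distr M M T) x) * f (aut_inv M T x)"

definition very_weak_coords :: "'a measure \<Rightarrow> ('a \<Rightarrow> 'a) \<Rightarrow> ('a set \<times> 'a set \<Rightarrow> real)" where
  "very_weak_coords M T = (\<lambda>(A, B). if A \<in> sets M \<and> B \<in> sets M
      then (\<integral>x. U1 M T (indicator A) x * indicator B x \<partial>M) else 0)"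

definition very_weak_topology :: "'a measure \<Rightarrow> ('a \<Rightarrow> 'a) topology" where
  "very_weak_topology M = pullback_topology (aut_star M) (very_weak_coords M) euclidean"

definition A_mu :: "'g::group_add pmf \<Rightarrow> 'a measure \<Rightarrow> ('g \<Rightarrow> 'a \<Rightarrow> 'a) set" where
  "A_mu \<mu> M = {a. (\<forall>g. a g \<in> aut_star M) \<and>
     (\<forall>g h. AE x in M. a (g + h) x = a g (a h x)) \<and>
     (\<forall>E\<in>sets M. emeasure M E =
        (\<integral>\<^sup>+ g. emeasure (distr M M (a g)) E \<partial>(measure_pmf \<mu>)))}"

definition A_mu_topology :: "'g::group_add pmf \<Rightarrow> 'a measure \<Rightarrow> ('g \<Rightarrow> 'a \<Rightarrow> 'a) topology" where
  "A_mu_topology \<mu> M = subtopology (product_topology (\<lambda>g. very_weak_topology M) UNIV) (A_mu \<mu> M)"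

end

(*
  Measures on the shift and actions on X are compared through the space W of pairs (a, phi), where a is
  a stationary action on (X, nu) and phi is a Z-valued name of the points of X. With the topology of
  convergence in measure W is completely (pseudo-)metrizable, and there are continuous surjections of W
  onto A_mu, by (a, phi) -> a, and onto P_mu, by sending (a, phi) to the law of the process
  k -> phi(a(-k) x). Both send every ball to a set with nonempty interior, whence preimages and, by
  completeness of W, images of residual sets are residual. Since Z is perfect, phi is injective mod null
  sets for generic (a, phi), and then a is conjugate to the shift with the law of (a, phi).

  The very weak coordinates of T are nu(A Int T^-1 B), so convergence means nu(T_n^-1 B Delta T^-1 B) -> 0
  for all B. As the support of mu generates G, stationarity gives nu(a(g)^-1 B) <= c(g) nu(B) with c(g)
  independent of a, and on A_mu the topology is that of convergence in measure of each a(g).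
*)
theory Submission
  imports Defs
begin

section \<open>Images of residual sets\<close>

lemma maximal_disjoint_subfamily:
  fixes N :: "'q set" and V :: "'q \<Rightarrow> 'y set"
  shows "\<exists>F\<subseteq>N. (\<forall>p\<in>F. \<forall>q\<in>F. p \<noteq> q \<longrightarrow> V p \<inter> V q = {}) \<and>
    (\<forall>q\<in>N. V q \<noteq> {} \<longrightarrow> (\<exists>p\<in>F. V p \<inter> V q \<noteq> {}))"
proof -
  define A where "A = {F. F \<subseteq> N \<and> (\<forall>p\<in>F. \<forall>q\<in>F. p \<noteq> q \<longrightarrow> V p \<inter> V q = {})}"
  have "\<exists>M\<in>A. \<forall>X\<in>A. M \<subseteq> X \<longrightarrow> X = M"
  proof (rule subset_Zorn')
    fix C assume C: "subset.chain A C"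
    then have sub: "C \<subseteq> A" and ch: "\<And>X Y. X \<in> C \<Longrightarrow> Y \<in> C \<Longrightarrow> X \<subseteq> Y \<or> Y \<subseteq> X"
      by (auto simp: subset_chain_def)
    show "\<Union>C \<in> A"
      unfolding A_def
    proof (intro CollectI conjI ballI impI)
      show "\<Union>C \<subseteq> N" using sub by (auto simp: A_def)
      fix p q assume p: "p \<in> \<Union>C" and q: "q \<in> \<Union>C" and "p \<noteq> q"
      then obtain X Y where X: "X \<in> C" "p \<in> X" and Y: "Y \<in> C" "q \<in> Y" by auto
      with ch[of X Y] obtain Z where "Z \<in> C" "p \<in> Z" "q \<in> Z" by blast
      with sub \<open>p \<noteq> q\<close> show "V p \<inter> V q = {}" unfolding A_def by blast
    qed
  qed
  then obtain M where M: "M \<in> A" and max: "\<And>X. X \<in> A \<Longrightarrow> M \<subseteq> X \<Longrightarrow> X = M" by blast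
  have "\<exists>p\<in>M. V p \<inter> V q \<noteq> {}" if q: "q \<in> N" "V q \<noteq> {}" for q
  proof (rule ccontr)
    assume no: "\<not> (\<exists>p\<in>M. V p \<inter> V q \<noteq> {})"
    then have "insert q M \<in> A" using M q by (auto simp: A_def Int_commute)
    then have "insert q M = M" by (rule max) auto
    with no q show False by auto
  qed
  then show ?thesis using M unfolding A_def by (intro exI[of _ M]) auto
qed

lemma dense_in_iff_meets_open:
  assumes "S \<subseteq> topspace T"
  shows "T closure_of S = topspace T \<longleftrightarrow> (\<forall>Op. openin T Op \<and> Op \<noteq> {} \<longrightarrow> (\<exists>x\<in>Op. x \<in> S))"
proof -
  have "T closure_of S = topspace T \<longleftrightarrow> topspace T \<subseteq> T closure_of S"
    using closure_of_subset_topspace[of T S] by auto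
  also have "\<dots> \<longleftrightarrow> (\<forall>Op. openin T Op \<and> Op \<noteq> {} \<longrightarrow> (\<exists>x\<in>Op. x \<in> S))"
  proof
    assume L: "topspace T \<subseteq> T closure_of S"
    show "\<forall>Op. openin T Op \<and> Op \<noteq> {} \<longrightarrow> (\<exists>x\<in>Op. x \<in> S)"
    proof (intro allI impI)
      fix Op assume Op: "openin T Op \<and> Op \<noteq> {}"
      then obtain x where x: "x \<in> Op" by auto
      then have "x \<in> T closure_of S" using L Op openin_subset by blast
      then show "\<exists>x\<in>Op. x \<in> S" using x Op by (auto simp: in_closure_of)
    qed
  next
    assume "\<forall>Op. openin T Op \<and> Op \<noteq> {} \<longrightarrow> (\<exists>x\<in>Op. x \<in> S)"
    then show "topspace T \<subseteq> T closure_of S" unfolding in_closure_of subset_iff by blast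
  qed
  finally show ?thesis .
qed

locale complete_pseudometric =
  fixes W :: "'w set" and d :: "'w \<Rightarrow> 'w \<Rightarrow> real"
  assumes d_refl: "x \<in> W \<Longrightarrow> d x x = 0"
    and d_sym: "x \<in> W \<Longrightarrow> y \<in> W \<Longrightarrow> d x y = d y x"
    and d_tri: "x \<in> W \<Longrightarrow> y \<in> W \<Longrightarrow> z \<in> W \<Longrightarrow> d x z \<le> d x y + d y z"
    and d_complete: "(\<And>n. \<sigma> n \<in> W) \<Longrightarrow> (\<And>n. d (\<sigma> n) (\<sigma> (Suc n)) < (1/2)^n) \<Longrightarrow>
      \<exists>x\<in>W. (\<lambda>n. d (\<sigma> n) x) \<longlonglongrightarrow> 0"
begin

definition pball :: "'w \<Rightarrow> real \<Rightarrow> 'w set" where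
  "pball x r = {y\<in>W. d x y < r}"

definition pm_topology :: "'w topology" where
  "pm_topology = topology (\<lambda>U. U \<subseteq> W \<and> (\<forall>x\<in>U. \<exists>e>0. pball x e \<subseteq> U))"

lemma openin_pm: "openin pm_topology U \<longleftrightarrow> U \<subseteq> W \<and> (\<forall>x\<in>U. \<exists>e>0. pball x e \<subseteq> U)"
proof -
  have "istopology (\<lambda>U. U \<subseteq> W \<and> (\<forall>x\<in>U. \<exists>e>0. pball x e \<subseteq> U))"
    unfolding istopology_def
  proof (intro conjI allI impI)
    fix S T assume S: "S \<subseteq> W \<and> (\<forall>x\<in>S. \<exists>e>0. pball x e \<subseteq> S)"
      and T: "T \<subseteq> W \<and> (\<forall>x\<in>T. \<exists>e>0. pball x e \<subseteq> T)"
    show "S \<inter> T \<subseteq> W" using S by auto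
    show "\<forall>x\<in>S \<inter> T. \<exists>e>0. pball x e \<subseteq> S \<inter> T"
    proof
      fix x assume "x \<in> S \<inter> T"
      then obtain e e' where "e > 0" "pball x e \<subseteq> S" "e' > 0" "pball x e' \<subseteq> T"
        using S T by blast
      then show "\<exists>e>0. pball x e \<subseteq> S \<inter> T"
        by (intro exI[of _ "min e e'"]) (auto simp: pball_def)
    qed
  next
    fix K assume K: "\<forall>U\<in>K. U \<subseteq> W \<and> (\<forall>x\<in>U. \<exists>e>0. pball x e \<subseteq> U)"
    then show "\<Union>K \<subseteq> W" by auto
    show "\<forall>x\<in>\<Union>K. \<exists>e>0. pball x e \<subseteq> \<Union>K"
      using K by (meson Union_iff Union_upper order_trans)
  qed
  then show ?thesis unfolding pm_topology_def by (simp add: topology_inverse')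
qed

lemma topspace_pm [simp]: "topspace pm_topology = W"
proof
  show "topspace pm_topology \<subseteq> W"
    by (auto simp: topspace_def openin_pm)
  have "openin pm_topology W" by (auto simp: openin_pm pball_def intro!: exI[of _ 1])
  then show "W \<subseteq> topspace pm_topology" by (rule openin_subset)
qed

lemma openin_pball: "x \<in> W \<Longrightarrow> openin pm_topology (pball x r)"
  unfolding openin_pm
proof (intro conjI ballI)
  show "pball x r \<subseteq> W" by (auto simp: pball_def)
  fix y assume "x \<in> W" "y \<in> pball x r"
  then show "\<exists>e>0. pball y e \<subseteq> pball x r"
    using d_tri[of x y] by (intro exI[of _ "r - d x y"]) (fastforce simp: pball_def)
qed

lemma continuous_map_real_seqI:
  fixes c :: "'w \<Rightarrow> real"
  assumes "\<And>\<sigma> w. w \<in> W \<Longrightarrow> (\<And>n. \<sigma> n \<in> W) \<Longrightarrow> (\<And>n. d w (\<sigma> n) < (1/2)^n) \<Longrightarrow>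
    (\<lambda>n. c (\<sigma> n)) \<longlonglongrightarrow> c w"
  shows "continuous_map pm_topology euclideanreal c"
  unfolding continuous_map_def
proof (intro conjI allI impI)
  fix U :: "real set" assume U: "openin euclideanreal U"
  show "openin pm_topology {x \<in> topspace pm_topology. c x \<in> U}"
    unfolding openin_pm
  proof (intro conjI ballI)
    fix w assume "w \<in> {x \<in> topspace pm_topology. c x \<in> U}"
    then have w: "w \<in> W" "c w \<in> U" by auto
    show "\<exists>e>0. pball w e \<subseteq> {x \<in> topspace pm_topology. c x \<in> U}"
    proof (rule ccontr)
      assume "\<not> ?thesis"
      then have "\<exists>y. y \<in> pball w ((1/2)^n) \<and> c y \<notin> U" for n :: nat
        by (auto simp: pball_def subset_iff)
      then obtain \<sigma> where \<sigma>: "\<And>n. \<sigma> n \<in> pball w ((1/2)^n)" "\<And>n. c (\<sigma> n) \<notin> U" by metis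
      have "(\<lambda>n. c (\<sigma> n)) \<longlonglongrightarrow> c w"
        by (rule assms) (use w \<sigma>(1) in \<open>auto simp: pball_def\<close>)
      then have "\<forall>\<^sub>F n in sequentially. c (\<sigma> n) \<in> U"
        using U w by (intro topological_tendstoD) auto
      with \<sigma>(2) show False by (auto simp: eventually_sequentially)
    qed
  qed auto
qed auto

text \<open>A Banach--Mazur type argument: a tree of balls in \<open>W\<close> is constructed along with disjoint open
  sets inside their images, so that a point in the intersection of the unions of the levels picks
  out a single branch, and all balls on this branch contain preimages of the point.\<close>

theorem residual_image:
  fixes Y :: "'y topology"
  assumes cont: "continuous_map pm_topology Y f"
    and surj: "topspace Y \<subseteq> f ` W"
    and somewhere_open: "\<And>x e. x \<in> W \<Longrightarrow> e > 0 \<Longrightarrow> \<exists>V. openin Y V \<and> V \<noteq> {} \<and> V \<subseteq> f ` pball x e"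
    and U_open: "\<And>n::nat. openin pm_topology (U n)"
    and U_dense: "\<And>n. pm_topology closure_of (U n) = W"
  shows "\<exists>V. (\<forall>n::nat. openin Y (V n) \<and> Y closure_of (V n) = topspace Y) \<and>
    (\<forall>y\<in>(\<Inter>n. V n). \<exists>x\<in>W. (\<forall>n. x \<in> U n) \<and> (\<forall>Op. openin Y Op \<longrightarrow> f x \<in> Op \<longrightarrow> y \<in> Op))"
proof -
  define child :: "nat \<Rightarrow> 'w set \<times> 'y set \<Rightarrow> 'w set \<times> 'y set \<Rightarrow> bool" where
    "child n p q \<longleftrightarrow> openin Y (snd q) \<and> snd q \<noteq> {} \<and> snd q \<subseteq> f ` fst q \<and> snd q \<subseteq> snd p \<and>
      (\<exists>c\<in>W. \<exists>r>0. r < (1/2)^(n+2) \<and> fst q = pball c r \<and> {y\<in>W. d c y \<le> r} \<subseteq> fst p \<inter> U n)" for n p q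
  define P :: "('w set \<times> 'y set) set \<Rightarrow> bool" where
    "P F \<longleftrightarrow> (\<forall>p\<in>F. openin pm_topology (fst p) \<and> openin Y (snd p) \<and> snd p \<subseteq> f ` fst p) \<and>
       (\<forall>p\<in>F. \<forall>q\<in>F. p \<noteq> q \<longrightarrow> snd p \<inter> snd q = {}) \<and>
       (\<forall>Op. openin Y Op \<longrightarrow> Op \<noteq> {} \<longrightarrow> (\<exists>p\<in>F. Op \<inter> snd p \<noteq> {}))" for F
  define Q where "Q n F F' \<longleftrightarrow> (\<forall>q\<in>F'. \<exists>p\<in>F. child n p q)" for n F F'
  have U_meets: "\<exists>x\<in>Op. x \<in> U n" if "openin pm_topology Op" "Op \<noteq> {}" for Op n
    using U_dense[of n] dense_in_iff_meets_open[of "U n" pm_topology] openin_subset[OF U_open] that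
    by auto
  have child_ex: "\<exists>q. child n p q \<and> snd q \<subseteq> Op"
    if p: "openin pm_topology (fst p)" "snd p \<subseteq> f ` fst p" and Op: "openin Y Op" "Op \<noteq> {}" "Op \<subseteq> snd p"
    for n p Op
  proof -
    let ?G = "{x\<in>W. f x \<in> Op} \<inter> fst p \<inter> U n"
    have o1: "openin pm_topology ({x\<in>W. f x \<in> Op} \<inter> fst p)"
      using cont Op p unfolding continuous_map_def by auto
    have "{x\<in>W. f x \<in> Op} \<inter> fst p \<noteq> {}"
      using Op p openin_subset[OF p(1)] by fastforce
    from U_meets[OF o1 this, of n] obtain c where c: "c \<in> ?G" by auto
    have "openin pm_topology ?G" using o1 U_open by blast
    with c obtain e where e: "e > 0" "pball c e \<subseteq> ?G" unfolding openin_pm by blast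
    have cW: "c \<in> W" using c by auto
    define r where "r = min (e/2) ((1/2)^(n+3))"
    have "r \<le> (1/2)^(n+3)" by (simp add: r_def)
    also have "\<dots> < (1/2)^(n+2)" by (rule power_strict_decreasing) auto
    finally have r: "r > 0" "r < e" "r < (1/2)^(n+2)" using e by (auto simp: r_def min_less_iff_disj)
    obtain V where V: "openin Y V" "V \<noteq> {}" "V \<subseteq> f ` pball c r"
      using somewhere_open[OF cW r(1)] by auto
    have "pball c r \<subseteq> {x\<in>W. f x \<in> Op}" using e(2) r(2) by (auto simp: pball_def)
    then have "V \<subseteq> Op" using V(3) by blast
    moreover have "{y\<in>W. d c y \<le> r} \<subseteq> fst p \<inter> U n" using e(2) r(2) by (auto simp: pball_def)
    ultimately have "child n p (pball c r, V)" using V cW r Op by (auto simp: child_def)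
    with \<open>V \<subseteq> Op\<close> show ?thesis by (intro exI[of _ "(pball c r, V)"]) auto
  qed
  have "\<exists>F. \<forall>n. P (F n) \<and> Q n (F n) (F (Suc n))"
  proof (rule dependent_nat_choice)
    show "\<exists>F. P F"
    proof (intro exI)
      let ?p = "(W, topspace Y)"
      have "openin pm_topology W" using openin_topspace[of pm_topology] by simp
      then have 1: "\<forall>p\<in>{?p}. openin pm_topology (fst p) \<and> openin Y (snd p) \<and> snd p \<subseteq> f ` fst p"
        using surj by simp
      have 2: "\<forall>p\<in>{?p}. \<forall>q\<in>{?p}. p \<noteq> q \<longrightarrow> snd p \<inter> snd q = {}" by simp
      have 3: "\<exists>p\<in>{?p}. Op \<inter> snd p \<noteq> {}" if "openin Y Op" "Op \<noteq> {}" for Op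
        using openin_subset[OF that(1)] that(2) by auto
      show "P {?p}" unfolding P_def by (intro conjI 1 2 allI impI 3)
    qed
  next
    fix F n assume PF: "P F"
    obtain F' where F': "F' \<subseteq> {q. \<exists>p\<in>F. child n p q}"
      "\<forall>p\<in>F'. \<forall>q\<in>F'. p \<noteq> q \<longrightarrow> snd p \<inter> snd q = {}"
      and F'_max: "\<forall>q\<in>{q. \<exists>p\<in>F. child n p q}. snd q \<noteq> {} \<longrightarrow> (\<exists>p\<in>F'. snd p \<inter> snd q \<noteq> {})"
      using maximal_disjoint_subfamily[of "{q. \<exists>p\<in>F. child n p q}" snd] by (elim exE conjE) (rule that)
    have "\<exists>p\<in>F'. Op \<inter> snd p \<noteq> {}" if Op: "openin Y Op" "Op \<noteq> {}" for Op
    proof -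
      obtain p where p: "p \<in> F" "Op \<inter> snd p \<noteq> {}" using PF[unfolded P_def] Op by meson
      with PF have pp: "openin pm_topology (fst p)" "openin Y (snd p)" "snd p \<subseteq> f ` fst p"
        by (auto simp: P_def)
      obtain q where q: "child n p q" "snd q \<subseteq> Op \<inter> snd p"
        using child_ex[OF pp(1,3) openin_Int[OF Op(1) pp(2)] p(2), of n] by blast
      have "snd q \<noteq> {}" using q(1) unfolding child_def by (elim conjE)
      with F'_max p(1) q(1) obtain p' where "p' \<in> F'" "snd p' \<inter> snd q \<noteq> {}" by blast
      with q(2) show ?thesis by (intro bexI[of _ p']) blast+
    qed
    moreover have "openin pm_topology (fst q) \<and> openin Y (snd q) \<and> snd q \<subseteq> f ` fst q" if "q \<in> F'" for q
    proof -
      from F'(1) that obtain p where "child n p q" by blast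
      then show ?thesis unfolding child_def using openin_pball by metis
    qed
    ultimately have "P F'" using F'(2) unfolding P_def by blast
    moreover have "Q n F F'" using F'(1) unfolding Q_def by blast
    ultimately show "\<exists>F'. P F' \<and> Q n F F'" by blast
  qed
  then obtain F where PF: "\<And>n. P (F n)" and QF: "\<And>n. Q n (F n) (F (Suc n))" by blast
  define V where "V n = \<Union>(snd ` F n)" for n
  note F_img = PF[unfolded P_def, THEN conjunct1, THEN bspec]
    and F_disj = PF[unfolded P_def, THEN conjunct2, THEN conjunct1, rule_format]
    and F_dense = PF[unfolded P_def, THEN conjunct2, THEN conjunct2, rule_format]
  have V1: "openin Y (V n)" for n unfolding V_def using F_img by (intro openin_Union) auto
  have V2: "Y closure_of (V n) = topspace Y" for n
    unfolding dense_in_iff_meets_open[OF openin_subset[OF V1[of n]]]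
  proof (intro allI impI)
    fix Op assume "openin Y Op \<and> Op \<noteq> {}"
    then obtain p where "p \<in> F n" "Op \<inter> snd p \<noteq> {}" using F_dense by blast
    then show "\<exists>x\<in>Op. x \<in> V n" unfolding V_def by blast
  qed
  have V3: "\<exists>x\<in>W. (\<forall>n. x \<in> U n) \<and> (\<forall>Op. openin Y Op \<longrightarrow> f x \<in> Op \<longrightarrow> y \<in> Op)" if y: "y \<in> (\<Inter>n. V n)" for y
  proof -
    have "\<forall>n. \<exists>q\<in>F n. y \<in> snd q" using y unfolding V_def by blast
    then obtain q where q: "\<And>n. q n \<in> F n" "\<And>n. y \<in> snd (q n)" by metis
    have ch: "child n (q n) (q (Suc n))" for n
    proof -
      obtain p where p: "p \<in> F n" "child n p (q (Suc n))" using QF[of n] q(1)[of "Suc n"] unfolding Q_def by blast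
      then have "y \<in> snd p" using q(2)[of "Suc n"] unfolding child_def by blast
      then have "p = q n" using F_disj[OF p(1) q(1)] q(2)[of n] by blast
      with p show ?thesis by simp
    qed
    have "\<forall>n. \<exists>cr. fst cr \<in> W \<and> snd cr > 0 \<and> snd cr < (1/2)^(n+2) \<and>
        fst (q (Suc n)) = pball (fst cr) (snd cr) \<and> {y\<in>W. d (fst cr) y \<le> snd cr} \<subseteq> fst (q n) \<inter> U n"
    proof
      fix n
      obtain c r where "c \<in> W" "r > 0" "r < (1/2)^(n+2)" "fst (q (Suc n)) = pball c r"
        "{y\<in>W. d c y \<le> r} \<subseteq> fst (q n) \<inter> U n"
        using ch[of n] unfolding child_def by (elim conjE bexE exE) (rule that)
      then show "\<exists>cr. fst cr \<in> W \<and> snd cr > 0 \<and> snd cr < (1/2)^(n+2) \<and>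
        fst (q (Suc n)) = pball (fst cr) (snd cr) \<and> {y\<in>W. d (fst cr) y \<le> snd cr} \<subseteq> fst (q n) \<inter> U n"
        by (intro exI[of _ "(c, r)"]) simp
    qed
    from choice[OF this] obtain cr where "\<forall>n. fst (cr n) \<in> W \<and> snd (cr n) > 0 \<and> snd (cr n) < (1/2)^(n+2) \<and>
        fst (q (Suc n)) = pball (fst (cr n)) (snd (cr n)) \<and>
        {y\<in>W. d (fst (cr n)) y \<le> snd (cr n)} \<subseteq> fst (q n) \<inter> U n" ..
    then obtain c r where cr: "\<And>n. c n \<in> W" "\<And>n. r n > 0" "\<And>n. r n < (1/2)^(n+2)"
      "\<And>n. fst (q (Suc n)) = pball (c n) (r n)" "\<And>n. {y\<in>W. d (c n) y \<le> r n} \<subseteq> fst (q n) \<inter> U n"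
      by (intro that[of "fst \<circ> cr" "snd \<circ> cr"]) auto
    have dec: "fst (q (Suc n)) \<subseteq> fst (q n)" for n
      using cr(4,5)[of n] by (auto simp: pball_def)
    have dec': "fst (q m) \<subseteq> fst (q n)" if "n \<le> m" for n m
      using that by (induction rule: dec_induct) (use dec in auto)
    have "\<forall>n. \<exists>x. x \<in> fst (q (Suc n)) \<and> f x = y"
    proof
      fix n
      have "snd (q (Suc n)) \<subseteq> f ` fst (q (Suc n))" using F_img[OF q(1)] by blast
      with q(2)[of "Suc n"] show "\<exists>x. x \<in> fst (q (Suc n)) \<and> f x = y" by blast
    qed
    then obtain s where s: "\<And>n. s n \<in> fst (q (Suc n))" "\<And>n. f (s n) = y" by metis
    have sW: "s n \<in> W" for n using s(1)[of n] cr(4)[of n] by (auto simp: pball_def)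
    have near: "d (c n) (s m) < r n" if "n \<le> m" for n m
      using dec'[of "Suc n" "Suc m"] s(1)[of m] cr(4)[of n] that by (auto simp: pball_def)
    have "d (s n) (s (Suc n)) < (1/2)^n" for n
    proof -
      have "d (s n) (s (Suc n)) \<le> d (c n) (s n) + d (c n) (s (Suc n))"
        using d_tri[OF sW[of n] cr(1)[of n] sW[of "Suc n"]] d_sym[OF sW[of n] cr(1)[of n]] by simp
      also have "\<dots> < (1/2)^(n+2) + (1/2)^(n+2)" using near[of n n] near[of n "Suc n"] cr(3)[of n] by simp
      also have "\<dots> \<le> (1/2)^n" by simp
      finally show ?thesis .
    qed
    from d_complete[OF sW this] obtain x where x: "x \<in> W" "(\<lambda>n. d (s n) x) \<longlonglongrightarrow> 0" by blast
    have "d (c n) x \<le> r n" for n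
    proof (rule LIMSEQ_le_const)
      show "(\<lambda>m. r n + d (s m) x) \<longlonglongrightarrow> r n" using tendsto_add[OF tendsto_const x(2), of "r n"] by simp
      show "\<exists>N. \<forall>m\<ge>N. d (c n) x \<le> r n + d (s m) x"
        using near[of n] d_tri[OF cr(1)[of n] sW x(1)] by (intro exI[of _ n]) (smt (verit))
    qed
    then have xU: "x \<in> U n" for n using cr(5)[of n] x(1) by auto
    have "y \<in> Op" if Op: "openin Y Op" "f x \<in> Op" for Op
    proof -
      have "openin pm_topology {z\<in>W. f z \<in> Op}" using cont Op unfolding continuous_map_def by auto
      then obtain e where e: "e > 0" "pball x e \<subseteq> {z\<in>W. f z \<in> Op}"
        using x(1) Op(2) unfolding openin_pm by blast
      have "\<forall>\<^sub>F n in sequentially. d (s n) x < e" using x(2) e(1) by (rule order_tendstoD)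
      then obtain n where "d (s n) x < e" by (auto simp: eventually_sequentially)
      then have "s n \<in> pball x e" using d_sym[OF sW[of n] x(1)] sW by (simp add: pball_def)
      with e(2) s(2)[of n] show "y \<in> Op" by auto
    qed
    with x(1) xU show ?thesis by blast
  qed
  show ?thesis using V1 V2 V3 by blast
qed

lemma dense_preimage:
  assumes cont: "continuous_map pm_topology Y f"
    and somewhere_open: "\<And>x e. x \<in> W \<Longrightarrow> e > 0 \<Longrightarrow> \<exists>V. openin Y V \<and> V \<noteq> {} \<and> V \<subseteq> f ` pball x e"
    and Op: "openin Y Op" "Y closure_of Op = topspace Y"
  shows "openin pm_topology {x\<in>W. f x \<in> Op}" "pm_topology closure_of {x\<in>W. f x \<in> Op} = W"
proof -
  show op: "openin pm_topology {x\<in>W. f x \<in> Op}" using cont Op unfolding continuous_map_def by auto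
  have "\<exists>x\<in>G. x \<in> {x\<in>W. f x \<in> Op}" if G: "openin pm_topology G" "G \<noteq> {}" for G
  proof -
    obtain x e where x: "x \<in> G" "e > 0" "pball x e \<subseteq> G" using G unfolding openin_pm by blast
    then have "x \<in> W" using openin_subset[OF G(1)] by auto
    from somewhere_open[OF this x(2)] obtain V
      where V: "openin Y V" "V \<noteq> {}" "V \<subseteq> f ` pball x e" by auto
    have "\<exists>v\<in>V. v \<in> Op"
      using iffD1[OF dense_in_iff_meets_open[OF openin_subset[OF Op(1)]] Op(2), rule_format, of V] V by simp
    then obtain v where "v \<in> V" "v \<in> Op" by auto
    with V(3) obtain u where "u \<in> pball x e" "f u \<in> Op" by (metis imageE subsetD)
    moreover from this have "u \<in> W" by (simp add: pball_def)
    ultimately show ?thesis using subsetD[OF x(3)] by blast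
  qed
  then show "pm_topology closure_of {x\<in>W. f x \<in> Op} = W"
    using dense_in_iff_meets_open[of "{x\<in>W. f x \<in> Op}" pm_topology] unfolding topspace_pm by blast
qed

lemma dense_Int_open:
  assumes "openin T A" "T closure_of A = topspace T" "openin T B" "T closure_of B = topspace T"
  shows "T closure_of (A \<inter> B) = topspace T"
proof -
  have "\<exists>x\<in>Op. x \<in> A \<inter> B" if Op: "openin T Op" "Op \<noteq> {}" for Op
  proof -
    have "\<exists>x\<in>Op. x \<in> A" using assms dense_in_iff_meets_open[OF openin_subset] Op by blast
    then have "openin T (Op \<inter> A)" "Op \<inter> A \<noteq> {}" using assms Op by auto
    then have "\<exists>x\<in>Op \<inter> A. x \<in> B" using assms dense_in_iff_meets_open[OF openin_subset] by blast
    then show ?thesis by auto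
  qed
  then show ?thesis using assms dense_in_iff_meets_open[of "A \<inter> B" T] openin_subset[of T A] by blast
qed

end

section \<open>Polish probability spaces and the unit interval\<close>

definition bits_code :: "(nat \<Rightarrow> bool) \<Rightarrow> real" where
  "bits_code b = (\<Sum>k. of_bool (b k) * (1/4)^Suc k)"

lemma summable_bits_code: "summable (\<lambda>k. of_bool (b k) * (1/4::real)^Suc k)"
proof (rule summable_comparison_test')
  show "summable (\<lambda>k. (1/4::real)^Suc k)" by (subst summable_Suc_iff) (simp add: summable_geometric)
  show "norm (of_bool (b k) * (1/4::real)^Suc k) \<le> (1/4)^Suc k" for k by auto
qed

lemma bits_code_range: "0 \<le> bits_code b" "bits_code b \<le> 1/3"
proof -
  show "0 \<le> bits_code b" unfolding bits_code_def by (rule suminf_nonneg[OF summable_bits_code]) auto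
  have s: "(\<lambda>k. (1/4::real)^Suc k) sums (1/3)"
    using sums_mult[OF geometric_sums[of "1/4::real"], of "1/4"] by simp
  have "bits_code b \<le> (\<Sum>k. (1/4::real)^Suc k)"
    unfolding bits_code_def by (rule suminf_le[OF _ summable_bits_code sums_summable[OF s]]) auto
  also have "\<dots> = 1/3" using sums_unique[OF s] by simp
  finally show "bits_code b \<le> 1/3" .
qed

lemma bits_code_Suc: "4 * bits_code b = of_bool (b 0) + bits_code (\<lambda>k. b (Suc k))"
proof -
  have "bits_code b = of_bool (b 0) * (1/4) + (\<Sum>k. of_bool (b (Suc k)) * (1/4::real)^Suc (Suc k))"
    unfolding bits_code_def using suminf_split_head[OF summable_bits_code[of b]] by simp
  also have "(\<Sum>k. of_bool (b (Suc k)) * (1/4::real)^Suc (Suc k)) = (1/4) * bits_code (\<lambda>k. b (Suc k))"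
    unfolding bits_code_def using suminf_mult[OF summable_bits_code[of "\<lambda>k. b (Suc k)"], of "1/4"]
    by (simp add: mult.left_commute)
  finally show ?thesis by simp
qed

lemma bits_decode: "odd \<lfloor>4^Suc k * bits_code b\<rfloor> \<longleftrightarrow> b k"
proof (induction k arbitrary: b)
  case 0
  have "\<lfloor>4 * bits_code b\<rfloor> = (if b 0 then 1 else 0)"
    unfolding bits_code_Suc using bits_code_range[of "\<lambda>k. b (Suc k)"] by (auto simp: floor_eq_iff)
  then show ?case by simp
next
  case (Suc k)
  have "4^Suc (Suc k) * bits_code b = 4^Suc k * (4 * bits_code b)" by simp
  also have "\<dots> = of_int (4^Suc k * of_bool (b 0)) + 4^Suc k * bits_code (\<lambda>k. b (Suc k))"
    unfolding bits_code_Suc by (simp add: algebra_simps)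
  finally have "\<lfloor>4^Suc (Suc k) * bits_code b\<rfloor> =
      4^Suc k * of_bool (b 0) + \<lfloor>4^Suc k * bits_code (\<lambda>k. b (Suc k))\<rfloor>"
    by (simp only: int_add_floor)
  then show ?case using Suc[of "\<lambda>k. b (Suc k)"] by simp
qed

lemma borel_limit_selection:
  fixes s :: "nat \<Rightarrow> 'a \<Rightarrow> 'b::polish_space"
  assumes [measurable]: "\<And>n. s n \<in> borel_measurable M"
  shows "\<exists>\<psi>\<in>borel_measurable M. \<forall>x\<in>space M. Cauchy (\<lambda>n. s n x) \<longrightarrow> (\<lambda>n. s n x) \<longlonglongrightarrow> \<psi> x"
proof -
  define s' where "s' n x = (if Cauchy (\<lambda>n. s n x) then s n x else undefined)" for n x
  have [measurable]: "s' n \<in> borel_measurable M" for n unfolding s'_def by measurable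
  have "convergent (\<lambda>n. s' n x)" for x
    by (cases "Cauchy (\<lambda>n. s n x)") (simp_all add: s'_def Cauchy_convergent convergent_const)
  then have lim: "(\<lambda>n. s' n x) \<longlonglongrightarrow> lim (\<lambda>n. s' n x)" for x by (simp add: convergent_LIMSEQ_iff)
  have "(\<lambda>x. lim (\<lambda>n. s' n x)) \<in> borel_measurable M"
    by (rule borel_measurable_LIMSEQ_metric[OF _ lim]) simp
  moreover have "(\<lambda>n. s n x) \<longlonglongrightarrow> lim (\<lambda>n. s' n x)" if "Cauchy (\<lambda>n. s n x)" for x
    using lim[of x] that by (simp add: s'_def)
  ultimately show ?thesis by (intro bexI[of _ "\<lambda>x. lim (\<lambda>n. s' n x)"]) auto
qed

lemma polish_dense_sequence: "\<exists>D :: nat \<Rightarrow> 'a::polish_space. \<forall>x e. e > 0 \<longrightarrow> (\<exists>k. dist x (D k) < e)"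
proof -
  obtain C :: "'a set" where C: "countable C" "\<And>X. open X \<Longrightarrow> X \<noteq> {} \<Longrightarrow> \<exists>d\<in>C. d \<in> X"
    using countable_dense_exists by (metis (no_types, lifting))
  have "C \<noteq> {}" using C(2)[of UNIV] by auto
  have "\<exists>k. dist x (from_nat_into C k) < e" if "e > 0" for x :: 'a and e
  proof -
    have "ball x e \<noteq> {}" using that by simp
    then obtain d where "d \<in> C" "d \<in> ball x e" using C(2)[OF open_ball] by blast
    then show ?thesis using from_nat_into_surj[OF C(1), of d] by auto
  qed
  then show ?thesis by blast
qed

lemma polish_real_retract:
  "\<exists>(i :: 'a::polish_space \<Rightarrow> real) \<psi>. i \<in> borel_measurable borel \<and> \<psi> \<in> borel_measurable borel \<and>
     (\<forall>x. \<psi> (i x) = x) \<and> (\<forall>x. 0 < i x \<and> i x < 1)"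
proof -
  obtain D :: "nat \<Rightarrow> 'a" where D: "\<And>x e. e > 0 \<Longrightarrow> \<exists>k. dist x (D k) < e"
    using polish_dense_sequence by blast
  define b where "b x m = (case prod_decode m of (n, k) \<Rightarrow> dist x (D k) < (1/2)^n)" for x m
  define i where "i x = 1/3 + bits_code (b x)" for x
  define dec where "dec t m = odd \<lfloor>4^Suc m * (t - 1/3 :: real)\<rfloor>" for t m
  have dec: "dec (i x) (prod_encode (n, k)) \<longleftrightarrow> dist x (D k) < (1/2)^n" for x n k
    unfolding dec_def i_def by (simp only: add_diff_cancel_left' bits_decode) (simp add: b_def)
  have [measurable]: "(\<lambda>x. b x m) \<in> measurable borel (count_space UNIV)" for m
    unfolding b_def by (cases "prod_decode m") simp
  have i_meas: "i \<in> borel_measurable borel"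
    unfolding i_def bits_code_def by measurable
  have [measurable]: "(\<lambda>t. dec t m) \<in> measurable borel (count_space UNIV)" for m
    unfolding dec_def by measurable
  define s where "s n t = D (LEAST k. dec t (prod_encode (n, k)))" for n t
  have [measurable]: "s n \<in> borel_measurable borel" for n
    unfolding s_def by measurable
  have close: "dist x (s n (i x)) < (1/2)^n" for x n
    unfolding s_def dec by (rule LeastI_ex) (rule D, simp)
  have lim: "(\<lambda>n. s n (i x)) \<longlonglongrightarrow> x" for x
  proof (rule metric_tendsto_imp_tendsto)
    show "(\<lambda>n. (1/2::real)^n) \<longlonglongrightarrow> 0" by (rule LIMSEQ_power_zero) simp
    show "\<forall>\<^sub>F n in sequentially. dist (s n (i x)) x \<le> dist ((1/2::real)^n) 0"
      using close[of x] by (intro always_eventually allI) (simp add: dist_commute less_imp_le)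
  qed
  obtain \<psi> where \<psi>: "\<psi> \<in> borel_measurable borel"
    "\<And>t. Cauchy (\<lambda>n. s n t) \<Longrightarrow> (\<lambda>n. s n t) \<longlonglongrightarrow> \<psi> t"
    using borel_limit_selection[of s borel] by auto
  have "\<psi> (i x) = x" for x
    using LIMSEQ_unique[OF \<psi>(2)[OF LIMSEQ_imp_Cauchy[OF lim[of x]]] lim[of x]] .
  moreover have "0 < i x \<and> i x < 1" for x
    using bits_code_range[of "b x"] by (simp add: i_def)
  ultimately show ?thesis using i_meas \<psi>(1) by blast
qed

definition unit_lebesgue :: "real measure" where
  "unit_lebesgue = distr (restrict_space lborel {0<..<1}) borel (\<lambda>x. x)"

lemma unit_lebesgue:
  shows sets_unit_lebesgue: "sets unit_lebesgue = sets borel"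
    and prob_space_unit_lebesgue: "prob_space unit_lebesgue"
    and emeasure_unit_lebesgue_singleton: "emeasure unit_lebesgue {t} = 0"
proof -
  have m: "(\<lambda>x. x) \<in> measurable (restrict_space lborel {0<..<1}) (borel :: real measure)"
    by (rule measurable_restrict_space1) simp
  show "sets unit_lebesgue = sets borel" by (simp add: unit_lebesgue_def)
  have "prob_space (restrict_space lborel {0<..<1::real})"
    by (auto simp add: emeasure_restrict_space space_restrict_space intro!: prob_spaceI)
  then show "prob_space unit_lebesgue"
    unfolding unit_lebesgue_def by (rule prob_space.prob_space_distr[OF _ m])
  have "emeasure unit_lebesgue {t} = emeasure (restrict_space lborel {0<..<1}) ({t} \<inter> {0<..<1})"
    unfolding unit_lebesgue_def by (subst emeasure_distr[OF m]) (auto simp: space_restrict_space)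
  also have "\<dots> = emeasure lborel ({t} \<inter> {0<..<1})"
    by (subst emeasure_restrict_space) auto
  also have "\<dots> = 0" using emeasure_mono[of "{t} \<inter> {0<..<1}" "{t}" lborel] by simp
  finally show "emeasure unit_lebesgue {t} = 0" .
qed

lemma measure_unit_lebesgue_interval:
  assumes "0 \<le> a" "a \<le> b" "b \<le> 1"
  shows "measure unit_lebesgue {a..<b} = b - a"
proof -
  have m: "(\<lambda>x. x) \<in> measurable (restrict_space lborel {0<..<1}) (borel :: real measure)"
    by (rule measurable_restrict_space1) simp
  have "emeasure unit_lebesgue {a..<b} = emeasure (restrict_space lborel {0<..<1}) ({a..<b} \<inter> {0<..<1})"
    unfolding unit_lebesgue_def by (subst emeasure_distr[OF m]) (auto simp: space_restrict_space)
  also have "\<dots> = emeasure lborel ({a..<b} \<inter> {0<..<1})"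
    by (subst emeasure_restrict_space) auto
  also have "\<dots> = emeasure lborel {a..<b}"
  proof (rule emeasure_eq_AE)
    show "AE x in lborel. (x \<in> {a..<b} \<inter> {0<..<1}) = (x \<in> {a..<b})"
      using AE_lborel_singleton[of 0] by eventually_elim (use assms in auto)
  qed auto
  also have "\<dots> = ennreal (b - a)" using assms by simp
  finally show ?thesis using assms by (simp add: measure_def)
qed

text \<open>The isomorphism is \<open>F \<circ> (l + i)\<close>, where \<open>i\<close> embeds the space into the unit interval and \<open>F\<close> is
  the distribution function of \<open>l + i\<close>; it thus sends the level sets of \<open>l\<close> to consecutive intervals.\<close>

lemma nonatomic_iso_unit_lebesgue:
  fixes N :: "'a::polish_space measure" and l :: "'a \<Rightarrow> nat"
  assumes sets_N [measurable_cong]: "sets N = sets borel" and "prob_space N"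
    and nonatomic: "\<And>x. emeasure N {x} = 0"
    and l [measurable]: "l \<in> measurable borel (count_space UNIV)"
  shows "\<exists>f f'. f \<in> borel_measurable borel \<and> f' \<in> borel_measurable borel \<and>
    distr N borel f = unit_lebesgue \<and> (AE x in N. f' (f x) = x) \<and> (AE t in unit_lebesgue. f (f' t) = t) \<and>
    (\<forall>j. AE x in N. f x < measure N {x. l x < j} \<longleftrightarrow> l x < j)"
proof -
  interpret N: prob_space N by fact
  have space_N: "space N = UNIV" using sets_eq_imp_space_eq[OF sets_N] by simp
  obtain i :: "'a \<Rightarrow> real" and \<psi> where [measurable]: "i \<in> borel_measurable borel" "\<psi> \<in> borel_measurable borel"
    and \<psi>: "\<And>x. \<psi> (i x) = x" and i: "\<And>x. 0 < i x" "\<And>x. i x < 1"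
    using polish_real_retract[where 'a='a] by blast
  define g where "g x = real (l x) + i x" for x
  have [measurable]: "g \<in> borel_measurable borel" unfolding g_def by measurable
  have frac_g: "\<psi> (g x - real_of_int \<lfloor>g x\<rfloor>) = x" for x
  proof -
    have "\<lfloor>g x\<rfloor> = int (l x)" unfolding g_def using i[of x] by (simp add: floor_eq_iff)
    then show ?thesis using \<psi>[of x] by (simp add: g_def)
  qed
  define m where "m = distr N borel g"
  have g_N: "g \<in> borel_measurable N" by measurable
  interpret m: prob_space m unfolding m_def by (rule N.prob_space_distr[OF g_N])
  have rd: "real_distribution m"
    by (intro real_distribution.intro real_distribution_axioms.intro) (use m.prob_space_axioms in \<open>simp_all add: m_def\<close>)
  interpret m: cdf_distribution m unfolding cdf_distribution_def by (rule rd)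
  define F where "F = cdf m"
  have [measurable]: "F \<in> borel_measurable borel" unfolding F_def by (rule m.measurable_C)
  define I where "I t = Inf {x. t \<le> F x}" for t
  have pseudo: "t \<le> F y \<longleftrightarrow> I t \<le> y" if "0 < t" "t < 1" for t y
    using m.pseudoinverse[OF that] unfolding F_def I_def .
  have "measure m {c} = 0" for c
  proof -
    have "g -` {c} \<subseteq> {\<psi> (c - real_of_int \<lfloor>c\<rfloor>)}" using frac_g by auto
    then have "emeasure N (g -` {c}) \<le> emeasure N {\<psi> (c - real_of_int \<lfloor>c\<rfloor>)}"
      by (intro emeasure_mono) (auto simp: sets_N)
    then have "emeasure m {c} = 0"
      unfolding m_def by (subst emeasure_distr[OF g_N]) (auto simp: space_N nonatomic)
    then show ?thesis by (simp add: measure_def)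
  qed
  then have F_cont: "isCont F c" for c unfolding F_def using m.isCont_cdf by blast
  have F_I: "F (I t) = t" if t: "0 < t" "t < 1" for t
  proof (rule antisym)
    show "t \<le> F (I t)" using pseudo[OF t] by simp
    show "F (I t) \<le> t"
    proof (rule tendsto_upperbound)
      show "(F \<longlongrightarrow> F (I t)) (at_left (I t))"
        using F_cont[of "I t"] by (auto simp: isCont_def filterlim_at_split)
      show "\<forall>\<^sub>F y in at_left (I t). F y \<le> t"
        unfolding eventually_at_filter
      proof (intro always_eventually allI impI)
        fix y assume "y \<in> {..<I t}"
        then show "F y \<le> t" using pseudo[OF t, of y] by simp
      qed
    qed simp
  qed
  let ?O = "restrict_space lborel {0<..<1::real}"
  have I_meas: "I \<in> borel_measurable ?O"
    using m.measurable_CI unfolding I_def[abs_def] F_def[symmetric]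
    by (simp cong: measurable_cong_sets)
  have m_I: "distr ?O borel I = m" unfolding I_def[abs_def] F_def by (rule m.distr_I_eq_M)
  define f where "f x = F (g x)" for x
  have f_meas: "f \<in> borel_measurable borel" unfolding f_def by measurable
  have "distr N borel f = distr m borel F"
    unfolding m_def by (subst distr_distr[OF _ g_N]) (auto simp: comp_def f_def[abs_def])
  also have "\<dots> = distr ?O borel (F \<circ> I)"
    unfolding m_I[symmetric] by (rule distr_distr[OF _ I_meas]) simp
  also have "\<dots> = unit_lebesgue"
    unfolding unit_lebesgue_def by (rule distr_cong) (auto simp: space_restrict_space F_I)
  finally have distr_f: "distr N borel f = unit_lebesgue" .
  define I0 where "I0 t = (if 0 < t \<and> t < 1 then I t else 0)" for t :: real
  have I0_meas [measurable]: "I0 \<in> borel_measurable borel"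
  proof -
    have "I \<in> borel_measurable (restrict_space borel {0<..<1})"
      using m.measurable_CI unfolding I_def[abs_def] F_def[symmetric] .
    then have "(\<lambda>t. if t \<in> {0<..<1} then I t else 0) \<in> borel_measurable borel"
      by (subst (asm) measurable_restrict_space_iff[where c = 0]) auto
    then show ?thesis by (simp add: I0_def[abs_def])
  qed
  have AE_m: "AE y in m. I0 (F y) = y"
  proof -
    have "AE t in ?O. I0 (F (I t)) = I t"
      by (rule AE_I2) (auto simp: space_restrict_space F_I I0_def)
    then have "AE y in distr ?O borel I. I0 (F y) = y"
      by (subst AE_distr_iff[OF I_meas]) auto
    then show ?thesis unfolding m_I .
  qed
  define f' where "f' t = \<psi> (I0 t - real_of_int \<lfloor>I0 t\<rfloor>)" for t
  have f'_meas: "f' \<in> borel_measurable borel" unfolding f'_def by measurable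
  have inv1: "AE x in N. f' (f x) = x"
  proof -
    have "AE x in N. I0 (F (g x)) = g x"
      using AE_m unfolding m_def by (subst (asm) AE_distr_iff[OF g_N]) auto
    then show ?thesis by eventually_elim (simp add: f'_def f_def frac_g)
  qed
  have f_N: "f \<in> borel_measurable N" using f_meas by (simp cong: measurable_cong_sets)
  have inv2: "AE t in unit_lebesgue. f (f' t) = t"
    unfolding distr_f[symmetric]
  proof (subst AE_distr_iff[OF f_N])
    show "{x \<in> space borel. f (f' x) = x} \<in> sets borel" using f_meas f'_meas by measurable
    show "AE x in N. f (f' (f x)) = f x" using inv1 by eventually_elim simp
  qed
  have lab: "AE x in N. f x < measure N {x. l x < j} \<longleftrightarrow> l x < j" for j
  proof -
    have g_j: "g x \<le> real j \<longleftrightarrow> l x < j" for x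
      using i[of x] unfolding g_def by (cases "l x < j") (auto simp: not_less intro: order_trans)
    have "F (real j) = measure N (g -` {..real j})"
      unfolding F_def cdf_def m_def by (subst measure_distr[OF g_N]) (auto simp: space_N)
    then have c: "measure N {x. l x < j} = F (real j)"
      by (simp add: vimage_def g_j)
    have mono: "F a \<le> F b" if "a \<le> b" for a b
      unfolding F_def by (rule m.cdf_nondecreasing[OF that])
    have "AE t in unit_lebesgue. t \<noteq> F (real j)"
      by (rule AE_I[of _ _ "{F (real j)}"]) (auto simp: emeasure_unit_lebesgue_singleton sets_unit_lebesgue)
    then have "AE x in N. f x \<noteq> F (real j)"
      unfolding distr_f[symmetric] by (subst (asm) AE_distr_iff[OF f_N]) auto
    then show ?thesis
    proof eventually_elim
      case (elim x)
      then show ?case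
        unfolding c using mono[of "g x" "real j"] mono[of "real j" "g x"] g_j[of x]
        unfolding f_def by linarith
    qed
  qed
  show ?thesis using f_meas f'_meas distr_f inv1 inv2 lab by blast
qed

section \<open>Convergence in measure\<close>

lemma measure_tendsto_zero_AE:
  assumes "finite_measure N" and [measurable]: "\<And>n::nat. A n \<in> sets N"
    and ev: "AE x in N. \<forall>\<^sub>F n in sequentially. x \<notin> A n"
  shows "(\<lambda>n. measure N (A n)) \<longlonglongrightarrow> 0"
proof -
  interpret finite_measure N by fact
  have "(\<lambda>n. \<integral>x. indicator (A n) x \<partial>N) \<longlonglongrightarrow> (\<integral>x. (0::real) \<partial>N)"
  proof (rule integral_dominated_convergence[where w = "\<lambda>_. 1"])
    show "AE x in N. (\<lambda>n. indicator (A n) x :: real) \<longlonglongrightarrow> 0"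
      using ev
    proof eventually_elim
      case (elim x)
      then have "\<forall>\<^sub>F n in sequentially. indicator (A n) x = (0::real)"
        by eventually_elim simp
      then show ?case by (rule tendsto_eventually)
    qed
    show "AE x in N. norm (indicator (A n) x :: real) \<le> 1" for n
      by (auto simp: indicator_def)
  qed auto
  then show ?thesis by simp
qed

lemma finite_small_partition:
  fixes N :: "'a measure" and u :: "'a \<Rightarrow> 'b::polish_space"
  assumes "finite_measure N" and u [measurable]: "u \<in> borel_measurable N" and e: "e > 0"
  shows "\<exists>(k :: 'a \<Rightarrow> nat) m. k \<in> measurable N (count_space UNIV) \<and> (\<forall>x. k x \<le> m) \<and>
    measure N {x\<in>space N. k x = 0} < e \<and> (\<forall>x y. k x = k y \<longrightarrow> k x \<noteq> 0 \<longrightarrow> dist (u x) (u y) < e)"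
proof -
  obtain D :: "nat \<Rightarrow> 'b" where D: "\<And>x e. e > 0 \<Longrightarrow> \<exists>k. dist x (D k) < e"
    using polish_dense_sequence by blast
  define K where "K x = (LEAST j. dist (u x) (D j) < e/2)" for x
  have [measurable]: "K \<in> measurable N (count_space UNIV)" unfolding K_def by measurable
  have K: "dist (u x) (D (K x)) < e/2" for x
    unfolding K_def by (rule LeastI_ex) (rule D, use e in simp)
  have "(\<lambda>m. measure N {x\<in>space N. m < K x}) \<longlonglongrightarrow> 0"
  proof (rule measure_tendsto_zero_AE[OF assms(1)])
    show "AE x in N. \<forall>\<^sub>F m in sequentially. x \<notin> {x \<in> space N. m < K x}"
    proof (rule AE_I2)
      fix x show "\<forall>\<^sub>F m in sequentially. x \<notin> {x \<in> space N. m < K x}"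
        using eventually_ge_at_top[of "K x"] by eventually_elim auto
    qed
  qed measurable
  then have "\<forall>\<^sub>F m in sequentially. measure N {x\<in>space N. m < K x} < e"
    using e by (rule order_tendstoD)
  then obtain m where m: "measure N {x\<in>space N. m < K x} < e"
    by (auto simp: eventually_sequentially)
  define k where "k x = (if m < K x then 0 else Suc (K x))" for x
  have "k \<in> measurable N (count_space UNIV)" unfolding k_def by measurable
  moreover have "\<forall>x. k x \<le> Suc m" by (simp add: k_def)
  moreover have "{x\<in>space N. k x = 0} = {x\<in>space N. m < K x}" by (auto simp: k_def)
  moreover have "dist (u x) (u y) < e" if "k x = k y" "k x \<noteq> 0" for x y
  proof -
    have "K x = K y" using that by (simp add: k_def split: if_splits)
    then show ?thesis using K[of x] K[of y] dist_triangle_half_l[of "u x" "D (K x)" e "u y"] by simp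
  qed
  ultimately show ?thesis using m by (intro exI[of _ k] exI[of _ "Suc m"]) auto
qed

lemma outer_open_approx:
  fixes N :: "'a::polish_space measure"
  assumes "sets N = sets borel" "finite_measure N" "B \<in> sets borel" "e > 0"
  shows "\<exists>Op. open Op \<and> B \<subseteq> Op \<and> measure N Op < measure N B + e"
proof -
  interpret finite_measure N by fact
  have "emeasure N B = (INF U\<in>{U. B \<subseteq> U \<and> open U}. emeasure N U)"
    by (rule outer_regular) (use assms in \<open>auto simp: emeasure_finite\<close>)
  moreover have "emeasure N B < emeasure N B + ennreal e"
    using assms(4) emeasure_finite[of B] by (simp add: ennreal_add_left_cancel_less less_top[symmetric] zero_less_iff_neq_zero[symmetric])
  ultimately obtain U where U: "B \<subseteq> U" "open U" "emeasure N U < emeasure N B + ennreal e"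
    by (auto simp: INF_less_iff)
  then have "measure N U < measure N B + e"
    using assms(4) by (simp add: emeasure_eq_measure ennreal_plus[symmetric] ennreal_less_iff del: ennreal_plus)
  with U show ?thesis by blast
qed

lemma inner_closed_approx:
  fixes N :: "'a::polish_space measure"
  assumes s: "sets N = sets borel" and "finite_measure N" and B: "B \<in> sets borel" and "e > 0"
  shows "\<exists>F. closed F \<and> F \<subseteq> B \<and> measure N (B - F) < e"
proof -
  interpret finite_measure N by fact
  have sp: "space N = UNIV" using sets_eq_imp_space_eq[OF s] by simp
  have "- B \<in> sets borel" using B by auto
  from outer_open_approx[OF s assms(2) this assms(4)] obtain Op
    where Op: "open Op" "- B \<subseteq> Op" "measure N Op < measure N (- B) + e" by blast
  have eq: "B - (- Op) = Op - (- B)" by auto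
  have "measure N (Op - (- B)) = measure N Op - measure N (- B)"
    by (rule finite_measure_Diff) (use Op B in \<open>auto simp: s\<close>)
  then show ?thesis using Op eq by (intro exI[of _ "- Op"]) auto
qed

lemma tendsto_zero_le_eps:
  fixes f :: "nat \<Rightarrow> real"
  assumes "\<And>n. 0 \<le> f n" "\<And>e. e > 0 \<Longrightarrow> \<exists>g. g \<longlonglongrightarrow> 0 \<and> (\<forall>n. f n \<le> e + g n)"
  shows "f \<longlonglongrightarrow> 0"
proof (rule LIMSEQ_I)
  fix r :: real assume "0 < r"
  then obtain g where g: "g \<longlonglongrightarrow> 0" "\<And>n. f n \<le> r/2 + g n" using assms(2)[of "r/2"] by auto
  have "\<forall>\<^sub>F n in sequentially. g n < r/2" using g(1) \<open>0 < r\<close> by (intro order_tendstoD) auto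
  then obtain no where "\<And>n. n \<ge> no \<Longrightarrow> g n < r/2" by (auto simp: eventually_sequentially)
  then have "f n < r" if "n \<ge> no" for n using g(2)[of n] that by fastforce
  then have "\<forall>n\<ge>no. norm (f n - 0) < r" using assms(1) by simp
  then show "\<exists>no. \<forall>n\<ge>no. norm (f n - 0) < r" by blast
qed

context
  fixes N :: "'a::polish_space measure" and T :: "nat \<Rightarrow> 'a \<Rightarrow> 'a" and S :: "'a \<Rightarrow> 'a" and C :: real
  assumes sets_N [measurable_cong]: "sets N = sets borel" and fin: "finite_measure N"
    and T [measurable]: "\<And>n. T n \<in> borel_measurable borel" and S [measurable]: "S \<in> borel_measurable borel"
    and lim: "AE x in N. (\<lambda>n. T n x) \<longlonglongrightarrow> S x"
    and bound: "\<And>n B. B \<in> sets borel \<Longrightarrow> measure N (T n -` B) \<le> C * measure N B" and C: "0 \<le> C"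
begin

lemma vimage_sets_N: "f \<in> borel_measurable borel \<Longrightarrow> B \<in> sets borel \<Longrightarrow> f -` B \<in> sets N"
  using measurable_sets[of f borel borel B] by (simp add: sets_N)

lemma closed_vimage_diff_tendsto:
  assumes "closed F"
  shows "(\<lambda>n. measure N (T n -` F - S -` F)) \<longlonglongrightarrow> 0"
proof (rule measure_tendsto_zero_AE[OF fin])
  show "T n -` F - S -` F \<in> sets N" for n
    using assms by (intro sets.Diff vimage_sets_N T S) auto
  show "AE x in N. \<forall>\<^sub>F n in sequentially. x \<notin> T n -` F - S -` F"
    using lim
  proof eventually_elim
    case (elim x)
    show ?case
    proof (cases "S x \<in> F")
      case False
      then have "\<forall>\<^sub>F n in sequentially. T n x \<in> - F"
        using elim assms by (intro topological_tendstoD) auto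
      then show ?thesis by eventually_elim auto
    qed simp
  qed
qed

lemma vimage_diff_tendsto:
  assumes B: "B \<in> sets borel"
  shows "(\<lambda>n. measure N (T n -` B - S -` B)) \<longlonglongrightarrow> 0"
proof (rule tendsto_zero_le_eps)
  interpret finite_measure N by (rule fin)
  fix e :: real assume e: "e > 0"
  then have "e / (C + 1) > 0" using C by simp
  from inner_closed_approx[OF sets_N fin B this] obtain F
    where F: "closed F" "F \<subseteq> B" "measure N (B - F) < e / (C+1)" by blast
  have "measure N (T n -` B - S -` B) \<le> e + measure N (T n -` F - S -` F)" for n
  proof -
    have [measurable]: "F \<in> sets borel" using F by auto
    have s: "T n -` (B - F) \<in> sets N" "T n -` F - S -` F \<in> sets N"
      using B by (intro sets.Diff vimage_sets_N T S; auto)+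
    have "measure N (T n -` B - S -` B) \<le> measure N (T n -` (B - F) \<union> (T n -` F - S -` F))"
      by (rule finite_measure_mono) (use s F in auto)
    also have "\<dots> \<le> measure N (T n -` (B - F)) + measure N (T n -` F - S -` F)"
      by (rule measure_subadditive) (use s in \<open>auto simp: emeasure_finite\<close>)
    also have "measure N (T n -` (B - F)) \<le> C * measure N (B - F)" by (rule bound) (use B in auto)
    also have "\<dots> \<le> C * (e / (C+1))" using F(3) C by (intro mult_left_mono) auto
    also have "\<dots> \<le> e" using e C by (simp add: field_simps)
    finally show ?thesis by simp
  qed
  then show "\<exists>g. g \<longlonglongrightarrow> 0 \<and> (\<forall>n. measure N (T n -` B - S -` B) \<le> e + g n)"
    using closed_vimage_diff_tendsto[OF F(1)] by blast
qed simp

lemma vimage_symdiff_tendsto: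
  assumes B: "B \<in> sets borel"
  shows "(\<lambda>n. measure N (sym_diff (T n -` B) (S -` B))) \<longlonglongrightarrow> 0"
proof (rule tendsto_sandwich[OF _ _ tendsto_const])
  interpret finite_measure N by (rule fin)
  have "- B \<in> sets borel" using B by auto
  from tendsto_add[OF vimage_diff_tendsto[OF B] vimage_diff_tendsto[OF this]]
  show "(\<lambda>n. measure N (T n -` B - S -` B) + measure N (T n -` (- B) - S -` (- B))) \<longlonglongrightarrow> 0" by simp
  have "measure N (sym_diff (T n -` B) (S -` B))
      \<le> measure N (T n -` B - S -` B) + measure N (T n -` (- B) - S -` (- B))" for n
  proof -
    have "sym_diff (T n -` B) (S -` B) = (T n -` B - S -` B) \<union> (T n -` (- B) - S -` (- B))" by auto
    also have "measure N \<dots> \<le> measure N (T n -` B - S -` B) + measure N (T n -` (- B) - S -` (- B))"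
      by (rule measure_subadditive) (use B T S in \<open>auto intro!: vimage_sets_N simp: emeasure_finite\<close>)
    finally show ?thesis .
  qed
  then show "\<forall>\<^sub>F n in sequentially. measure N (sym_diff (T n -` B) (S -` B))
      \<le> measure N (T n -` B - S -` B) + measure N (T n -` (- B) - S -` (- B))" by simp
  show "\<forall>\<^sub>F n in sequentially. 0 \<le> measure N (sym_diff (T n -` B) (S -` B))" by simp
qed

end

lemma compose_close:
  fixes N :: "'a::polish_space measure" and u :: "'a \<Rightarrow> 'b::polish_space"
  assumes sets_N [measurable_cong]: "sets N = sets borel" and "prob_space N"
    and u [measurable]: "u \<in> borel_measurable borel" and e: "e > 0" and C: "0 \<le> C"
  shows "\<exists>(P :: nat \<Rightarrow> 'a set) m d. (\<forall>j. P j \<in> sets borel) \<and> d > 0 \<and>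
    (\<forall>T S. T \<in> borel_measurable borel \<longrightarrow> S \<in> borel_measurable borel \<longrightarrow>
      (\<forall>B\<in>sets borel. measure N (T -` B) \<le> C * measure N B) \<longrightarrow>
      (\<forall>j<m. measure N (sym_diff (T -` P j) (S -` P j)) < d) \<longrightarrow>
      (\<integral>x. min 1 (dist (u (T x)) (u (S x))) \<partial>N) < e)"
proof -
  interpret prob_space N by fact
  have sp: "space N = UNIV" using sets_eq_imp_space_eq[OF sets_N] by simp
  define e1 where "e1 = e / (C + 3)"
  have e1: "e1 > 0" using e C by (simp add: e1_def)
  have "u \<in> borel_measurable N" by measurable
  from finite_small_partition[OF finite_measure_axioms this e1]
  obtain k :: "'a \<Rightarrow> nat" and m where [measurable]: "k \<in> measurable N (count_space UNIV)" and k: "\<And>x. k x \<le> m"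
    "measure N {x\<in>space N. k x = 0} < e1" "\<And>x y. k x = k y \<Longrightarrow> k x \<noteq> 0 \<Longrightarrow> dist (u x) (u y) < e1"
    by blast
  have kb: "k \<in> measurable borel (count_space UNIV)"
    by (subst measurable_cong_sets[OF sets_N[symmetric] refl]) measurable
  define P where "P j = {x. k x = j}" for j
  have P: "P j \<in> sets borel" for j unfolding P_def using kb by measurable
  define d where "d = e1 / (m + 1)"
  have "(\<integral>x. min 1 (dist (u (T x)) (u (S x))) \<partial>N) < e"
    if T [measurable]: "T \<in> borel_measurable borel" and S [measurable]: "S \<in> borel_measurable borel"
      and bd: "\<forall>B\<in>sets borel. measure N (T -` B) \<le> C * measure N B"
      and cl: "\<forall>j<Suc m. measure N (sym_diff (T -` P j) (S -` P j)) < d" for T S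
  proof -
    have vs: "f -` P j \<in> sets N" if "f \<in> borel_measurable borel" for f :: "'a \<Rightarrow> 'a" and j
      using measurable_sets[OF that P, of j] by (simp add: sets_N)
    let ?D = "\<lambda>j. sym_diff (T -` P j) (S -` P j)"
    have D: "?D j \<in> sets N" for j using vs[OF T] vs[OF S] by auto
    let ?h = "\<lambda>x. e1 + indicator (T -` P 0) x + (\<Sum>j\<le>m. indicator (?D j) x) :: real"
    have int_h: "integrable N ?h"
      using D vs[OF T] by (intro Bochner_Integration.integrable_add Bochner_Integration.integrable_sum)
         (auto intro!: integrable_real_indicator simp: emeasure_eq_measure)
    have "(\<integral>x. min 1 (dist (u (T x)) (u (S x))) \<partial>N) \<le> (\<integral>x. ?h x \<partial>N)"
    proof (rule integral_mono)
      show "integrable N (\<lambda>x. min 1 (dist (u (T x)) (u (S x))))"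
        by (rule integrable_const_bound[of _ 1]) auto
      show "integrable N ?h" by (rule int_h)
      fix x
      show "min 1 (dist (u (T x)) (u (S x))) \<le> ?h x"
      proof (cases "k (T x) = 0 \<or> k (T x) \<noteq> k (S x)")
        case True
        have "1 \<le> indicator (T -` P 0) x + (\<Sum>j\<le>m. indicator (?D j) x :: real)"
        proof (cases "k (T x) = 0")
          case False
          with True have "x \<in> ?D (k (T x))" by (auto simp: P_def)
          then have "(1::real) \<le> (\<Sum>j\<in>{k (T x)}. indicator (?D j) x)" by simp
          also have "\<dots> \<le> (\<Sum>j\<le>m. indicator (?D j) x)"
            by (rule sum_mono2) (use k(1) in auto)
          finally show ?thesis by (simp add: add_increasing)
        qed (auto simp: P_def intro!: sum_nonneg)
        then show ?thesis using e1 by simp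
      next
        case False
        then have "dist (u (T x)) (u (S x)) < e1" using k(3) by auto
        moreover have "0 \<le> indicator (T -` P 0) x + (\<Sum>j\<le>m. indicator (?D j) x :: real)"
          by (intro add_nonneg_nonneg sum_nonneg) auto
        ultimately show ?thesis by linarith
      qed
    qed
    also have "(\<integral>x. ?h x \<partial>N) = e1 + measure N (T -` P 0) + (\<Sum>j\<le>m. measure N (?D j))"
      using D vs[OF T] by (subst Bochner_Integration.integral_add Bochner_Integration.integral_sum;
          auto intro!: integrable_real_indicator Bochner_Integration.integrable_sum Bochner_Integration.integrable_add simp: emeasure_eq_measure sp prob_space[unfolded sp])+
    also have "measure N (T -` P 0) \<le> C * e1"
    proof -
      have "measure N (T -` P 0) \<le> C * measure N (P 0)" using bd P by auto
      also have "\<dots> \<le> C * e1" using k(2) C by (intro mult_left_mono) (auto simp: sp P_def)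
      finally show ?thesis .
    qed
    also have "(\<Sum>j\<le>m. measure N (?D j)) \<le> (\<Sum>j\<le>m. d)"
      by (rule sum_mono) (use cl in \<open>auto simp: less_Suc_eq_le less_imp_le\<close>)
    also have "(\<Sum>j\<le>m. d) = e1" by (simp add: d_def)
    also have "e1 + C * e1 + e1 = (C + 2) * e1" by (simp add: algebra_simps)
    also have "\<dots> < (C + 3) * e1" using e1 by simp
    also have "\<dots> = e" using C by (simp add: e1_def)
    finally show ?thesis by simp
  qed
  moreover have "d > 0" using e1 by (simp add: d_def)
  ultimately show ?thesis using P by (intro exI[of _ P] exI[of _ "Suc m"] exI[of _ d]) blast
qed

lemma AE_eq_if_vimages_eq:
  fixes N :: "'a::polish_space measure"
  assumes sets_N [measurable_cong]: "sets N = sets borel" and "prob_space N"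
    and T [measurable]: "T \<in> borel_measurable borel" and S [measurable]: "S \<in> borel_measurable borel"
    and bd: "\<And>B. B \<in> sets borel \<Longrightarrow> measure N (T -` B) \<le> C * measure N B" and C: "0 \<le> C"
    and eq: "\<And>B. B \<in> sets borel \<Longrightarrow> measure N (sym_diff (T -` B) (S -` B)) = 0"
  shows "AE x in N. T x = S x"
proof -
  interpret prob_space N by fact
  let ?I = "\<integral>x. min 1 (dist (T x) (S x)) \<partial>N"
  have "?I < e" if "e > 0" for e
    using compose_close[OF sets_N assms(2) _ that C, of "\<lambda>x. x"] T S bd eq by fastforce
  then have "?I \<le> 0" by (meson less_irrefl not_le)
  moreover have "0 \<le> ?I" by (intro integral_nonneg_AE) auto
  ultimately have "?I = 0" by simp
  then have "AE x in N. min 1 (dist (T x) (S x)) = 0"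
    by (subst (asm) integral_nonneg_eq_0_iff_AE) (auto intro!: integrable_const_bound[of _ 1])
  then show ?thesis by eventually_elim (auto simp: min_def split: if_splits)
qed

lemma compose_limit:
  fixes N :: "'a::polish_space measure" and u :: "'a \<Rightarrow> 'b::polish_space"
  assumes sets_N [measurable_cong]: "sets N = sets borel" and "prob_space N"
    and T [measurable]: "\<And>n::nat. T n \<in> borel_measurable borel" and S [measurable]: "S \<in> borel_measurable borel"
    and lim: "AE x in N. (\<lambda>n. T n x) \<longlonglongrightarrow> S x"
    and bound: "\<And>n B. B \<in> sets borel \<Longrightarrow> measure N (T n -` B) \<le> C * measure N B" and C: "0 \<le> C"
    and un [measurable]: "\<And>n::nat. un n \<in> borel_measurable borel" and u [measurable]: "u \<in> borel_measurable borel"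
    and v [measurable]: "v \<in> borel_measurable borel"
    and lim_u: "AE x in N. (\<lambda>n. un n x) \<longlonglongrightarrow> u x"
    and lim_v: "AE x in N. (\<lambda>n. un n (T n x)) \<longlonglongrightarrow> v x"
  shows "AE x in N. v x = u (S x)"
proof -
  interpret prob_space N by fact
  have sp: "space N = UNIV" using sets_eq_imp_space_eq[OF sets_N] by simp
  let ?I = "\<integral>x. min 1 (dist (v x) (u (S x))) \<partial>N"
  let ?A = "\<lambda>n. \<integral>x. min 1 (dist (v x) (un n (T n x))) \<partial>N"
  let ?B = "\<lambda>n. \<integral>x. min 1 (dist (u (T n x)) (u (S x))) \<partial>N"
  have A: "?A \<longlonglongrightarrow> 0"
  proof -
    have "?A \<longlonglongrightarrow> (\<integral>x. (0::real) \<partial>N)"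
    proof (rule integral_dominated_convergence[where w = "\<lambda>_. 1"])
      show "AE x in N. (\<lambda>n. min 1 (dist (v x) (un n (T n x)))) \<longlonglongrightarrow> 0"
        using lim_v
      proof eventually_elim
        case (elim x)
        from tendsto_min[OF tendsto_const[of "1::real"] tendsto_dist[OF tendsto_const[of "v x"] elim]]
        show ?case by simp
      qed
    qed auto
    then show ?thesis by simp
  qed
  have B: "?B \<longlonglongrightarrow> 0"
  proof (rule LIMSEQ_I)
    fix r :: real assume "0 < r"
    from compose_close[OF sets_N assms(2) u this C] obtain P m d
      where P: "\<forall>j. P j \<in> sets borel" "d > 0"
        and close: "\<forall>T S. T \<in> borel_measurable borel \<longrightarrow> S \<in> borel_measurable borel \<longrightarrow>
          (\<forall>B\<in>sets borel. measure N (T -` B) \<le> C * measure N B) \<longrightarrow>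
          (\<forall>j<m::nat. measure N (sym_diff (T -` P j) (S -` P j)) < d) \<longrightarrow>
          (\<integral>x. min 1 (dist (u (T x)) (u (S x))) \<partial>N) < r"
      by (elim exE conjE) (rule that)
    have "\<forall>\<^sub>F n in sequentially. measure N (sym_diff (T n -` P j) (S -` P j)) < d" for j
      using vimage_symdiff_tendsto[OF sets_N finite_measure_axioms T S lim bound C P(1)[rule_format, of j]] P(2)
      by (rule order_tendstoD)
    then have "\<forall>\<^sub>F n in sequentially. \<forall>j\<in>{..<m}. measure N (sym_diff (T n -` P j) (S -` P j)) < d"
      by (intro eventually_ball_finite) auto
    then obtain no where no: "\<And>n j. n \<ge> no \<Longrightarrow> j < m \<Longrightarrow> measure N (sym_diff (T n -` P j) (S -` P j)) < d"
      by (auto simp: eventually_sequentially)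
    have "?B n < r" if "n \<ge> no" for n
      using close[rule_format, OF T S bound no[OF that]] by simp
    moreover have "0 \<le> ?B n" for n by (intro integral_nonneg_AE) auto
    ultimately show "\<exists>no. \<forall>n\<ge>no. norm (?B n - 0) < r" by (intro exI[of _ no]) auto
  qed
  have Q: "(\<lambda>n. measure N {x. dist (un n x) (u x) \<ge> e}) \<longlonglongrightarrow> 0" if e: "e > 0" for e
  proof (rule measure_tendsto_zero_AE[OF finite_measure_axioms])
    show "{x. dist (un n x) (u x) \<ge> e} \<in> sets N" for n by measurable
    show "AE x in N. \<forall>\<^sub>F n in sequentially. x \<notin> {x. e \<le> dist (un n x) (u x)}"
      using lim_u
    proof eventually_elim
      case (elim x)
      then have "\<forall>\<^sub>F n in sequentially. dist (un n x) (u x) < e" using e by (rule tendstoD)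
      then show ?case by eventually_elim auto
    qed
  qed
  have "?I \<le> e" if e: "e > 0" for e
  proof (rule LIMSEQ_le_const)
    let ?Q = "\<lambda>n. {x. dist (un n x) (u x) \<ge> e}"
    show "(\<lambda>n. ?A n + (e + C * measure N (?Q n)) + ?B n) \<longlonglongrightarrow> e"
      using tendsto_add[OF tendsto_add[OF A tendsto_add[OF tendsto_const[of e] tendsto_mult[OF tendsto_const[of C] Q[OF e]]]] B]
      by simp
    have "?I \<le> ?A n + (e + C * measure N (?Q n)) + ?B n" for n
    proof -
      have q: "?Q n \<in> sets borel" by measurable
      then have tq: "T n -` ?Q n \<in> sets N" using measurable_sets[OF T q] by (simp add: sets_N)
      have i: "integrable N (\<lambda>x. min 1 (dist (f x) (g x)))"
        if [measurable]: "f \<in> borel_measurable N" "g \<in> borel_measurable N" for f g :: "'a \<Rightarrow> 'b"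
        by (rule integrable_const_bound[of _ 1]) auto
      have i1: "integrable N (\<lambda>x. min 1 (dist (v x) (u (S x))))"
        "integrable N (\<lambda>x. min 1 (dist (v x) (un n (T n x))))"
        "integrable N (\<lambda>x. min 1 (dist (u (T n x)) (u (S x))))" by (intro i; measurable)+
      have i2: "integrable N (\<lambda>x. e + indicator (T n -` ?Q n) x)"
        using tq by (intro Bochner_Integration.integrable_add integrable_real_indicator) (auto simp: emeasure_eq_measure)
      have "?I \<le> (\<integral>x. min 1 (dist (v x) (un n (T n x))) + (e + indicator (T n -` ?Q n) x)
          + min 1 (dist (u (T n x)) (u (S x))) \<partial>N)"
      proof (rule integral_mono)
        fix x
        have "min 1 (dist (un n (T n x)) (u (T n x))) \<le> e + indicator (T n -` ?Q n) x"
          using e by (auto simp: indicator_def)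
        then show "min 1 (dist (v x) (u (S x))) \<le> min 1 (dist (v x) (un n (T n x))) + (e + indicator (T n -` ?Q n) x)
          + min 1 (dist (u (T n x)) (u (S x)))"
          using dist_triangle[of "v x" "u (S x)" "un n (T n x)"] dist_triangle[of "un n (T n x)" "u (S x)" "u (T n x)"]
            zero_le_dist[of "v x" "un n (T n x)"] zero_le_dist[of "u (T n x)" "u (S x)"]
            zero_le_dist[of "un n (T n x)" "u (T n x)"]
          by (smt (verit))
      qed (intro Bochner_Integration.integrable_add i1 i2)+
      also have "\<dots> = ?A n + (e + measure N (T n -` ?Q n)) + ?B n"
        using i1 i2 tq by (simp add: prob_space[unfolded sp] sp Bochner_Integration.integral_add emeasure_eq_measure)
      also have "measure N (T n -` ?Q n) \<le> C * measure N (?Q n)" by (rule bound[OF q])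
      finally show ?thesis by simp
    qed
    then show "\<exists>M. \<forall>n\<ge>M. ?I \<le> ?A n + (e + C * measure N (?Q n)) + ?B n" by blast
  qed
  then have "?I \<le> 0 + e" if "e > 0" for e using that unfolding add_0 .
  then have "?I \<le> 0" by (rule field_le_epsilon)
  moreover have "0 \<le> ?I" by (intro integral_nonneg_AE) auto
  ultimately have "?I = 0" by simp
  then have "AE x in N. min 1 (dist (v x) (u (S x))) = 0"
    by (subst (asm) integral_nonneg_eq_0_iff_AE) (auto intro!: integrable_const_bound[of _ 1])
  then show ?thesis by eventually_elim (auto simp: min_def split: if_splits)
qed

lemma finite_borel_measure_eqI:
  fixes M N :: "'a::metric_space measure"
  assumes sM [measurable_cong]: "sets M = sets borel" and sN [measurable_cong]: "sets N = sets borel"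
    and "finite_measure M" "finite_measure N"
    and eq: "\<And>f :: 'a \<Rightarrow> real. continuous_on UNIV f \<Longrightarrow> bounded (range f) \<Longrightarrow> (\<integral>x. f x \<partial>M) = (\<integral>x. f x \<partial>N)"
  shows "M = N"
proof -
  interpret M: finite_measure M by fact
  interpret N: finite_measure N by fact
  have op: "measure M Op = measure N Op" if Op: "open Op" for Op
  proof (cases "Op = UNIV")
    case True
    then show ?thesis
      using eq[of "\<lambda>_. 1"] sets_eq_imp_space_eq[OF sM] sets_eq_imp_space_eq[OF sN] by simp
  next
    case False
    define f where "f n x = min 1 (real n * infdist x (- Op))" for n x
    have f_cont: "continuous_on UNIV (f n)" for n unfolding f_def by (intro continuous_intros)
    have f_range: "0 \<le> f n x" "f n x \<le> 1" for n x by (auto simp: f_def infdist_nonneg)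
    have f_meas [measurable]: "f n \<in> borel_measurable borel" for n
      using f_cont by (rule borel_measurable_continuous_onI)
    have lim: "(\<lambda>n. f n x) \<longlonglongrightarrow> indicator Op x" for x
    proof (cases "x \<in> Op")
      case True
      have "infdist x (- Op) \<noteq> 0"
        using in_closed_iff_infdist_zero[of "- Op" x] Op False True by auto
      then have pos: "infdist x (- Op) > 0" using infdist_nonneg[of x "- Op"] by linarith
      obtain m where m: "1 < real m * infdist x (- Op)" using reals_Archimedean3[OF pos] by blast
      have "\<forall>\<^sub>F n in sequentially. f n x = 1"
        using eventually_ge_at_top[of m]
      proof eventually_elim
        case (elim n)
        have "real m * infdist x (- Op) \<le> real n * infdist x (- Op)"
          using elim pos by (intro mult_right_mono) auto
        then show ?case using m by (simp add: f_def)
      qed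
      then show ?thesis using True by (simp add: tendsto_eventually)
    next
      case F: False
      then have "f n x = 0" for n by (simp add: f_def)
      then show ?thesis using F by simp
    qed
    have conv: "(\<lambda>n. \<integral>x. f n x \<partial>K) \<longlonglongrightarrow> measure K Op"
      if K [measurable_cong]: "sets K = sets borel" and fK: "finite_measure K" for K
    proof -
      interpret K: finite_measure K by fact
      have o: "Op \<in> sets K" using Op K by simp
      have "(\<lambda>n. \<integral>x. f n x \<partial>K) \<longlonglongrightarrow> (\<integral>x. indicator Op x \<partial>K)"
      proof (rule integral_dominated_convergence[where w = "\<lambda>_. 1"])
        show "AE x in K. (\<lambda>n. f n x) \<longlonglongrightarrow> indicator Op x" using lim by simp
        show "AE x in K. norm (f n x) \<le> 1" for n using f_range by simp
      qed (use o in auto)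
      then show ?thesis using o sets.sets_into_space[OF o] by (simp add: Int_absorb2)
    qed
    have "(\<lambda>n. \<integral>x. f n x \<partial>M) = (\<lambda>n. \<integral>x. f n x \<partial>N)"
    proof
      fix n
      have "bounded (range (f n))" unfolding bounded_iff using f_range[of n] by (intro exI[of _ 1]) auto
      then show "(\<integral>x. f n x \<partial>M) = (\<integral>x. f n x \<partial>N)" by (rule eq[OF f_cont])
    qed
    then show ?thesis
      using LIMSEQ_unique[OF conv[OF sM assms(3)]] conv[OF sN assms(4)] by simp
  qed
  show ?thesis
  proof (rule measure_eqI_generator_eq[where E = "{S. open S}" and A = "\<lambda>_. UNIV" and \<Omega> = UNIV])
    show "Int_stable {S :: 'a set. open S}" by (auto simp: Int_stable_def)
    show "emeasure M X = emeasure N X" if "X \<in> {S. open S}" for X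
      using op that by (simp add: M.emeasure_eq_measure N.emeasure_eq_measure)
  qed (auto simp: sM sN borel_def M.emeasure_eq_measure)
qed

section \<open>Stationary actions\<close>

definition stationary :: "'g::group_add pmf \<Rightarrow> 'a::topological_space measure \<Rightarrow> ('g \<Rightarrow> 'a \<Rightarrow> 'a) \<Rightarrow> bool" where
  "stationary \<mu> M \<alpha> \<longleftrightarrow> (\<forall>E\<in>sets borel. measure M E = (\<integral>g. measure M (\<alpha> g -` E) \<partial>measure_pmf \<mu>))"

definition borel_action :: "'a::topological_space measure \<Rightarrow> ('g::group_add \<Rightarrow> 'a \<Rightarrow> 'a) \<Rightarrow> bool" where
  "borel_action M \<alpha> \<longleftrightarrow> (\<forall>g. \<alpha> g \<in> borel_measurable borel) \<and> (AE x in M. \<alpha> 0 x = x) \<and>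
     (\<forall>g h. AE x in M. \<alpha> (g + h) x = \<alpha> g (\<alpha> h x))"

lemma stationary_nn_iff:
  assumes sets_M: "sets M = sets borel" and "prob_space M" and \<alpha>: "\<And>g. \<alpha> g \<in> borel_measurable borel"
    and sets_K: "sets K = sets borel"
  shows "(\<forall>E\<in>sets M. emeasure M E = (\<integral>\<^sup>+ g. emeasure (distr M K (\<alpha> g)) E \<partial>measure_pmf \<mu>)) \<longleftrightarrow> stationary \<mu> M \<alpha>"
proof -
  interpret prob_space M by fact
  have sp: "space M = UNIV" using sets_eq_imp_space_eq[OF sets_M] by simp
  have "emeasure M E = (\<integral>\<^sup>+ g. emeasure (distr M K (\<alpha> g)) E \<partial>measure_pmf \<mu>) \<longleftrightarrow>
      measure M E = (\<integral>g. measure M (\<alpha> g -` E) \<partial>measure_pmf \<mu>)" if E: "E \<in> sets borel" for E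
  proof -
    have "emeasure (distr M K (\<alpha> g)) E = ennreal (measure M (\<alpha> g -` E))" for g
    proof -
      have "\<alpha> g \<in> measurable M K" using \<alpha>[of g] by (simp cong: measurable_cong_sets add: sets_M sets_K)
      then show ?thesis using E by (subst emeasure_distr) (auto simp: sets_K sp emeasure_eq_measure)
    qed
    moreover have "(\<integral>\<^sup>+ g. ennreal (measure M (\<alpha> g -` E)) \<partial>measure_pmf \<mu>) =
        ennreal (\<integral>g. measure M (\<alpha> g -` E) \<partial>measure_pmf \<mu>)"
      by (rule nn_integral_eq_integral) (auto intro!: measure_pmf.integrable_const_bound[of _ 1])
    moreover have "0 \<le> (\<integral>g. measure M (\<alpha> g -` E) \<partial>measure_pmf \<mu>)"
      by (intro integral_nonneg_AE) auto
    ultimately show ?thesis by (simp add: emeasure_eq_measure)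
  qed
  then show ?thesis unfolding stationary_def sets_M by auto
qed

lemma AE_pullback_null:
  assumes T: "T \<in> measurable M M" and null: "\<And>A. A \<in> sets M \<Longrightarrow> emeasure M A = 0 \<Longrightarrow> emeasure M (T -` A \<inter> space M) = 0"
    and P: "AE y in M. P y"
  shows "AE x in M. P (T x)"
proof -
  obtain A where A: "{y\<in>space M. \<not> P y} \<subseteq> A" "A \<in> sets M" "emeasure M A = 0"
    using P by (auto elim!: AE_E)
  show ?thesis
  proof (rule AE_I[of _ _ "T -` A \<inter> space M"])
    show "{x \<in> space M. \<not> P (T x)} \<subseteq> T -` A \<inter> space M"
      using A(1) measurable_space[OF T] by auto
  qed (use null[OF A(2,3)] measurable_sets[OF T A(2)] in auto)
qed

lemma stationary_nonsingular_constants: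
  fixes \<mu> :: "'g::group_add pmf"
  assumes gen: "gen_semigroup (set_pmf \<mu>) = UNIV"
  shows "\<exists>c. \<forall>g. 0 \<le> c g \<and> (\<forall>(M :: 'a::topological_space measure) \<alpha>. sets M = sets borel \<longrightarrow> prob_space M \<longrightarrow>
    borel_action M \<alpha> \<longrightarrow> stationary \<mu> M \<alpha> \<longrightarrow> (\<forall>B\<in>sets borel. measure M (\<alpha> g -` B) \<le> c g * measure M B))"
proof -
  define Bd where "Bd g c \<longleftrightarrow> 0 \<le> c \<and> (\<forall>(M :: 'a measure) \<alpha>. sets M = sets borel \<longrightarrow> prob_space M \<longrightarrow>
    borel_action M \<alpha> \<longrightarrow> stationary \<mu> M \<alpha> \<longrightarrow> (\<forall>B\<in>sets borel. measure M (\<alpha> g -` B) \<le> c * measure M B))"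
    for g :: 'g and c :: real
  have "\<exists>c. Bd g c" for g
  proof -
    have "g \<in> gen_semigroup (set_pmf \<mu>)" using gen by simp
    then show ?thesis
    proof induction
      case (base s)
      then have p: "pmf \<mu> s > 0" by (simp add: pmf_positive)
      have "measure M (\<alpha> s -` B) \<le> (1 / pmf \<mu> s) * measure M B"
        if "prob_space M" "stationary \<mu> M \<alpha>" "B \<in> sets borel" for M :: "'a measure" and \<alpha> B
      proof -
        interpret prob_space M by fact
        have "measure M (\<alpha> s -` B) * pmf \<mu> s = (\<integral>g. measure M (\<alpha> s -` B) * indicator {s} g \<partial>measure_pmf \<mu>)"
          by (simp add: measure_pmf_single)
        also have "\<dots> \<le> (\<integral>g. measure M (\<alpha> g -` B) \<partial>measure_pmf \<mu>)"
        proof (rule integral_mono)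
          show "integrable (measure_pmf \<mu>) (\<lambda>g. measure M (\<alpha> s -` B) * indicator {s} g)"
            by (rule measure_pmf.integrable_const_bound[of _ 1]) (auto simp: indicator_def)
          show "integrable (measure_pmf \<mu>) (\<lambda>g. measure M (\<alpha> g -` B))"
            by (rule measure_pmf.integrable_const_bound[of _ 1]) auto
        qed (auto simp: indicator_def)
        also have "\<dots> = measure M B" using that by (simp add: stationary_def)
        finally show ?thesis using p by (simp add: field_simps)
      qed
      then show ?case using p by (intro exI[of _ "1 / pmf \<mu> s"]) (simp add: Bd_def)
    next
      case (plus a b)
      then obtain ca cb where "Bd a ca" "Bd b cb" by blast
      then have c: "0 \<le> ca" "0 \<le> cb"
        and ca: "\<And>(M :: 'a measure) \<alpha> B. sets M = sets borel \<Longrightarrow> prob_space M \<Longrightarrow>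
          borel_action M \<alpha> \<Longrightarrow> stationary \<mu> M \<alpha> \<Longrightarrow> B\<in>sets borel \<Longrightarrow> measure M (\<alpha> a -` B) \<le> ca * measure M B"
        and cb: "\<And>(M :: 'a measure) \<alpha> B. sets M = sets borel \<Longrightarrow> prob_space M \<Longrightarrow>
          borel_action M \<alpha> \<Longrightarrow> stationary \<mu> M \<alpha> \<Longrightarrow> B\<in>sets borel \<Longrightarrow> measure M (\<alpha> b -` B) \<le> cb * measure M B"
        unfolding Bd_def by simp_all
      have "measure M (\<alpha> (a + b) -` B) \<le> (cb * ca) * measure M B"
        if M: "sets M = sets borel" "prob_space M" "borel_action M \<alpha>" "stationary \<mu> M \<alpha>" "B \<in> sets borel"
        for M :: "'a measure" and \<alpha> B
      proof -
        interpret prob_space M by fact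
        have sp: "space M = UNIV" using sets_eq_imp_space_eq[OF M(1)] by simp
        have meas: "\<alpha> g -` D \<in> sets borel" if "D \<in> sets borel" for g D
          using measurable_sets[of "\<alpha> g" borel borel D] that M(3) by (simp add: borel_action_def)
        have "measure M (\<alpha> (a + b) -` B) = measure M (\<alpha> b -` (\<alpha> a -` B))"
        proof (rule finite_measure_eq_AE)
          have "AE x in M. \<alpha> (a + b) x = \<alpha> a (\<alpha> b x)" using M(3) by (simp add: borel_action_def)
          then show "AE x in M. (x \<in> \<alpha> (a + b) -` B) = (x \<in> \<alpha> b -` (\<alpha> a -` B))"
            by eventually_elim auto
        qed (use meas M in auto)
        also have "\<dots> \<le> cb * measure M (\<alpha> a -` B)" by (rule cb) (use M meas in auto)
        also have "\<dots> \<le> cb * (ca * measure M B)" using c(2) by (intro mult_left_mono ca) (use M in auto)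
        finally show ?thesis by simp
      qed
      then show ?case using c by (intro exI[of _ "cb * ca"]) (simp add: Bd_def)
    qed
  qed
  then have "\<exists>c. \<forall>g. Bd g (c g)" by (intro choice allI)
  then show ?thesis unfolding Bd_def .
qed

locale stationary_setup =
  fixes \<mu> :: "'g::{group_add,countable} pmf" and \<nu> :: "'x::polish_space measure"
  assumes gen: "gen_semigroup (set_pmf \<mu>) = UNIV" and sets_\<nu> [measurable_cong]: "sets \<nu> = sets borel"
    and prob_\<nu>: "prob_space \<nu>" and nonatomic_\<nu>: "\<And>x. emeasure \<nu> {x} = 0"
begin

sublocale \<nu>: prob_space \<nu> by (rule prob_\<nu>)

lemma space_\<nu> [simp]: "space \<nu> = UNIV" using sets_eq_imp_space_eq[OF sets_\<nu>] by simp

definition cst :: "'g \<Rightarrow> real" where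
  "cst = (SOME c. \<forall>g. 0 \<le> c g \<and> (\<forall>(M :: 'x measure) \<alpha>. sets M = sets borel \<longrightarrow> prob_space M \<longrightarrow>
    borel_action M \<alpha> \<longrightarrow> stationary \<mu> M \<alpha> \<longrightarrow> (\<forall>B\<in>sets borel. measure M (\<alpha> g -` B) \<le> c g * measure M B)))"

lemma cst_nonneg: "0 \<le> cst g"
  and cst_bound: "borel_action \<nu> a \<Longrightarrow> stationary \<mu> \<nu> a \<Longrightarrow> B \<in> sets borel \<Longrightarrow>
    measure \<nu> (a g -` B) \<le> cst g * measure \<nu> B"
  using someI_ex[OF stationary_nonsingular_constants[OF gen, where 'a='x], folded cst_def] sets_\<nu> prob_\<nu> by auto

lemma borel_measurable_\<nu>: "f \<in> borel_measurable borel \<Longrightarrow> f \<in> borel_measurable \<nu>"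
  by measurable

lemma measurable_\<nu>_\<nu>: "measurable \<nu> \<nu> = (borel_measurable borel :: ('x \<Rightarrow> 'x) set)"
  by (intro measurable_cong_sets sets_\<nu>)

lemma A_mu_iff: "a \<in> A_mu \<mu> \<nu> \<longleftrightarrow> borel_action \<nu> a \<and> stationary \<mu> \<nu> a"
proof
  assume a: "a \<in> A_mu \<mu> \<nu>"
  then have aut: "a g \<in> aut_star \<nu>" and meas: "a g \<in> borel_measurable borel" for g
    by (auto simp: A_mu_def aut_star_def measurable_\<nu>_\<nu>)
  from a have comp: "\<And>g h. AE x in \<nu>. a (g + h) x = a g (a h x)" by (simp add: A_mu_def)
  obtain S where S: "AE x in \<nu>. S (a 0 x) = x" using aut[of 0] by (auto simp: aut_star_def)
  have "AE x in \<nu>. S (a 0 (a 0 x)) = a 0 x"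
    by (rule AE_pullback_null[OF _ _ S]) (use aut[of 0] in \<open>auto simp: aut_star_def\<close>)
  with S comp[of 0 0] have "AE x in \<nu>. a 0 x = x"
    by eventually_elim simp
  then have "borel_action \<nu> a" using meas comp by (simp add: borel_action_def)
  moreover have "stationary \<mu> \<nu> a"
    using a stationary_nn_iff[OF sets_\<nu> prob_\<nu> meas sets_\<nu>, of \<mu>] by (simp add: A_mu_def)
  ultimately show "borel_action \<nu> a \<and> stationary \<mu> \<nu> a" by simp
next
  assume a: "borel_action \<nu> a \<and> stationary \<mu> \<nu> a"
  then have meas: "a g \<in> borel_measurable borel" and zero: "AE x in \<nu>. a 0 x = x"
    and comp: "AE x in \<nu>. a (g + h) x = a g (a h x)" for g h by (auto simp: borel_action_def)
  have bound: "measure \<nu> (a g -` B) \<le> cst g * measure \<nu> B" if "B \<in> sets borel" for g B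
    using cst_bound a that by auto
  have vs: "a g -` B \<in> sets borel" if "B \<in> sets borel" for g B
    using measurable_sets[OF meas that, of g] by simp
  have inv: "AE x in \<nu>. a (- g) (a g x) = x" "AE x in \<nu>. a g (a (- g) x) = x" for g
  proof -
    show "AE x in \<nu>. a (- g) (a g x) = x" using comp[of "- g" g] zero by eventually_elim simp
    show "AE x in \<nu>. a g (a (- g) x) = x" using comp[of g "- g"] zero by eventually_elim simp
  qed
  have "a g \<in> aut_star \<nu>" for g
    unfolding aut_star_def measurable_\<nu>_\<nu>
  proof (intro CollectI conjI ballI)
    show "a g \<in> borel_measurable borel" by (rule meas)
    fix A assume "A \<in> sets \<nu>"
    then have A: "A \<in> sets borel" by (simp add: sets_\<nu>)
    have "measure \<nu> A = measure \<nu> (a (- g) -` (a g -` A))"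
    proof (rule \<nu>.finite_measure_eq_AE)
      show "AE x in \<nu>. (x \<in> A) = (x \<in> a (- g) -` (a g -` A))"
        using inv(2)[of g] by eventually_elim auto
    qed (use A vs sets_\<nu> in auto)
    also have "\<dots> \<le> cst (- g) * measure \<nu> (a g -` A)" by (intro bound vs A)
    finally have "measure \<nu> A \<le> cst (- g) * measure \<nu> (a g -` A)" .
    moreover have "measure \<nu> (a g -` A) \<le> cst g * measure \<nu> A" by (rule bound[OF A])
    ultimately have "measure \<nu> (a g -` A) = 0 \<longleftrightarrow> measure \<nu> A = 0"
      using measure_nonneg[of \<nu> A] measure_nonneg[of \<nu> "a g -` A"] by (metis mult_zero_right order_antisym)
    then show "emeasure \<nu> (a g -` A \<inter> space \<nu>) = 0 \<longleftrightarrow> emeasure \<nu> A = 0"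
      by (simp add: \<nu>.emeasure_eq_measure)
  next
    show "\<exists>S. S \<in> borel_measurable borel \<and> (AE x in \<nu>. S (a g x) = x) \<and> (AE x in \<nu>. a g (S x) = x)"
      using inv[of g] meas[of "- g"] by blast
  qed
  then show "a \<in> A_mu \<mu> \<nu>"
    using comp a stationary_nn_iff[OF sets_\<nu> prob_\<nu> meas sets_\<nu>, of \<mu>] by (simp add: A_mu_def)
qed

lemma A_mu_aut_star: "a \<in> A_mu \<mu> \<nu> \<Longrightarrow> a g \<in> aut_star \<nu>"
  by (simp add: A_mu_def)

lemma A_muD:
  assumes "a \<in> A_mu \<mu> \<nu>"
  shows A_mu_measurable: "a g \<in> borel_measurable borel"
    and A_mu_zero: "AE x in \<nu>. a 0 x = x"
    and A_mu_plus: "AE x in \<nu>. a (g + h) x = a g (a h x)"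
    and A_mu_stationary: "stationary \<mu> \<nu> a"
    and A_mu_bound: "B \<in> sets borel \<Longrightarrow> measure \<nu> (a g -` B) \<le> cst g * measure \<nu> B"
proof -
  have a: "borel_action \<nu> a" "stationary \<mu> \<nu> a" using assms A_mu_iff by auto
  then show "a g \<in> borel_measurable borel" "AE x in \<nu>. a 0 x = x"
    "AE x in \<nu>. a (g + h) x = a g (a h x)" "stationary \<mu> \<nu> a"
    by (auto simp: borel_action_def)
  show "B \<in> sets borel \<Longrightarrow> measure \<nu> (a g -` B) \<le> cst g * measure \<nu> B" by (rule cst_bound[OF a])
qed

lemma A_mu_vimage: "a \<in> A_mu \<mu> \<nu> \<Longrightarrow> B \<in> sets borel \<Longrightarrow> a g -` B \<in> sets \<nu>"
  using measurable_sets[OF A_mu_measurable, of a B g] by (simp add: sets_\<nu>)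

lemma A_mu_nonsingular_action: "a \<in> A_mu \<mu> \<nu> \<Longrightarrow> nonsingular_action \<nu> a"
  using A_mu_aut_star[of a] A_mu_zero[of a] A_mu_plus[of a] prob_\<nu>
  unfolding nonsingular_action_def aut_star_def by auto

lemma very_weak_coords_eq:
  assumes T: "T \<in> aut_star \<nu>"
  shows "very_weak_coords \<nu> T (A, B) = (if A \<in> sets borel \<and> B \<in> sets borel then measure \<nu> (A \<inter> T -` B) else 0)"
proof (cases "A \<in> sets borel \<and> B \<in> sets borel")
  case True
  then have A: "A \<in> sets \<nu>" and B: "B \<in> sets \<nu>" by (auto simp: sets_\<nu>)
  have T_meas: "T \<in> measurable \<nu> \<nu>" and null: "\<And>A. A\<in>sets \<nu> \<Longrightarrow> emeasure \<nu> (T -` A \<inter> space \<nu>) = 0 \<longleftrightarrow> emeasure \<nu> A = 0"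
    and ex: "\<exists>S. S \<in> measurable \<nu> \<nu> \<and> (AE x in \<nu>. S (T x) = x) \<and> (AE x in \<nu>. T (S x) = x)"
    using T by (auto simp: aut_star_def)
  define S where "S = aut_inv \<nu> T"
  have S: "S \<in> measurable \<nu> \<nu>" "AE x in \<nu>. S (T x) = x"
    using someI_ex[OF ex] unfolding S_def aut_inv_def by auto
  let ?N = "distr \<nu> \<nu> T"
  interpret N: prob_space ?N by (rule \<nu>.prob_space_distr[OF T_meas])
  have ac: "absolutely_continuous \<nu> ?N"
    unfolding absolutely_continuous_def
    using null by (auto simp: null_sets_def emeasure_distr[OF T_meas])
  have f: "(\<lambda>x. indicator A (S x) * indicator B x :: real) \<in> borel_measurable \<nu>"
    using A B S(1) by measurable
  have "(\<integral>x. U1 \<nu> T (indicator A) x * indicator B x \<partial>\<nu>) =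
      (\<integral>x. enn2real (RN_deriv \<nu> ?N x) * (indicator A (S x) * indicator B x) \<partial>\<nu>)"
    unfolding U1_def S_def by (simp add: mult.assoc)
  also have "\<dots> = (\<integral>x. indicator A (S x) * indicator B x \<partial>?N)"
    by (rule \<nu>.RN_deriv_integral[symmetric, OF N.sigma_finite_measure_axioms ac sets_distr f])
  also have "\<dots> = (\<integral>x. indicator A (S (T x)) * indicator B (T x) \<partial>\<nu>)"
    by (rule integral_distr[OF T_meas f])
  also have "\<dots> = (\<integral>x. indicator (A \<inter> T -` B) x \<partial>\<nu>)"
  proof (rule integral_cong_AE)
    show "(\<lambda>x. indicator A (S (T x)) * indicator B (T x) :: real) \<in> borel_measurable \<nu>"
      using measurable_compose[OF T_meas f] .
    have "T -` B \<inter> space \<nu> \<in> sets \<nu>" by (rule measurable_sets[OF T_meas B])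
    then show "(\<lambda>x. indicator (A \<inter> T -` B) x :: real) \<in> borel_measurable \<nu>" using A by auto
    show "AE x in \<nu>. indicator A (S (T x)) * indicator B (T x) = (indicator (A \<inter> T -` B) x :: real)"
      using S(2) by eventually_elim (auto simp: indicator_def)
  qed
  also have "\<dots> = measure \<nu> (A \<inter> T -` B)" by simp
  finally show ?thesis using A B True by (simp add: very_weak_coords_def)
qed (auto simp: very_weak_coords_def sets_\<nu>)

lemma topspace_A_mu_topology [simp]: "topspace (A_mu_topology \<mu> \<nu>) = A_mu \<mu> \<nu>"
proof -
  have "topspace (very_weak_topology \<nu>) = aut_star \<nu>"
    by (simp add: very_weak_topology_def topspace_pullback_topology)
  then show ?thesis using A_mu_aut_star
    by (auto simp: A_mu_topology_def)
qed

lemma continuous_map_A_mu_coord: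
  assumes "A \<in> sets borel" "B \<in> sets borel"
  shows "continuous_map (A_mu_topology \<mu> \<nu>) euclideanreal (\<lambda>a. measure \<nu> (A \<inter> a g -` B))"
proof (rule continuous_map_eq)
  have "continuous_map (euclidean :: ('x set \<times> 'x set \<Rightarrow> real) topology) euclideanreal (\<lambda>c. c (A, B))"
    using continuous_on_product_coordinates by simp
  from continuous_map_pullback[OF this]
  have "continuous_map (very_weak_topology \<nu>) euclideanreal ((\<lambda>c. c (A, B)) \<circ> very_weak_coords \<nu>)"
    unfolding very_weak_topology_def .
  moreover have "continuous_map (A_mu_topology \<mu> \<nu>) (very_weak_topology \<nu>) (\<lambda>a. a g)"
    unfolding A_mu_topology_def
    by (intro continuous_map_from_subtopology continuous_map_product_projection) simp
  ultimately show "continuous_map (A_mu_topology \<mu> \<nu>) euclideanreal (((\<lambda>c. c (A, B)) \<circ> very_weak_coords \<nu>) \<circ> (\<lambda>a. a g))"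
    by (rule continuous_map_compose[rotated])
  show "(((\<lambda>c. c (A, B)) \<circ> very_weak_coords \<nu>) \<circ> (\<lambda>a. a g)) a = measure \<nu> (A \<inter> a g -` B)"
    if "a \<in> topspace (A_mu_topology \<mu> \<nu>)" for a
    using that very_weak_coords_eq[OF A_mu_aut_star[of a g], of A B] assms by simp
qed

lemma continuous_map_into_A_mu:
  assumes in_A: "\<And>w. w \<in> topspace T \<Longrightarrow> f w \<in> A_mu \<mu> \<nu>"
    and coord: "\<And>g A B. A \<in> sets borel \<Longrightarrow> B \<in> sets borel \<Longrightarrow>
      continuous_map T euclideanreal (\<lambda>w. measure \<nu> (A \<inter> f w g -` B))"
  shows "continuous_map T (A_mu_topology \<mu> \<nu>) f"
  unfolding A_mu_topology_def
proof (rule continuous_map_into_subtopology)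
  show "f \<in> topspace T \<rightarrow> A_mu \<mu> \<nu>" using in_A by auto
  show "continuous_map T (product_topology (\<lambda>g. very_weak_topology \<nu>) UNIV) f"
    unfolding continuous_map_componentwise_UNIV
  proof
    fix g
    show "continuous_map T (very_weak_topology \<nu>) (\<lambda>w. f w g)"
      unfolding very_weak_topology_def
    proof (rule continuous_map_pullback')
      show "topspace T \<subseteq> (\<lambda>w. f w g) -` aut_star \<nu>" using in_A A_mu_aut_star by auto
      have "continuous_map T euclideanreal (\<lambda>w. very_weak_coords \<nu> (f w g) i)" for i
      proof -
        obtain A B where i: "i = (A, B)" by (cases i)
        show ?thesis
        proof (rule continuous_map_eq)
          show "continuous_map T euclideanreal
            (\<lambda>w. if A \<in> sets borel \<and> B \<in> sets borel then measure \<nu> (A \<inter> f w g -` B) else 0)"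
            using coord[of A B g] by auto
          show "(if A \<in> sets borel \<and> B \<in> sets borel then measure \<nu> (A \<inter> f w g -` B) else 0) =
              very_weak_coords \<nu> (f w g) i" if "w \<in> topspace T" for w
            unfolding i by (rule very_weak_coords_eq[symmetric]) (use that in_A A_mu_aut_star in auto)
        qed
      qed
      then show "continuous_map T euclidean (very_weak_coords \<nu> \<circ> (\<lambda>w. f w g))"
        unfolding euclidean_product_topology[symmetric] continuous_map_componentwise_UNIV by simp
    qed
  qed
qed

lemma P_mu_iff:
  fixes \<eta> :: "('g \<Rightarrow> 'z::polish_space) measure"
  shows "\<eta> \<in> P_mu \<mu> \<longleftrightarrow> sets \<eta> = sets borel \<and> prob_space \<eta> \<and> stationary \<mu> \<eta> shift_action"
proof -
  have "shift_action g \<in> borel_measurable (borel :: ('g \<Rightarrow> 'z) measure)" for g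
    unfolding shift_action_def by (intro measurable_coordinatewise_then_product measurable_product_coordinates)
  from stationary_nn_iff[of \<eta> shift_action borel \<mu>, OF _ _ this refl]
  show ?thesis unfolding P_mu_def by auto
qed

end

lemma shift_action_measurable:
  "shift_action g \<in> borel_measurable (borel :: ('g::{group_add,countable} \<Rightarrow> 'z::second_countable_topology) measure)"
  unfolding shift_action_def by (intro measurable_coordinatewise_then_product measurable_product_coordinates)

lemma shift_action_plus: "shift_action (g + h) z = shift_action g (shift_action h z)"
  by (simp only: shift_action_def minus_add add.assoc)

lemma borel_action_shift:
  "borel_action M (shift_action :: 'g::{group_add,countable} \<Rightarrow> ('g \<Rightarrow> 'z::second_countable_topology) \<Rightarrow> _)"
proof -
  have "shift_action 0 z = z" for z :: "'g \<Rightarrow> 'z" by (simp add: shift_action_def)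
  then show ?thesis by (simp add: borel_action_def shift_action_measurable shift_action_plus)
qed

lemma (in stationary_setup) shift_null:
  fixes \<eta> :: "('g \<Rightarrow> 'z::polish_space) measure"
  assumes \<eta>: "\<eta> \<in> P_mu \<mu>" and A: "A \<in> sets borel" and "measure \<eta> A = 0"
  shows "measure \<eta> (shift_action g -` A) = 0"
proof -
  from \<eta> interpret prob_space \<eta> by (simp add: P_mu_iff)
  obtain c where "measure \<eta> (shift_action g -` A) \<le> c * measure \<eta> A"
    using stationary_nonsingular_constants[OF gen, where 'a="'g \<Rightarrow> 'z"] \<eta> A borel_action_shift
    unfolding P_mu_iff by blast
  then show ?thesis using assms(3) by (simp add: measure_le_0_iff)
qed

lemma topspace_P_mu_topology [simp]: "topspace (P_mu_topology \<mu>) = P_mu \<mu>"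
  by (simp add: P_mu_topology_def topspace_pullback_topology)

lemma continuous_map_P_mu_coord:
  fixes f :: "('g::{group_add,countable} \<Rightarrow> 'z::topological_space) \<Rightarrow> real"
  assumes "continuous_on UNIV f" "bounded (range f)"
  shows "continuous_map (P_mu_topology \<mu>) euclideanreal (\<lambda>\<eta>. \<integral>x. f x \<partial>\<eta>)"
proof -
  have "continuous_map (euclidean :: ((('g \<Rightarrow> 'z) \<Rightarrow> real) \<Rightarrow> real) topology) euclideanreal (\<lambda>c. c f)"
    using continuous_on_product_coordinates by simp
  from continuous_map_pullback[OF this]
  show ?thesis unfolding P_mu_topology_def
    by (rule continuous_map_eq) (simp add: assms)
qed

lemma continuous_map_into_P_mu:
  fixes E :: "'w \<Rightarrow> ('g::{group_add,countable} \<Rightarrow> 'z::topological_space) measure"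
  assumes in_P: "\<And>w. w \<in> topspace T \<Longrightarrow> E w \<in> P_mu \<mu>"
    and coord: "\<And>f :: ('g \<Rightarrow> 'z) \<Rightarrow> real. continuous_on UNIV f \<Longrightarrow> bounded (range f) \<Longrightarrow>
      continuous_map T euclideanreal (\<lambda>w. \<integral>x. f x \<partial>(E w))"
  shows "continuous_map T (P_mu_topology \<mu>) E"
  unfolding P_mu_topology_def
proof (rule continuous_map_pullback')
  show "topspace T \<subseteq> E -` P_mu \<mu>" using in_P by auto
  have "continuous_map T euclideanreal (\<lambda>w. if continuous_on UNIV f \<and> bounded (range f) then (\<integral>x. f x \<partial>(E w)) else 0)"
    for f :: "('g \<Rightarrow> 'z) \<Rightarrow> real"
    using coord[of f] by auto
  then show "continuous_map T euclidean ((\<lambda>\<eta> (f :: ('g \<Rightarrow> 'z) \<Rightarrow> real).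
        if continuous_on UNIV f \<and> bounded (range f) then (\<integral>x. f x \<partial>\<eta>) else 0) \<circ> E)"
    unfolding euclidean_product_topology[symmetric] continuous_map_componentwise_UNIV by simp
qed

section \<open>Named actions\<close>

instance prod :: (polish_space, polish_space) polish_space ..

lemma
  shows borel_measurable_fst: "fst \<in> borel_measurable borel"
    and borel_measurable_snd: "snd \<in> borel_measurable borel"
  by (auto intro!: borel_measurable_continuous_onI continuous_on_fst continuous_on_snd continuous_on_id)

lemma dist_fun_bounds:
  fixes x y :: "'g::countable \<Rightarrow> 'b::metric_space"
  shows dist_fun_le_2: "dist x y \<le> 2"
    and dist_fun_le_sum: "dist x y \<le> (\<Sum>n<N. min 1 (dist (x (from_nat n)) (y (from_nat n)))) + 2 * (1/2)^N"
proof -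
  let ?t = "\<lambda>n. (1/2)^n * min (dist (x (from_nat n)) (y (from_nat n))) 1 :: real"
  have t: "0 \<le> ?t n" "?t n \<le> (1/2)^n" for n by (auto intro: mult_left_le)
  have s: "summable (\<lambda>n. (1/2::real)^n)" by (simp add: summable_geometric)
  have st: "summable ?t" by (rule summable_comparison_test'[OF s]) (use t in auto)
  have geo: "(\<Sum>n. (1/2::real)^n) = 2" using suminf_geometric[of "1/2::real"] by simp
  show "dist x y \<le> 2"
    unfolding dist_fun_def using suminf_le[OF t(2) st s] geo by simp
  have "dist x y = (\<Sum>n. ?t (n + N)) + (\<Sum>n<N. ?t n)"
    unfolding dist_fun_def by (rule suminf_split_initial_segment[OF st])
  also have "(\<Sum>n. ?t (n + N)) \<le> (\<Sum>n. (1/2::real)^n * (1/2)^N)"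
  proof (rule suminf_le)
    show "?t (n + N) \<le> (1/2)^n * (1/2)^N" for n using t(2)[of "n + N"] by (simp add: power_add)
    show "summable (\<lambda>n. ?t (n + N))" using st by (rule summable_ignore_initial_segment)
    show "summable (\<lambda>n. (1/2::real)^n * (1/2)^N)" using s by (rule summable_mult2)
  qed
  also have "\<dots> = 2 * (1/2)^N" using suminf_mult2[OF s, of "(1/2)^N"] geo by simp
  also have "(\<Sum>n<N. ?t n) \<le> (\<Sum>n<N. min 1 (dist (x (from_nat n)) (y (from_nat n))))"
  proof (rule sum_mono)
    fix n
    show "?t n \<le> min 1 (dist (x (from_nat n)) (y (from_nat n)))"
      using mult_left_le_one_le[of "min (dist (x (from_nat n)) (y (from_nat n))) 1" "(1/2)^n"]
      by (simp add: min.commute power_le_one)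
  qed
  finally show "dist x y \<le> (\<Sum>n<N. min 1 (dist (x (from_nat n)) (y (from_nat n)))) + 2 * (1/2)^N" by simp
qed

lemma AE_summable_of_integrals:
  assumes "prob_space N" and h [measurable]: "\<And>n::nat. h n \<in> borel_measurable N"
    and b: "\<And>n x. 0 \<le> h n x" "\<And>n x. h n x \<le> K" and small: "\<And>n. (\<integral>x. h n x \<partial>N) < (1/2)^n"
  shows "AE x in N. summable (\<lambda>n. h n x :: real)"
proof -
  interpret prob_space N by fact
  have int: "integrable N (h n)" for n
    by (rule integrable_const_bound[of _ K]) (use b in auto)
  have s: "summable (\<lambda>n. (1/2::real)^n)" by (simp add: summable_geometric)
  have "(\<integral>\<^sup>+x. (\<Sum>n. ennreal (h n x)) \<partial>N) = (\<Sum>n. \<integral>\<^sup>+x. ennreal (h n x) \<partial>N)"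
    by (rule nn_integral_suminf) simp
  also have "\<dots> \<le> (\<Sum>n. ennreal ((1/2)^n))"
    using small b(1) int by (intro suminf_le) (auto simp: nn_integral_eq_integral intro!: ennreal_leI less_imp_le)
  also have "\<dots> = ennreal (\<Sum>n. (1/2)^n)" by (rule suminf_ennreal2[OF _ s]) simp
  also have "\<dots> < \<infinity>" by simp
  finally have fin: "(\<integral>\<^sup>+x. (\<Sum>n. ennreal (h n x)) \<partial>N) \<noteq> \<infinity>" by simp
  have "AE x in N. (\<Sum>n. ennreal (h n x)) \<noteq> \<infinity>"
    by (rule nn_integral_PInf_AE[OF _ fin]) simp
  then show ?thesis
    by eventually_elim (auto intro!: summable_suminf_not_top b)
qed

lemma Cauchy_if_summable_dist:
  fixes s :: "nat \<Rightarrow> 'b::metric_space"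
  assumes "summable (\<lambda>n. dist (s n) (s (Suc n)))"
  shows "Cauchy s"
proof (rule metric_CauchyI)
  have tri: "dist (s m) (s n) \<le> (\<Sum>k=m..<n. dist (s k) (s (Suc k)))" if "m \<le> n" for m n
    using that
  proof (induction rule: dec_induct)
    case (step n)
    then show ?case using dist_triangle[of "s m" "s (Suc n)" "s n"] by simp
  qed simp
  fix e :: real assume "0 < e"
  then obtain N where N: "\<And>m n. m \<ge> N \<Longrightarrow> norm (\<Sum>k=m..<n. dist (s k) (s (Suc k))) < e"
    using assms unfolding summable_Cauchy by blast
  have le: "dist (s m) (s n) < e" if "N \<le> m" "m \<le> n" for m n
    using tri[OF that(2)] N[OF that(1), of n] by (auto simp: sum_nonneg)
  have "dist (s m) (s n) < e" if "m \<ge> N" "n \<ge> N" for m n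
    using le[of m n] le[of n m] that by (cases "m \<le> n") (auto simp: dist_commute)
  then show "\<exists>M. \<forall>m\<ge>M. \<forall>n\<ge>M. dist (s m) (s n) < e" by blast
qed

type_synonym ('g, 'x, 'z) named_action = "('g \<Rightarrow> 'x \<Rightarrow> 'x) \<times> ('x \<Rightarrow> 'z)"

context stationary_setup
begin

text \<open>The orbit \<open>orb (a, \<phi>)\<close> takes values in a single Polish space with bounded metric, so that \<open>rho\<close>
  metrizes convergence in measure of all \<open>a g\<close> and all \<open>\<phi> \<circ> a g\<close>.\<close>

definition named_actions :: "('g, 'x, 'z::polish_space) named_action set" where
  "named_actions = A_mu \<mu> \<nu> \<times> borel_measurable borel"

definition orb :: "('g, 'x, 'z::polish_space) named_action \<Rightarrow> 'x \<Rightarrow> 'g \<Rightarrow> 'x \<times> 'z" where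
  "orb w x = (\<lambda>g. (fst w g x, snd w (fst w g x)))"

definition rho :: "('g, 'x, 'z::polish_space) named_action \<Rightarrow> ('g, 'x, 'z) named_action \<Rightarrow> real" where
  "rho w w' = (\<integral>x. dist (orb w x) (orb w' x) \<partial>\<nu>)"

lemma named_actionsD:
  assumes "w \<in> named_actions"
  shows "fst w \<in> A_mu \<mu> \<nu>" "snd w \<in> borel_measurable borel" "fst w g \<in> borel_measurable borel"
    "(\<lambda>x. snd w (fst w g x)) \<in> borel_measurable borel"
proof -
  show 1: "fst w \<in> A_mu \<mu> \<nu>" "snd w \<in> borel_measurable borel" using assms by (auto simp: named_actions_def)
  then show 2: "fst w g \<in> borel_measurable borel" by (intro A_mu_measurable)
  show "(\<lambda>x. snd w (fst w g x)) \<in> borel_measurable borel" using measurable_compose[OF 2 1(2)] .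
qed

lemma orb_measurable: "w \<in> named_actions \<Longrightarrow> orb w \<in> borel_measurable borel"
  unfolding orb_def by (intro measurable_coordinatewise_then_product borel_measurable_Pair named_actionsD)

lemma dist_orb_measurable:
  assumes "w \<in> named_actions" "w' \<in> named_actions"
  shows "(\<lambda>x. dist (orb w x) (orb w' x)) \<in> borel_measurable \<nu>"
  using borel_measurable_\<nu>[OF orb_measurable[OF assms(1)]] borel_measurable_\<nu>[OF orb_measurable[OF assms(2)]]
  by (rule borel_measurable_dist)

lemma dist_orb_integrable:
  assumes "w \<in> named_actions" "w' \<in> named_actions"
  shows "integrable \<nu> (\<lambda>x. dist (orb w x) (orb w' x))"
  by (rule \<nu>.integrable_const_bound[of _ 2]) (use dist_orb_measurable[OF assms] in \<open>auto simp: dist_fun_le_2\<close>)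

lemma AE_orb_tendsto:
  assumes w: "w \<in> named_actions" and \<sigma>: "\<And>n. \<sigma> n \<in> named_actions" and close: "\<And>n. rho w (\<sigma> n) < (1/2)^n"
  shows "AE x in \<nu>. (\<lambda>n. orb (\<sigma> n) x) \<longlonglongrightarrow> orb w x"
proof -
  have "AE x in \<nu>. summable (\<lambda>n. dist (orb w x) (orb (\<sigma> n) x))"
    by (rule AE_summable_of_integrals[OF prob_\<nu>, where K = 2])
      (use dist_orb_measurable[OF w \<sigma>] close in \<open>auto simp: dist_fun_le_2 rho_def\<close>)
  then show ?thesis
  proof eventually_elim
    case (elim x)
    then have "(\<lambda>n. dist (orb w x) (orb (\<sigma> n) x)) \<longlonglongrightarrow> 0" by (rule summable_LIMSEQ_zero)
    then show ?case by (subst tendsto_dist_iff) (simp add: dist_commute)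
  qed
qed

lemma orb_tendstoD:
  assumes "(\<lambda>n. y n) \<longlonglongrightarrow> (y' :: 'g \<Rightarrow> 'x \<times> 'z::polish_space)"
  shows "(\<lambda>n. fst (y n g)) \<longlonglongrightarrow> fst (y' g)" "(\<lambda>n. snd (y n g)) \<longlonglongrightarrow> snd (y' g)"
proof -
  have "isCont (\<lambda>y :: 'g \<Rightarrow> 'x \<times> 'z. y g) y'"
    by (rule continuous_on_interior[OF continuous_on_product_coordinates]) simp
  from isCont_tendsto_compose[OF this assms] have "(\<lambda>n. y n g) \<longlonglongrightarrow> y' g" .
  then show "(\<lambda>n. fst (y n g)) \<longlonglongrightarrow> fst (y' g)" "(\<lambda>n. snd (y n g)) \<longlonglongrightarrow> snd (y' g)"
    by (auto intro: tendsto_fst tendsto_snd)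
qed

lemma measure_diff_le_sym_diff:
  assumes "A \<in> sets \<nu>" "B \<in> sets \<nu>" "D \<in> sets \<nu>"
  shows "\<bar>measure \<nu> (D \<inter> A) - measure \<nu> (D \<inter> B)\<bar> \<le> measure \<nu> (sym_diff A B)"
proof -
  have "measure \<nu> (D \<inter> A) \<le> measure \<nu> (D \<inter> B) + measure \<nu> (sym_diff A B)"
    if "A \<in> sets \<nu>" "B \<in> sets \<nu>" for A B
  proof -
    have "measure \<nu> (D \<inter> A) \<le> measure \<nu> ((D \<inter> B) \<union> sym_diff A B)"
      by (rule \<nu>.finite_measure_mono) (use that assms in auto)
    also have "\<dots> \<le> measure \<nu> (D \<inter> B) + measure \<nu> (sym_diff A B)"
      by (rule measure_subadditive) (use that assms in \<open>auto simp: \<nu>.emeasure_eq_measure\<close>)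
    finally show ?thesis .
  qed
  from this[OF assms(1,2)] this[OF assms(2,1)] show ?thesis by (simp add: Un_commute abs_le_iff)
qed

lemma A_mu_limit_vimage:
  assumes \<sigma>: "\<And>n. \<sigma> n \<in> A_mu \<mu> \<nu>" and S: "S \<in> borel_measurable borel"
    and lim: "AE x in \<nu>. (\<lambda>n. \<sigma> n g x) \<longlonglongrightarrow> S x" and B: "B \<in> sets borel" and D: "D \<in> sets borel"
  shows "(\<lambda>n. measure \<nu> (D \<inter> \<sigma> n g -` B)) \<longlonglongrightarrow> measure \<nu> (D \<inter> S -` B)"
proof -
  have SB: "S -` B \<in> sets \<nu>" using measurable_sets[OF S B] by (simp add: sets_\<nu>)
  have "(\<lambda>n. measure \<nu> (sym_diff (\<sigma> n g -` B) (S -` B))) \<longlonglongrightarrow> 0"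
    by (rule vimage_symdiff_tendsto[OF sets_\<nu> \<nu>.finite_measure_axioms A_mu_measurable[OF \<sigma>] S lim
        A_mu_bound[OF \<sigma>] cst_nonneg B])
  then have "(\<lambda>n. measure \<nu> (D \<inter> \<sigma> n g -` B) - measure \<nu> (D \<inter> S -` B)) \<longlonglongrightarrow> 0"
    by (rule Lim_null_comparison[rotated])
      (use measure_diff_le_sym_diff[OF A_mu_vimage[OF \<sigma> B] SB] D in \<open>auto simp: sets_\<nu>\<close>)
  then show ?thesis by (simp add: LIM_zero_iff)
qed

lemma complete_named_actions:
  fixes \<sigma> :: "nat \<Rightarrow> ('g, 'x, 'z::polish_space) named_action"
  assumes \<sigma>: "\<And>n. \<sigma> n \<in> named_actions" and close: "\<And>n. rho (\<sigma> n) (\<sigma> (Suc n)) < (1/2)^n"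
  shows "\<exists>w\<in>named_actions. (\<lambda>n. rho (\<sigma> n) w) \<longlonglongrightarrow> 0"
proof -
  have "AE x in \<nu>. summable (\<lambda>n. dist (orb (\<sigma> n) x) (orb (\<sigma> (Suc n)) x))"
    by (rule AE_summable_of_integrals[OF prob_\<nu>, where K = 2])
      (use dist_orb_measurable[OF \<sigma> \<sigma>] close in \<open>auto simp: dist_fun_le_2 rho_def\<close>)
  then have cau: "AE x in \<nu>. Cauchy (\<lambda>n. orb (\<sigma> n) x)"
    by eventually_elim (rule Cauchy_if_summable_dist)
  obtain y where y [measurable]: "y \<in> borel_measurable borel"
    and y_lim: "\<And>x. Cauchy (\<lambda>n. orb (\<sigma> n) x) \<Longrightarrow> (\<lambda>n. orb (\<sigma> n) x) \<longlonglongrightarrow> y x"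
    using borel_limit_selection[of "\<lambda>n. orb (\<sigma> n)" borel, OF orb_measurable[OF \<sigma>]] by auto
  have lim: "AE x in \<nu>. (\<lambda>n. orb (\<sigma> n) x) \<longlonglongrightarrow> y x"
    using cau by eventually_elim (rule y_lim)
  define a where "a g x = fst (y x g)" for g x
  define \<phi> where "\<phi> x = snd (y x 0)" for x
  have yg [measurable]: "(\<lambda>x. y x g) \<in> borel_measurable borel" for g
    by (rule measurable_product_then_coordinatewise[OF y])
  have a_meas: "a g \<in> borel_measurable borel" for g
    unfolding a_def by (rule measurable_compose[OF yg borel_measurable_fst])
  have sy_meas: "(\<lambda>x. snd (y x g)) \<in> borel_measurable borel" for g
    by (rule measurable_compose[OF yg borel_measurable_snd])
  then have \<phi>_meas: "\<phi> \<in> borel_measurable borel" unfolding \<phi>_def .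
  note \<sigma>D = named_actionsD[OF \<sigma>]
  have lim_a: "AE x in \<nu>. (\<lambda>n. fst (\<sigma> n) g x) \<longlonglongrightarrow> a g x" for g
    using lim by eventually_elim (drule orb_tendstoD(1)[of _ _ g], simp add: orb_def a_def)
  have lim_\<phi>a: "AE x in \<nu>. (\<lambda>n. snd (\<sigma> n) (fst (\<sigma> n) g x)) \<longlonglongrightarrow> snd (y x g)" for g
    using lim by eventually_elim (drule orb_tendstoD(2)[of _ _ g], simp add: orb_def)
  have zero_n: "AE x in \<nu>. \<forall>n. fst (\<sigma> n) 0 x = x"
    using A_mu_zero[OF \<sigma>D(1)] by (simp add: AE_all_countable)
  have zero: "AE x in \<nu>. a 0 x = x"
    using lim_a[of 0] zero_n by eventually_elim (simp add: LIMSEQ_const_iff)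
  have plus: "AE x in \<nu>. a (g + h) x = a g (a h x)" for g h
  proof (rule compose_limit[OF sets_\<nu> prob_\<nu> \<sigma>D(3) a_meas lim_a A_mu_bound[OF \<sigma>D(1)] cst_nonneg \<sigma>D(3) a_meas a_meas lim_a])
    have "AE x in \<nu>. \<forall>n. fst (\<sigma> n) (g + h) x = fst (\<sigma> n) g (fst (\<sigma> n) h x)"
      using A_mu_plus[OF \<sigma>D(1)] by (simp add: AE_all_countable)
    then show "AE x in \<nu>. (\<lambda>n. fst (\<sigma> n) g (fst (\<sigma> n) h x)) \<longlonglongrightarrow> a (g + h) x"
      using lim_a[of "g + h"] by eventually_elim simp
  qed
  have "stationary \<mu> \<nu> a"
    unfolding stationary_def
  proof
    fix E :: "'x set" assume E: "E \<in> sets borel"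
    have "(\<lambda>n. \<integral>g. measure \<nu> (fst (\<sigma> n) g -` E) \<partial>measure_pmf \<mu>) \<longlonglongrightarrow> (\<integral>g. measure \<nu> (a g -` E) \<partial>measure_pmf \<mu>)"
    proof (rule integral_dominated_convergence[where w = "\<lambda>_. 1"])
      show "AE g in measure_pmf \<mu>. (\<lambda>n. measure \<nu> (fst (\<sigma> n) g -` E)) \<longlonglongrightarrow> measure \<nu> (a g -` E)"
        using A_mu_limit_vimage[OF \<sigma>D(1) a_meas lim_a E, of UNIV] by auto
    qed auto
    moreover have "(\<integral>g. measure \<nu> (fst (\<sigma> n) g -` E) \<partial>measure_pmf \<mu>) = measure \<nu> E" for n
      using A_mu_stationary[OF \<sigma>D(1)] E by (simp add: stationary_def)
    ultimately show "measure \<nu> E = (\<integral>g. measure \<nu> (a g -` E) \<partial>measure_pmf \<mu>)"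
      by (simp add: LIMSEQ_const_iff)
  qed
  then have a: "a \<in> A_mu \<mu> \<nu>" using a_meas zero plus by (simp add: A_mu_iff borel_action_def)
  then have w: "(a, \<phi>) \<in> named_actions" using \<phi>_meas by (simp add: named_actions_def)
  have lim_\<phi>: "AE x in \<nu>. (\<lambda>n. snd (\<sigma> n) x) \<longlonglongrightarrow> \<phi> x"
    using lim_\<phi>a[of 0] zero_n by eventually_elim (simp add: \<phi>_def)
  have "AE x in \<nu>. snd (y x g) = \<phi> (a g x)" for g
    by (rule compose_limit[OF sets_\<nu> prob_\<nu> \<sigma>D(3) a_meas lim_a A_mu_bound[OF \<sigma>D(1)] cst_nonneg \<sigma>D(2) \<phi>_meas
          sy_meas lim_\<phi> lim_\<phi>a])
  then have "AE x in \<nu>. \<forall>g. snd (y x g) = \<phi> (a g x)" by (simp add: AE_all_countable)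
  then have lim': "AE x in \<nu>. (\<lambda>n. orb (\<sigma> n) x) \<longlonglongrightarrow> orb (a, \<phi>) x"
    using lim
  proof eventually_elim
    case (elim x)
    have "y x = orb (a, \<phi>) x"
      using elim(1) by (intro ext) (simp add: orb_def prod_eq_iff a_def)
    with elim(2) show ?case by simp
  qed
  have "(\<lambda>n. rho (\<sigma> n) (a, \<phi>)) \<longlonglongrightarrow> (\<integral>x. 0 \<partial>\<nu>)"
    unfolding rho_def
  proof (rule integral_dominated_convergence[where w = "\<lambda>_. 2"])
    show "AE x in \<nu>. (\<lambda>n. dist (orb (\<sigma> n) x) (orb (a, \<phi>) x)) \<longlonglongrightarrow> 0"
      using lim' by eventually_elim (rule iffD1[OF tendsto_dist_iff])
    show "(\<lambda>x. dist (orb (\<sigma> n) x) (orb (a, \<phi>) x)) \<in> borel_measurable \<nu>" for n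
      by (rule dist_orb_measurable[OF \<sigma> w])
  qed (auto simp: dist_fun_le_2)
  then show ?thesis using w by (intro bexI[of _ "(a, \<phi>)"]) simp_all
qed

sublocale NA: complete_pseudometric "named_actions :: ('g, 'x, 'z::polish_space) named_action set" rho
proof
  fix x y z :: "('g, 'x, 'z) named_action"
  show "rho x x = 0" by (simp add: rho_def)
  show "rho x y = rho y x" by (simp add: rho_def dist_commute)
  assume xyz: "x \<in> named_actions" "y \<in> named_actions" "z \<in> named_actions"
  have "rho x z \<le> (\<integral>u. dist (orb x u) (orb y u) + dist (orb y u) (orb z u) \<partial>\<nu>)"
    unfolding rho_def
    by (intro integral_mono Bochner_Integration.integrable_add dist_orb_integrable xyz dist_triangle)
  also have "\<dots> = rho x y + rho y z"
    unfolding rho_def by (intro Bochner_Integration.integral_add dist_orb_integrable xyz)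
  finally show "rho x z \<le> rho x y + rho y z" .
qed (rule complete_named_actions)

lemma continuous_map_fst:
  "continuous_map (NA.pm_topology :: ('g, 'x, 'z::polish_space) named_action topology) (A_mu_topology \<mu> \<nu>) fst"
proof (rule continuous_map_into_A_mu)
  show "fst w \<in> A_mu \<mu> \<nu>" if "w \<in> topspace (NA.pm_topology :: ('g, 'x, 'z) named_action topology)" for w
    using that by (simp add: named_actionsD)
  fix g A B assume A: "A \<in> sets (borel :: 'x measure)" and B: "B \<in> sets (borel :: 'x measure)"
  show "continuous_map (NA.pm_topology :: ('g, 'x, 'z) named_action topology) euclideanreal
      (\<lambda>w. measure \<nu> (A \<inter> fst w g -` B))"
  proof (rule NA.continuous_map_real_seqI)
    fix \<sigma> and w :: "('g, 'x, 'z) named_action"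
    assume w: "w \<in> named_actions" and \<sigma>: "\<And>n. \<sigma> n \<in> named_actions" and c: "\<And>n. rho w (\<sigma> n) < (1/2)^n"
    have "AE x in \<nu>. (\<lambda>n. fst (\<sigma> n) g x) \<longlonglongrightarrow> fst w g x"
      using AE_orb_tendsto[OF w \<sigma> c] by eventually_elim (drule orb_tendstoD(1)[of _ _ g], simp add: orb_def)
    from A_mu_limit_vimage[OF named_actionsD(1)[OF \<sigma>] named_actionsD(3)[OF w] this B A]
    show "(\<lambda>n. measure \<nu> (A \<inter> fst (\<sigma> n) g -` B)) \<longlonglongrightarrow> measure \<nu> (A \<inter> fst w g -` B)" .
  qed
qed

lemma fst_surj: "topspace (A_mu_topology \<mu> \<nu>) \<subseteq> fst ` (named_actions :: ('g, 'x, 'z::polish_space) named_action set)"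
proof
  fix a assume "a \<in> topspace (A_mu_topology \<mu> \<nu>)"
  then have "(a, \<lambda>_. undefined) \<in> (named_actions :: ('g, 'x, 'z) named_action set)"
    by (simp add: named_actions_def)
  then show "a \<in> fst ` (named_actions :: ('g, 'x, 'z) named_action set)" by force
qed

lemma rho_le_sum:
  fixes w w' :: "('g, 'x, 'z::polish_space) named_action"
  assumes w: "w \<in> named_actions" and w': "w' \<in> named_actions"
  shows "rho w w' \<le> (\<Sum>n<N. \<integral>x. min 1 (dist (orb w x (from_nat n)) (orb w' x (from_nat n))) \<partial>\<nu>) + 2 * (1/2)^N"
proof -
  have m: "(\<lambda>x. orb w x g) \<in> borel_measurable \<nu>" if "w \<in> named_actions" for g and w :: "('g, 'x, 'z) named_action"
    by (rule measurable_product_then_coordinatewise[OF borel_measurable_\<nu>[OF orb_measurable[OF that]]])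
  have i: "integrable \<nu> (\<lambda>x. min 1 (dist (orb w x g) (orb w' x g)))" for g
    by (rule \<nu>.integrable_const_bound[of _ 1]) (use m[OF w, of g] m[OF w', of g] in auto)
  have "rho w w' \<le> (\<integral>x. (\<Sum>n<N. min 1 (dist (orb w x (from_nat n)) (orb w' x (from_nat n)))) + 2 * (1/2)^N \<partial>\<nu>)"
    unfolding rho_def
    by (intro integral_mono dist_orb_integrable w w' dist_fun_le_sum Bochner_Integration.integrable_add
        Bochner_Integration.integrable_sum i) simp
  also have "\<dots> = (\<Sum>n<N. \<integral>x. min 1 (dist (orb w x (from_nat n)) (orb w' x (from_nat n))) \<partial>\<nu>) + 2 * (1/2)^N"
    by (subst Bochner_Integration.integral_add)
      (auto intro!: Bochner_Integration.integrable_sum i simp: Bochner_Integration.integral_sum[OF i] \<nu>.prob_space[simplified])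
  finally show ?thesis .
qed

lemma rho_lessI:
  assumes e: "e > 0"
  shows "\<exists>(F :: 'g set) e'. finite F \<and> e' > 0 \<and>
    (\<forall>(w :: ('g, 'x, 'z::polish_space) named_action) w'. w \<in> named_actions \<longrightarrow> w' \<in> named_actions \<longrightarrow>
      (\<forall>g\<in>F. (\<integral>x. min 1 (dist (orb w x g) (orb w' x g)) \<partial>\<nu>) < e') \<longrightarrow> rho w w' < e)"
proof -
  obtain N where N: "(1/2::real)^N < e/4" using real_arch_pow_inv[of "e/4" "1/2"] e by auto
  define e' where "e' = e / (2 * (N + 1))"
  have e': "e' > 0" using e by (simp add: e'_def)
  have "rho w w' < e" if w: "w \<in> named_actions" "w' \<in> named_actions"
    and cl: "\<forall>g\<in>from_nat ` {..<N}. (\<integral>x. min 1 (dist (orb w x g) (orb w' x g)) \<partial>\<nu>) < e'"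
    for w w' :: "('g, 'x, 'z) named_action"
  proof -
    have "(\<Sum>n<N. \<integral>x. min 1 (dist (orb w x (from_nat n)) (orb w' x (from_nat n))) \<partial>\<nu>) \<le> (\<Sum>n<N. e')"
      by (rule sum_mono) (use cl in \<open>auto intro: less_imp_le\<close>)
    also have "\<dots> = real N * e'" by simp
    also have "\<dots> \<le> e / 2" using e by (simp add: e'_def field_simps)
    finally show ?thesis using rho_le_sum[OF w, of N] N by linarith
  qed
  then show ?thesis using e' by (intro exI[of _ "from_nat ` {..<N}"] exI[of _ e']) blast
qed

lemma continuous_map_sym_diff:
  assumes A: "A \<in> sets borel" and B: "B \<in> sets borel"
  shows "continuous_map (A_mu_topology \<mu> \<nu>) euclideanreal (\<lambda>a. measure \<nu> (sym_diff A (a g -` B)))"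
proof (rule continuous_map_eq)
  show "continuous_map (A_mu_topology \<mu> \<nu>) euclideanreal
      (\<lambda>a. measure \<nu> A + measure \<nu> (UNIV \<inter> a g -` B) - 2 * measure \<nu> (A \<inter> a g -` B))"
    by (intro continuous_map_diff continuous_map_add continuous_map_real_mult_left continuous_map_A_mu_coord
        continuous_map_const[THEN iffD2] A B) auto
  fix a assume "a \<in> topspace (A_mu_topology \<mu> \<nu>)"
  then have m: "a g -` B \<in> sets \<nu>" "A \<in> sets \<nu>" using A_mu_vimage[OF _ B] A by (auto simp: sets_\<nu>)
  have "measure \<nu> (sym_diff A (a g -` B)) = measure \<nu> (A - a g -` B) + measure \<nu> (a g -` B - A)"
    by (rule \<nu>.finite_measure_Union) (use m in auto)
  then show "measure \<nu> A + measure \<nu> (UNIV \<inter> a g -` B) - 2 * measure \<nu> (A \<inter> a g -` B) =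
      measure \<nu> (sym_diff A (a g -` B))"
    using \<nu>.finite_measure_Diff'[OF m(2,1)] \<nu>.finite_measure_Diff'[OF m] by (simp add: Int_commute)
qed

lemma A_mu_neighbourhood:
  fixes u :: "'x \<Rightarrow> 'b::polish_space"
  assumes a: "a \<in> A_mu \<mu> \<nu>" and u: "u \<in> borel_measurable borel" and e: "e > 0"
  shows "\<exists>V. openin (A_mu_topology \<mu> \<nu>) V \<and> a \<in> V \<and>
    (\<forall>b\<in>V. (\<integral>x. min 1 (dist (u (a g x)) (u (b g x))) \<partial>\<nu>) < e)"
proof -
  let ?T = "A_mu_topology \<mu> \<nu>"
  obtain P m d where P: "\<forall>j. P j \<in> sets borel" "d > 0"
    and close: "\<forall>T S. T \<in> borel_measurable borel \<longrightarrow> S \<in> borel_measurable borel \<longrightarrow>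
      (\<forall>B\<in>sets borel. measure \<nu> (T -` B) \<le> cst g * measure \<nu> B) \<longrightarrow>
      (\<forall>j<m :: nat. measure \<nu> (sym_diff (T -` P j) (S -` P j)) < d) \<longrightarrow>
      (\<integral>x. min 1 (dist (u (T x)) (u (S x))) \<partial>\<nu>) < e"
    using compose_close[OF sets_\<nu> prob_\<nu> u e cst_nonneg[of g]] by (elim exE conjE) (rule that)
  let ?U = "\<lambda>j. {b\<in>topspace ?T. measure \<nu> (sym_diff (a g -` P j) (b g -` P j)) \<in> {..<d}}"
  have "openin ?T (topspace ?T \<inter> \<Inter>(?U ` {..<m}))"
  proof (rule openin_Int_Inter)
    fix X assume "X \<in> ?U ` {..<m}"
    then obtain j where X: "X = ?U j" by auto
    have "a g -` P j \<in> sets borel" using A_mu_vimage[OF a] P(1) by (simp add: sets_\<nu>)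
    then show "openin ?T X" unfolding X using P(1)
      by (intro openin_continuous_map_preimage[OF continuous_map_sym_diff]) simp_all
  next
    show "openin ?T (topspace ?T)" by (rule openin_topspace)
  qed simp
  moreover have "a \<in> topspace ?T \<inter> \<Inter>(?U ` {..<m})" using a P(2) by simp
  moreover have "(\<integral>x. min 1 (dist (u (a g x)) (u (b g x))) \<partial>\<nu>) < e"
    if b: "b \<in> topspace ?T \<inter> \<Inter>(?U ` {..<m})" for b
    using b A_mu_bound[OF a] A_mu_measurable[OF a]
    by (intro close[rule_format]) (simp_all add: A_mu_measurable)
  ultimately show ?thesis by blast
qed

lemma fst_somewhere_open:
  fixes w :: "('g, 'x, 'z::polish_space) named_action"
  assumes w: "w \<in> named_actions" and e: "e > 0"
  shows "\<exists>V. openin (A_mu_topology \<mu> \<nu>) V \<and> V \<noteq> {} \<and> V \<subseteq> fst ` NA.pball w e"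
proof -
  let ?T = "A_mu_topology \<mu> \<nu>"
  obtain F :: "'g set" and e' where F: "finite F" "e' > 0"
    and Fe: "\<And>w' :: ('g, 'x, 'z) named_action. w' \<in> named_actions \<Longrightarrow>
      (\<forall>g\<in>F. (\<integral>x. min 1 (dist (orb w x g) (orb w' x g)) \<partial>\<nu>) < e') \<Longrightarrow> rho w w' < e"
    using rho_lessI[OF e, where 'z='z] w by blast
  have u: "(\<lambda>x. (x, snd w x)) \<in> borel_measurable borel"
    by (intro borel_measurable_Pair named_actionsD[OF w] measurable_ident_sets) simp
  from choice[OF allI, OF A_mu_neighbourhood[OF named_actionsD(1)[OF w] u F(2)]]
  obtain V where V0: "\<forall>g. openin ?T (V g) \<and> fst w \<in> V g \<and> (\<forall>b\<in>V g.
      (\<integral>x. min 1 (dist (fst w g x, snd w (fst w g x)) (b g x, snd w (b g x))) \<partial>\<nu>) < e')" ..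
  then have V: "\<And>g. openin ?T (V g)" "\<And>g. fst w \<in> V g" by simp_all
  have "openin ?T (topspace ?T \<inter> \<Inter>(V ` F))"
    by (rule openin_Int_Inter) (use F(1) V(1) openin_topspace[of ?T] in auto)
  moreover have "fst w \<in> topspace ?T \<inter> \<Inter>(V ` F)" using V(2) named_actionsD(1)[OF w] by simp
  moreover have "topspace ?T \<inter> \<Inter>(V ` F) \<subseteq> fst ` NA.pball w e"
  proof
    fix a assume a: "a \<in> topspace ?T \<inter> \<Inter>(V ` F)"
    then have aw: "(a, snd w) \<in> named_actions" using named_actionsD(2)[OF w] by (simp add: named_actions_def)
    have "rho w (a, snd w) < e"
      by (rule Fe[OF aw]) (use a V0 in \<open>auto simp: orb_def\<close>)
    then show "a \<in> fst ` NA.pball w e" using aw by (force simp: NA.pball_def)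
  qed
  ultimately show ?thesis by blast
qed

end

section \<open>Realizing stationary measures on the shift\<close>

text \<open>The isomorphism passes through the unit interval, where the level sets of both labellings are
  consecutive intervals, so that they are matched up to the distances between endpoints.\<close>

lemma nonatomic_iso:
  fixes N1 :: "'a::polish_space measure" and N2 :: "'b::polish_space measure"
    and l1 :: "'a \<Rightarrow> nat" and l2 :: "'b \<Rightarrow> nat"
  assumes s1 [measurable_cong]: "sets N1 = sets borel" and p1: "prob_space N1" and na1: "\<And>x. emeasure N1 {x} = 0"
    and s2 [measurable_cong]: "sets N2 = sets borel" and p2: "prob_space N2" and na2: "\<And>x. emeasure N2 {x} = 0"
    and l1 [measurable]: "l1 \<in> measurable borel (count_space UNIV)"
    and l2 [measurable]: "l2 \<in> measurable borel (count_space UNIV)"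
    and le: "\<And>x. l1 x \<le> n" "\<And>x. l2 x \<le> n"
  shows "\<exists>\<theta> \<theta>'. \<theta> \<in> borel_measurable borel \<and> \<theta>' \<in> borel_measurable borel \<and> distr N1 borel \<theta> = N2 \<and>
    (AE x in N1. \<theta>' (\<theta> x) = x) \<and> (AE y in N2. \<theta> (\<theta>' y) = y) \<and>
    measure N1 {x. l1 x \<noteq> l2 (\<theta> x)} \<le> (\<Sum>j\<le>n. \<bar>measure N1 {x. l1 x < j} - measure N2 {y. l2 y < j}\<bar>)"
proof -
  interpret N1: prob_space N1 by fact
  interpret N2: prob_space N2 by fact
  have sp1: "space N1 = UNIV" and sp2: "space N2 = UNIV"
    using sets_eq_imp_space_eq[OF s1] sets_eq_imp_space_eq[OF s2] by auto
  let ?s = "\<lambda>j. measure N1 {x. l1 x < j}" and ?t = "\<lambda>j. measure N2 {y. l2 y < j}"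
  obtain f f' where f [measurable]: "f \<in> borel_measurable borel" "f' \<in> borel_measurable borel"
    and df: "distr N1 borel f = unit_lebesgue" and f'f: "AE x in N1. f' (f x) = x"
    and ff': "AE t in unit_lebesgue. f (f' t) = t" and fl: "\<And>j. AE x in N1. f x < ?s j \<longleftrightarrow> l1 x < j"
    using nonatomic_iso_unit_lebesgue[OF s1 p1 na1 l1] by blast
  obtain h h' where h [measurable]: "h \<in> borel_measurable borel" "h' \<in> borel_measurable borel"
    and dh: "distr N2 borel h = unit_lebesgue" and h'h: "AE x in N2. h' (h x) = x"
    and hh': "AE t in unit_lebesgue. h (h' t) = t" and hl: "\<And>j. AE x in N2. h x < ?t j \<longleftrightarrow> l2 x < j"
    using nonatomic_iso_unit_lebesgue[OF s2 p2 na2 l2] by blast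
  have fN: "f \<in> borel_measurable N1" and hN: "h \<in> borel_measurable N2" by measurable
  have pull_f: "AE x in N1. P (f x)" if "AE t in unit_lebesgue. P t" for P
    using that unfolding df[symmetric] by (rule AE_distrD[OF fN])
  have pull_h: "AE x in N2. P (h x)" if "AE t in unit_lebesgue. P t" for P
    using that unfolding dh[symmetric] by (rule AE_distrD[OF hN])
  define \<theta> where "\<theta> x = h' (f x)" for x
  define \<theta>' where "\<theta>' y = f' (h y)" for y
  have \<theta> [measurable]: "\<theta> \<in> borel_measurable borel" and \<theta>' [measurable]: "\<theta>' \<in> borel_measurable borel"
    unfolding \<theta>_def \<theta>'_def by measurable
  have \<theta>N: "\<theta> \<in> borel_measurable N1" by measurable
  have "distr N1 borel \<theta> = distr unit_lebesgue borel h'"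
    unfolding df[symmetric] by (subst distr_distr[OF _ fN]) (auto simp: comp_def \<theta>_def[abs_def])
  also have "\<dots> = distr N2 borel (\<lambda>y. h' (h y))"
    unfolding dh[symmetric] by (subst distr_distr[OF _ hN]) (auto simp: comp_def)
  also have "\<dots> = distr N2 borel (\<lambda>y. y)"
    by (rule distr_cong_AE) (use h'h in auto)
  also have "\<dots> = distr N2 N2 (\<lambda>y. y)" by (rule distr_cong) (auto simp: s2)
  also have "\<dots> = N2" by (rule distr_id)
  finally have d\<theta>: "distr N1 borel \<theta> = N2" .
  have h\<theta>: "AE x in N1. h (\<theta> x) = f x" unfolding \<theta>_def using pull_f[OF hh'] .
  have inv1: "AE x in N1. \<theta>' (\<theta> x) = x"
    using h\<theta> f'f by eventually_elim (simp add: \<theta>'_def)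
  have "AE y in N2. f (\<theta>' y) = h y" unfolding \<theta>'_def using pull_h[OF ff'] .
  then have inv2: "AE y in N2. \<theta> (\<theta>' y) = y"
    using h'h by eventually_elim (simp add: \<theta>_def)
  have hl': "AE x in N1. h (\<theta> x) < ?t j \<longleftrightarrow> l2 (\<theta> x) < j" for j
    using hl[of j] unfolding d\<theta>[symmetric] by (rule AE_distrD[OF \<theta>N])
  let ?I = "\<lambda>j. {min (?s j) (?t j)..<max (?s j) (?t j)}"
  have I: "measure N1 (f -` ?I j) = \<bar>?s j - ?t j\<bar>" for j
  proof -
    have "measure N1 (f -` ?I j) = measure unit_lebesgue (?I j)"
      unfolding df[symmetric] by (subst measure_distr[OF fN]) (auto simp: sp1)
    also have "\<dots> = max (?s j) (?t j) - min (?s j) (?t j)"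
      by (rule measure_unit_lebesgue_interval) auto
    finally show ?thesis by (simp add: max_def min_def)
  qed
  have fI: "f -` ?I j \<in> sets N1" for j
    using measurable_sets[OF fN, of "?I j"] by (simp add: sp1)
  have "AE x in N1. \<forall>j. (f x < ?s j \<longleftrightarrow> l1 x < j) \<and> (f x < ?t j \<longleftrightarrow> l2 (\<theta> x) < j)"
    unfolding AE_all_countable
  proof
    fix j
    show "AE x in N1. (f x < ?s j \<longleftrightarrow> l1 x < j) \<and> (f x < ?t j \<longleftrightarrow> l2 (\<theta> x) < j)"
      using fl[of j] hl'[of j] h\<theta> by eventually_elim simp
  qed
  then have "AE x in N1. x \<in> {x. l1 x \<noteq> l2 (\<theta> x)} \<longrightarrow> x \<in> (\<Union>j\<in>{..n}. f -` ?I j)"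
  proof eventually_elim
    case (elim x)
    show ?case
    proof
      assume "x \<in> {x. l1 x \<noteq> l2 (\<theta> x)}"
      then consider "l1 x < l2 (\<theta> x)" | "l2 (\<theta> x) < l1 x" by fastforce
      then obtain j where j: "j \<le> n" "(l1 x < j) \<noteq> (l2 (\<theta> x) < j)"
      proof cases
        case 1 then show thesis using le(2)[of "\<theta> x"] by (intro that[of "l2 (\<theta> x)"]) auto
      next
        case 2 then show thesis using le(1)[of x] by (intro that[of "l1 x"]) auto
      qed
      then have "f x \<in> ?I j" using elim[rule_format, of j] by (auto simp: min_def max_def)
      with j show "x \<in> (\<Union>j\<in>{..n}. f -` ?I j)" by auto
    qed
  qed
  then have "measure N1 {x. l1 x \<noteq> l2 (\<theta> x)} \<le> measure N1 (\<Union>j\<in>{..n}. f -` ?I j)"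
    by (rule N1.finite_measure_mono_AE) (use fI in auto)
  also have "\<dots> \<le> (\<Sum>j\<in>{..n}. measure N1 (f -` ?I j))"
    by (rule N1.finite_measure_subadditive_finite) (use fI in auto)
  also have "\<dots> = (\<Sum>j\<le>n. \<bar>?s j - ?t j\<bar>)" by (simp add: I)
  finally show ?thesis using \<theta> \<theta>' d\<theta> inv1 inv2 by (intro exI[of _ \<theta>] exI[of _ \<theta>']) simp
qed

lemma transport_action:
  fixes N1 :: "'a::polish_space measure" and N2 :: "'b::polish_space measure" and \<alpha> :: "'g::group_add \<Rightarrow> 'b \<Rightarrow> 'b"
  assumes gen: "gen_semigroup (set_pmf \<mu>) = UNIV"
    and s1 [measurable_cong]: "sets N1 = sets borel" and p1: "prob_space N1"
    and s2 [measurable_cong]: "sets N2 = sets borel" and p2: "prob_space N2"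
    and \<alpha>: "borel_action N2 \<alpha>" "stationary \<mu> N2 \<alpha>"
    and \<theta> [measurable]: "\<theta> \<in> borel_measurable borel" and \<theta>' [measurable]: "\<theta>' \<in> borel_measurable borel"
    and d\<theta>: "distr N1 borel \<theta> = N2"
    and inv1: "AE x in N1. \<theta>' (\<theta> x) = x" and inv2: "AE y in N2. \<theta> (\<theta>' y) = y"
  defines "a \<equiv> (\<lambda>g x. \<theta>' (\<alpha> g (\<theta> x)))"
  shows "borel_action N1 a" "stationary \<mu> N1 a" "AE x in N1. \<theta> (a g x) = \<alpha> g (\<theta> x)"
proof -
  interpret N1: prob_space N1 by fact
  interpret N2: prob_space N2 by fact
  have sp1: "space N1 = UNIV" and sp2: "space N2 = UNIV"
    using sets_eq_imp_space_eq[OF s1] sets_eq_imp_space_eq[OF s2] by auto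
  have [measurable]: "\<alpha> g \<in> borel_measurable borel" for g using \<alpha>(1) by (simp add: borel_action_def)
  have \<theta>N: "\<theta> \<in> borel_measurable N1" by measurable
  have pull: "AE x in N1. P (\<theta> x)" if "AE y in N2. P y" for P
    using that unfolding d\<theta>[symmetric] by (rule AE_distrD[OF \<theta>N])
  have meas: "measure N1 (\<theta> -` B) = measure N2 B" if "B \<in> sets borel" for B
    unfolding d\<theta>[symmetric] by (subst measure_distr[OF \<theta>N]) (use that in \<open>auto simp: sp1\<close>)
  have vs: "f -` B \<in> sets borel" if "f \<in> borel_measurable borel" "B \<in> sets borel" for f :: "'c::topological_space \<Rightarrow> 'd::topological_space" and B
    using measurable_sets[OF that] by simp
  have \<alpha>m: "\<alpha> g \<in> borel_measurable borel" for g by measurable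
  obtain c where c: "\<And>B. B \<in> sets borel \<Longrightarrow> measure N2 (\<alpha> g -` B) \<le> c g * measure N2 B" for g
    using stationary_nonsingular_constants[OF gen, where 'a='b] s2 p2 \<alpha> by metis
  have pull_\<alpha>: "AE y in N2. P (\<alpha> g y)" if "AE y in N2. P y" for P g
  proof (rule AE_pullback_null[OF _ _ that])
    show "\<alpha> g \<in> measurable N2 N2" by measurable
    fix A assume A: "A \<in> sets N2" "emeasure N2 A = 0"
    then have "measure N2 (\<alpha> g -` A) \<le> 0" using c[of A g] by (simp add: s2 measure_def)
    then show "emeasure N2 (\<alpha> g -` A \<inter> space N2) = 0"
      by (simp add: sp2 N2.emeasure_eq_measure measure_le_0_iff)
  qed
  have eqv: "AE x in N1. \<theta> (a g x) = \<alpha> g (\<theta> x)" for g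
    unfolding a_def using pull[OF pull_\<alpha>[OF inv2, of g]] .
  then show "AE x in N1. \<theta> (a g x) = \<alpha> g (\<theta> x)" .
  show "borel_action N1 a"
    unfolding borel_action_def
  proof (intro conjI allI)
    show "a g \<in> borel_measurable borel" for g unfolding a_def by measurable
    have "AE x in N1. \<alpha> 0 (\<theta> x) = \<theta> x" by (rule pull) (use \<alpha>(1) in \<open>simp add: borel_action_def\<close>)
    then show "AE x in N1. a 0 x = x" using inv1 by eventually_elim (simp add: a_def)
    fix g h
    have "AE x in N1. \<alpha> (g + h) (\<theta> x) = \<alpha> g (\<alpha> h (\<theta> x))"
      by (rule pull) (use \<alpha>(1) in \<open>simp add: borel_action_def\<close>)
    with eqv[of h] show "AE x in N1. a (g + h) x = a g (a h x)"
      by eventually_elim (simp add: a_def)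
  qed
  show "stationary \<mu> N1 a"
    unfolding stationary_def
  proof
    fix E :: "'a set" assume E: "E \<in> sets borel"
    have E': "\<theta>' -` E \<in> sets borel" by (rule vs[OF \<theta>' E])
    have "measure N1 E = measure N1 (\<theta> -` (\<theta>' -` E))"
      by (rule N1.finite_measure_eq_AE) (use inv1 E vs[OF \<theta> E'] in \<open>auto simp: s1\<close>)
    also have "\<dots> = measure N2 (\<theta>' -` E)" by (rule meas[OF E'])
    also have "\<dots> = (\<integral>g. measure N2 (\<alpha> g -` (\<theta>' -` E)) \<partial>measure_pmf \<mu>)"
      using \<alpha>(2) E' by (simp add: stationary_def)
    also have "\<dots> = (\<integral>g. measure N1 (a g -` E) \<partial>measure_pmf \<mu>)"
    proof (rule Bochner_Integration.integral_cong[OF refl])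
      fix g
      have "a g -` E = \<theta> -` (\<alpha> g -` (\<theta>' -` E))" by (auto simp: a_def)
      then show "measure N2 (\<alpha> g -` (\<theta>' -` E)) = measure N1 (a g -` E)"
        using meas[OF vs[OF \<alpha>m E']] by simp
    qed
    finally show "measure N1 E = (\<integral>g. measure N1 (a g -` E) \<partial>measure_pmf \<mu>)" .
  qed
qed

lemma stationary_times_unit_lebesgue:
  fixes \<eta> :: "'b::polish_space measure" and \<alpha> :: "'g::{group_add,countable} \<Rightarrow> 'b \<Rightarrow> 'b"
  assumes s [measurable_cong]: "sets \<eta> = sets borel" and p: "prob_space \<eta>"
    and \<alpha>: "borel_action \<eta> \<alpha>" "stationary \<mu> \<eta> \<alpha>"
  defines "K \<equiv> \<eta> \<Otimes>\<^sub>M unit_lebesgue" and "\<beta> \<equiv> (\<lambda>g y. (\<alpha> g (fst y), snd y))"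
  shows "sets K = sets borel" "prob_space K" "\<And>y. emeasure K {y} = 0" "distr K borel fst = \<eta>"
    "borel_action K \<beta>" "stationary \<mu> K \<beta>"
proof -
  interpret \<eta>: prob_space \<eta> by fact
  interpret U: prob_space unit_lebesgue by (rule prob_space_unit_lebesgue)
  note sets_unit_lebesgue [measurable_cong]
  interpret P: pair_prob_space \<eta> unit_lebesgue ..
  have sp: "space \<eta> = UNIV" "space unit_lebesgue = UNIV"
    using sets_eq_imp_space_eq[OF s] sets_eq_imp_space_eq[OF sets_unit_lebesgue] by auto
  have spK: "space K = UNIV" by (simp add: K_def space_pair_measure sp)
  have "sets K = sets (borel \<Otimes>\<^sub>M borel)"
    unfolding K_def by (rule sets_pair_measure_cong[OF s sets_unit_lebesgue])
  then show sK: "sets K = sets borel" unfolding borel_prod .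
  show pK: "prob_space K" unfolding K_def by (rule P.prob_space_axioms)
  interpret K: prob_space K by (rule pK)
  show "emeasure K {y} = 0" for y
  proof -
    have "{y} = {fst y} \<times> {snd y}" by auto
    moreover have "emeasure K ({fst y} \<times> {snd y}) = emeasure \<eta> {fst y} * emeasure unit_lebesgue {snd y}"
      unfolding K_def by (rule U.emeasure_pair_measure_Times) (auto simp: s sets_unit_lebesgue)
    ultimately show ?thesis by (simp add: emeasure_unit_lebesgue_singleton)
  qed
  show "distr K borel fst = \<eta>"
  proof (rule measure_eqI)
    fix A assume "A \<in> sets (distr K borel fst)"
    then have A: "A \<in> sets \<eta>" by (simp add: s)
    have "fst \<in> borel_measurable K" unfolding K_def by measurable
    then have "emeasure (distr K borel fst) A = emeasure K (fst -` A)"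
      using A by (subst emeasure_distr) (auto simp: s spK)
    also have "fst -` A = A \<times> (UNIV :: real set)" by auto
    also have "emeasure K \<dots> = emeasure \<eta> A * emeasure unit_lebesgue UNIV"
      unfolding K_def by (rule U.emeasure_pair_measure_Times) (use A in \<open>auto simp: sets_unit_lebesgue\<close>)
    also have "emeasure unit_lebesgue UNIV = 1" using U.emeasure_space_1 sp by simp
    finally show "emeasure (distr K borel fst) A = emeasure \<eta> A" by simp
  qed (simp add: s)
  have \<alpha>m [measurable]: "\<alpha> g \<in> borel_measurable borel" for g using \<alpha>(1) by (simp add: borel_action_def)
  have \<beta>m: "\<beta> g \<in> borel_measurable borel" for g
    unfolding \<beta>_def
    by (intro borel_measurable_Pair measurable_compose[OF borel_measurable_fst \<alpha>m] borel_measurable_snd)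
  have AE_fst: "AE y in K. P (fst y)" if "AE z in \<eta>. P z" for P
    using that unfolding \<open>distr K borel fst = \<eta>\<close>[symmetric]
    by (rule AE_distrD[rotated]) (simp add: K_def)
  show "borel_action K \<beta>"
    unfolding borel_action_def
  proof (intro conjI allI \<beta>m)
    have "AE y in K. \<alpha> 0 (fst y) = fst y" by (rule AE_fst) (use \<alpha>(1) in \<open>simp add: borel_action_def\<close>)
    then show "AE y in K. \<beta> 0 y = y" by eventually_elim (simp add: \<beta>_def)
    fix g h
    have "AE y in K. \<alpha> (g + h) (fst y) = \<alpha> g (\<alpha> h (fst y))"
      by (rule AE_fst) (use \<alpha>(1) in \<open>simp add: borel_action_def\<close>)
    then show "AE y in K. \<beta> (g + h) y = \<beta> g (\<beta> h y)" by eventually_elim (simp add: \<beta>_def)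
  qed
  have st\<eta>: "\<forall>E\<in>sets \<eta>. emeasure \<eta> E = (\<integral>\<^sup>+ g. emeasure (distr \<eta> borel (\<alpha> g)) E \<partial>measure_pmf \<mu>)"
    using stationary_nn_iff[of \<eta> \<alpha> borel \<mu>, OF s p \<alpha>m refl] \<alpha>(2) by blast
  interpret Q: pair_prob_space "measure_pmf \<mu>" unit_lebesgue ..
  have "\<forall>E\<in>sets K. emeasure K E = (\<integral>\<^sup>+ g. emeasure (distr K borel (\<beta> g)) E \<partial>measure_pmf \<mu>)"
  proof
    fix E assume E: "E \<in> sets K"
    then have EP: "E \<in> sets (\<eta> \<Otimes>\<^sub>M unit_lebesgue)" by (simp add: K_def)
    have \<beta>E: "\<beta> g -` E \<in> sets K" for g using measurable_sets[OF \<beta>m, of E g] E by (simp add: sK)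
    have slice: "(\<lambda>z. (z, t)) -` E \<in> sets \<eta>" for t using sets_Pair2[OF EP] .
    have "emeasure K E = (\<integral>\<^sup>+t. emeasure \<eta> ((\<lambda>z. (z, t)) -` E) \<partial>unit_lebesgue)"
      unfolding K_def by (rule P.emeasure_pair_measure_alt2[OF EP])
    also have "\<dots> = (\<integral>\<^sup>+t. (\<integral>\<^sup>+g. emeasure \<eta> ((\<lambda>z. (z, t)) -` (\<beta> g -` E)) \<partial>measure_pmf \<mu>) \<partial>unit_lebesgue)"
    proof (rule nn_integral_cong)
      fix t
      have "emeasure (distr \<eta> borel (\<alpha> g)) ((\<lambda>z. (z, t)) -` E) = emeasure \<eta> ((\<lambda>z. (z, t)) -` (\<beta> g -` E))" for g
      proof -
        have "\<alpha> g \<in> borel_measurable \<eta>" by measurable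
        then show ?thesis using slice[of t]
          by (subst emeasure_distr) (auto simp: s sp \<beta>_def vimage_def)
      qed
      then show "emeasure \<eta> ((\<lambda>z. (z, t)) -` E) =
          (\<integral>\<^sup>+g. emeasure \<eta> ((\<lambda>z. (z, t)) -` (\<beta> g -` E)) \<partial>measure_pmf \<mu>)"
        using st\<eta> slice[of t] by simp
    qed
    also have "\<dots> = (\<integral>\<^sup>+g. (\<integral>\<^sup>+t. emeasure \<eta> ((\<lambda>z. (z, t)) -` (\<beta> g -` E)) \<partial>unit_lebesgue) \<partial>measure_pmf \<mu>)"
    proof (rule Q.Fubini')
      have "(\<lambda>(g, t). emeasure \<eta> ((\<lambda>z. (z, t)) -` (\<beta> g -` E))) \<in> borel_measurable (count_space UNIV \<Otimes>\<^sub>M unit_lebesgue)"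
      proof (rule measurable_pair_measure_countable1)
        fix g
        have "(\<lambda>t. emeasure \<eta> ((\<lambda>z. (z, t)) -` (\<beta> g -` E))) \<in> borel_measurable unit_lebesgue"
          by (rule P.measurable_emeasure_Pair2) (use \<beta>E in \<open>simp add: K_def\<close>)
        then show "(\<lambda>t. case (g, t) of (g, t) \<Rightarrow> emeasure \<eta> ((\<lambda>z. (z, t)) -` (\<beta> g -` E))) \<in> borel_measurable unit_lebesgue"
          by simp
      qed simp
      then show "(\<lambda>(g, t). emeasure \<eta> ((\<lambda>z. (z, t)) -` (\<beta> g -` E))) \<in> borel_measurable (measure_pmf \<mu> \<Otimes>\<^sub>M unit_lebesgue)"
        using measurable_cong_sets[OF sets_pair_measure_cong[of "measure_pmf \<mu>" "count_space UNIV" unit_lebesgue unit_lebesgue] refl]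
        by simp
    qed
    also have "\<dots> = (\<integral>\<^sup>+ g. emeasure (distr K borel (\<beta> g)) E \<partial>measure_pmf \<mu>)"
    proof (rule nn_integral_cong)
      fix g
      have "(\<integral>\<^sup>+t. emeasure \<eta> ((\<lambda>z. (z, t)) -` (\<beta> g -` E)) \<partial>unit_lebesgue) = emeasure K (\<beta> g -` E)"
        unfolding K_def by (rule P.emeasure_pair_measure_alt2[symmetric]) (use \<beta>E in \<open>simp add: K_def\<close>)
      also have "\<dots> = emeasure (distr K borel (\<beta> g)) E"
      proof -
        have "\<beta> g \<in> borel_measurable K" using \<beta>m[of g] by (simp cong: measurable_cong_sets add: sK)
        then show ?thesis using E by (subst emeasure_distr) (auto simp: sK spK)
      qed
      finally show "(\<integral>\<^sup>+t. emeasure \<eta> ((\<lambda>z. (z, t)) -` (\<beta> g -` E)) \<partial>unit_lebesgue) =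
          emeasure (distr K borel (\<beta> g)) E" .
    qed
    finally show "emeasure K E = (\<integral>\<^sup>+ g. emeasure (distr K borel (\<beta> g)) E \<partial>measure_pmf \<mu>)" .
  qed
  then show "stationary \<mu> K \<beta>" using stationary_nn_iff[of K \<beta> borel \<mu>, OF sK pK \<beta>m refl] by blast
qed

lemma sets_label_neq:
  fixes f g :: "'a \<Rightarrow> nat"
  assumes [measurable]: "f \<in> measurable M (count_space UNIV)" "g \<in> measurable M (count_space UNIV)"
  shows "{x \<in> space M. f x \<noteq> g x} \<in> sets M"
proof -
  have "{x \<in> space M. f x \<noteq> g x} = {x \<in> space M. \<exists>n. f x = n \<and> g x \<noteq> n}" by auto
  also have "\<dots> \<in> sets M" by measurable
  finally show ?thesis .
qed

context stationary_setup
begin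

definition name :: "('g, 'x, 'z::polish_space) named_action \<Rightarrow> 'x \<Rightarrow> 'g \<Rightarrow> 'z" where
  "name w x = (\<lambda>k. snd w (fst w (- k) x))"

definition law :: "('g, 'x, 'z::polish_space) named_action \<Rightarrow> ('g \<Rightarrow> 'z) measure" where
  "law w = distr \<nu> borel (name w)"

lemma name_measurable: "w \<in> named_actions \<Longrightarrow> name w \<in> borel_measurable borel"
  unfolding name_def by (intro measurable_coordinatewise_then_product named_actionsD)

lemma name_equivariant:
  assumes "w \<in> named_actions"
  shows "AE x in \<nu>. name w (fst w g x) = shift_action g (name w x)"
proof -
  have "AE x in \<nu>. \<forall>k. fst w (- k + g) x = fst w (- k) (fst w g x)"
    unfolding AE_all_countable using A_mu_plus[OF named_actionsD(1)[OF assms]] by blast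
  then show ?thesis
    by eventually_elim (auto simp: name_def shift_action_def minus_add fun_eq_iff)
qed

text \<open>Multiplying by the unit interval with the trivial action makes \<open>\<eta>\<close> nonatomic.\<close>

lemma realization:
  fixes \<eta> :: "('g \<Rightarrow> 'z::polish_space) measure" and l1 :: "'x \<Rightarrow> nat" and l2 :: "('g \<Rightarrow> 'z) \<Rightarrow> nat"
  assumes \<eta>: "\<eta> \<in> P_mu \<mu>" and l1: "l1 \<in> measurable borel (count_space UNIV)"
    and l2: "l2 \<in> measurable borel (count_space UNIV)" and le: "\<And>x. l1 x \<le> n" "\<And>z. l2 z \<le> n"
  shows "\<exists>w\<in>named_actions. law w = \<eta> \<and> measure \<nu> {x. l1 x \<noteq> l2 (name w x)} \<le>
    (\<Sum>j\<le>n. \<bar>measure \<nu> {x. l1 x < j} - measure \<eta> {z. l2 z < j}\<bar>)"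
proof -
  have \<eta>s: "sets \<eta> = sets borel" and \<eta>p: "prob_space \<eta>" and \<eta>st: "stationary \<mu> \<eta> shift_action"
    using \<eta> by (auto simp: P_mu_iff)
  have \<eta>sp: "space \<eta> = UNIV" using sets_eq_imp_space_eq[OF \<eta>s] by simp
  define K where "K = \<eta> \<Otimes>\<^sub>M unit_lebesgue"
  define \<beta> where "\<beta> = (\<lambda>g (y :: ('g \<Rightarrow> 'z) \<times> real). (shift_action g (fst y), snd y))"
  note K = stationary_times_unit_lebesgue[OF \<eta>s \<eta>p borel_action_shift \<eta>st, folded K_def \<beta>_def]
  have l2': "(\<lambda>y :: ('g \<Rightarrow> 'z) \<times> real. l2 (fst y)) \<in> measurable borel (count_space UNIV)"
    by (rule measurable_compose[OF borel_measurable_fst l2])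
  obtain \<theta> \<theta>' where \<theta>: "\<theta> \<in> borel_measurable borel" and \<theta>': "\<theta>' \<in> borel_measurable borel"
    and d\<theta>: "distr \<nu> borel \<theta> = K" and inv: "AE x in \<nu>. \<theta>' (\<theta> x) = x" "AE y in K. \<theta> (\<theta>' y) = y"
    and lab: "measure \<nu> {x. l1 x \<noteq> l2 (fst (\<theta> x))} \<le>
        (\<Sum>j\<le>n. \<bar>measure \<nu> {x. l1 x < j} - measure K {y. l2 (fst y) < j}\<bar>)"
    using nonatomic_iso[where ?l2.0 = "\<lambda>y. l2 (fst y)" and ?l1.0 = l1 and n = n,
        OF sets_\<nu> prob_\<nu> nonatomic_\<nu> K(1,2,3) l1 l2' le(1) le(2)] by blast
  have spK: "space K = UNIV" using sets_eq_imp_space_eq[OF K(1)] by simp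
  define a where "a = (\<lambda>g x. \<theta>' (\<beta> g (\<theta> x)))"
  note a = transport_action[OF gen sets_\<nu> prob_\<nu> K(1,2,5,6) \<theta> \<theta>' d\<theta> inv, folded a_def]
  define \<phi> where "\<phi> x = fst (\<theta> x) 0" for x
  have f\<theta>: "(\<lambda>x. fst (\<theta> x)) \<in> borel_measurable borel" by (rule measurable_compose[OF \<theta> borel_measurable_fst])
  have \<phi>: "\<phi> \<in> borel_measurable borel"
    unfolding \<phi>_def by (rule measurable_product_then_coordinatewise[OF f\<theta>])
  have w: "(a, \<phi>) \<in> named_actions"
    using a(1,2) \<phi> by (simp add: named_actions_def A_mu_iff)
  have nm: "AE x in \<nu>. name (a, \<phi>) x = fst (\<theta> x)"
  proof -
    have "AE x in \<nu>. \<forall>k. \<theta> (a (- k) x) = \<beta> (- k) (\<theta> x)"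
      unfolding AE_all_countable a_def using a(3) by blast
    then show ?thesis
      by eventually_elim (auto simp: name_def \<phi>_def \<beta>_def shift_action_def fun_eq_iff)
  qed
  have K_fst: "measure K (fst -` B) = measure \<eta> B" if "B \<in> sets borel" for B
  proof -
    have "fst \<in> borel_measurable K" using borel_measurable_fst by (simp cong: measurable_cong_sets add: K(1))
    then show ?thesis unfolding K(4)[symmetric] using that by (subst measure_distr) (auto simp: spK)
  qed
  have "law (a, \<phi>) = distr \<nu> borel (\<lambda>x. fst (\<theta> x))"
    unfolding law_def by (rule distr_cong_AE)
      (use nm borel_measurable_\<nu>[OF name_measurable[OF w]] borel_measurable_\<nu>[OF f\<theta>] in auto)
  also have "\<dots> = distr K borel fst"
    unfolding d\<theta>[symmetric] using borel_measurable_\<nu>[OF \<theta>]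
    by (subst distr_distr) (auto simp: comp_def borel_measurable_fst)
  finally have law: "law (a, \<phi>) = \<eta>" using K(4) by simp
  have m1: "{x. l1 x \<noteq> l2 (name (a, \<phi>) x)} \<in> sets \<nu>"
  proof -
    have "(\<lambda>x. l2 (name (a, \<phi>) x)) \<in> measurable borel (count_space UNIV)"
      by (rule measurable_compose[OF name_measurable[OF w] l2])
    from sets_label_neq[OF l1 this] show ?thesis by (simp add: sets_\<nu>)
  qed
  have m2: "{x. l1 x \<noteq> l2 (fst (\<theta> x))} \<in> sets \<nu>"
  proof -
    have "(\<lambda>x. l2 (fst (\<theta> x))) \<in> measurable borel (count_space UNIV)"
      by (rule measurable_compose[OF f\<theta> l2])
    from sets_label_neq[OF l1 this] show ?thesis by (simp add: sets_\<nu>)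
  qed
  have "measure \<nu> {x. l1 x \<noteq> l2 (name (a, \<phi>) x)} = measure \<nu> {x. l1 x \<noteq> l2 (fst (\<theta> x))}"
    by (rule \<nu>.finite_measure_eq_AE[OF _ m1 m2]) (use nm in \<open>eventually_elim; simp\<close>)
  moreover have "measure K {y. l2 (fst y) < j} = measure \<eta> {z. l2 z < j}" for j
  proof -
    have "l2 -` {..<j} \<inter> space borel \<in> sets borel" by (rule measurable_sets[OF l2]) simp
    then have "{z. l2 z < j} \<in> sets borel" by (simp add: vimage_def)
    then show ?thesis using K_fst[of "{z. l2 z < j}"] by (simp add: vimage_def)
  qed
  ultimately show ?thesis using w law lab by (intro bexI[of _ "(a, \<phi>)"]) simp_all
qed

end

section \<open>The law of a named action\<close>

lemma distinct_approximation:
  fixes p :: "nat \<Rightarrow> 'z::{metric_space,perfect_space}"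
  assumes "e > 0"
  shows "\<exists>z. inj_on z {..<m} \<and> (\<forall>j<m. dist (p j) (z j) < e)"
proof (induction m)
  case (Suc m)
  then obtain z where z: "inj_on z {..<m}" "\<And>j. j < m \<Longrightarrow> dist (p j) (z j) < e" by auto
  have "infinite (ball (p m) e)"
    using islimpt_UNIV[of "p m"] assms unfolding islimpt_eq_infinite_ball by auto
  then have "infinite (ball (p m) e - z ` {..<m})" by (rule Diff_infinite_finite[rotated]) simp
  then obtain y where y: "y \<in> ball (p m) e" "y \<notin> z ` {..<m}"
    by (metis DiffE ex_in_conv finite.emptyI)
  have "inj_on (z(m := y)) {..<Suc m}"
    using z(1) y(2) by (auto simp: inj_on_def less_Suc_eq)
  moreover have "\<forall>j<Suc m. dist (p j) ((z(m := y)) j) < e"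
    using z(2) y(1) by (auto simp: less_Suc_eq)
  ultimately show ?case by blast
qed simp

lemma finite_separation:
  fixes z :: "nat \<Rightarrow> 'z::metric_space"
  assumes inj: "inj_on z {..m}" and "e > 0"
  shows "\<exists>r>0. r \<le> e \<and> (\<forall>y i j. i \<le> m \<longrightarrow> j \<le> m \<longrightarrow> dist y (z i) < r \<longrightarrow> dist y (z j) < r \<longrightarrow> i = j)"
proof -
  define S where "S = insert e ((\<lambda>(i, j). dist (z i) (z j) / 2) ` {(i, j). i \<le> m \<and> j \<le> m \<and> i \<noteq> j})"
  have "finite ({..m} \<times> {..m})" by simp
  then have "finite {(i, j). i \<le> m \<and> j \<le> m \<and> i \<noteq> j}" by (rule rev_finite_subset) auto
  then have S: "finite S" "S \<noteq> {}" by (auto simp: S_def)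
  have "s > 0" if "s \<in> S" for s
    using that assms by (auto simp: S_def inj_on_def)
  then have "Min S > 0" using S by simp
  moreover have "Min S \<le> e" using S by (simp add: S_def)
  moreover have "i = j" if "i \<le> m" "j \<le> m" "dist y (z i) < Min S" "dist y (z j) < Min S" for y i j
  proof (rule ccontr)
    assume "i \<noteq> j"
    then have "dist (z i) (z j) / 2 \<in> S" using that by (auto simp: S_def)
    with S(1) have "Min S \<le> dist (z i) (z j) / 2" by (rule Min_le)
    moreover have "dist (z i) (z j) \<le> dist y (z i) + dist y (z j)" by (rule dist_triangle3)
    ultimately show False using that by linarith
  qed
  ultimately show ?thesis by blast
qed

definition bump :: "'z::metric_space \<Rightarrow> real \<Rightarrow> 'z \<Rightarrow> real" where
  "bump c r y = max 0 (1 - dist y c / r)"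

lemma bump:
  assumes "r > 0"
  shows "continuous_on S (bump c r)" "0 \<le> bump c r y" "bump c r y \<le> 1" "bump c r c = 1"
    "r \<le> dist y c \<Longrightarrow> bump c r y = 0"
  using assms by (auto simp: bump_def[abs_def] field_simps intro!: continuous_intros)

lemma list_encode_measurable:
  assumes "\<And>g. g \<in> set gs \<Longrightarrow> A g \<in> measurable M (count_space (UNIV :: nat set))"
  shows "(\<lambda>x. list_encode (map (\<lambda>g. A g x) gs)) \<in> measurable M (count_space UNIV)"
  using assms
proof (induction gs)
  case (Cons g gs)
  have "(\<lambda>x. Suc (prod_encode (i, list_encode (map (\<lambda>g. A g x) gs)))) \<in> measurable M (count_space UNIV)" for i
    using measurable_compose[OF Cons.IH, of "\<lambda>n. Suc (prod_encode (i, n))" "count_space UNIV"] Cons.prems by simp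
  from measurable_compose_countable[OF this, of "A g"] show ?case using Cons.prems by simp
qed simp

lemma list_encode_bounded: "\<exists>n. \<forall>xs. set xs \<subseteq> {..M} \<longrightarrow> length xs = L \<longrightarrow> list_encode xs \<le> n"
proof -
  have "finite {xs. set xs \<subseteq> {..M} \<and> length xs = L}" by (rule finite_lists_length_eq) simp
  then have "finite (list_encode ` {xs. set xs \<subseteq> {..M} \<and> length xs = L})" by (rule finite_imageI)
  then show ?thesis unfolding finite_nat_set_iff_bounded_le by blast
qed

lemma measure_label_less:
  fixes l :: "'a \<Rightarrow> nat"
  assumes "finite_measure M" and l: "l \<in> measurable M (count_space UNIV)" and sp: "space M = UNIV"
  shows "measure M {x. l x < j} = (\<Sum>i<j. measure M {x. l x = i})"
proof (induction j)
  case (Suc j)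
  interpret finite_measure M by fact
  have s: "{x. l x \<in> S} \<in> sets M" for S
    using measurable_sets[OF l, of S] by (simp add: sp vimage_def)
  have "{x. l x < Suc j} = {x. l x < j} \<union> {x. l x = j}" by auto
  also have "measure M \<dots> = measure M {x. l x < j} + measure M {x. l x = j}"
    by (rule finite_measure_Union) (use s[of "{..<j}"] s[of "{j}"] in auto)
  finally show ?case using Suc by simp
qed simp

lemma cumulative_close:
  fixes p q :: "nat \<Rightarrow> real"
  assumes "(\<Sum>i<N. p i) = (\<Sum>i<N. q i)" and le: "\<And>i. p i - q i \<le> d" and "0 \<le> d" and "j \<le> N"
  shows "\<bar>(\<Sum>i<j. p i) - (\<Sum>i<j. q i)\<bar> \<le> real N * d"
proof -
  have A: "(\<Sum>i\<in>I. p i) - (\<Sum>i\<in>I. q i) \<le> real N * d" if "I \<subseteq> {..<N}" for I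
  proof -
    have "(\<Sum>i\<in>I. p i) - (\<Sum>i\<in>I. q i) \<le> (\<Sum>i\<in>I. d)"
      unfolding sum_subtractf[symmetric] by (rule sum_mono) (rule le)
    also have "\<dots> = real (card I) * d" by simp
    also have "\<dots> \<le> real N * d"
      using card_mono[OF _ that] assms(3) by (intro mult_right_mono) auto
    finally show ?thesis .
  qed
  have "(\<Sum>i<N. f i) = (\<Sum>i<j. f i) + (\<Sum>i\<in>{j..<N}. f i)" for f :: "nat \<Rightarrow> real"
    using sum.atLeastLessThan_concat[of 0 j N f] assms(4) by (simp add: atLeast0LessThan)
  from this[of p] this[of q] assms(1)
  have "(\<Sum>i<j. q i) - (\<Sum>i<j. p i) = (\<Sum>i\<in>{j..<N}. p i) - (\<Sum>i\<in>{j..<N}. q i)" by linarith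
  moreover have "(\<Sum>i\<in>{j..<N}. p i) - (\<Sum>i\<in>{j..<N}. q i) \<le> real N * d" by (rule A) auto
  moreover have "(\<Sum>i<j. p i) - (\<Sum>i<j. q i) \<le> real N * d" by (rule A) (use assms(4) in auto)
  ultimately show ?thesis by linarith
qed

context stationary_setup
begin

lemma AE_name_tendsto:
  fixes \<sigma> :: "nat \<Rightarrow> ('g, 'x, 'z::polish_space) named_action"
  assumes w: "w \<in> named_actions" and \<sigma>: "\<And>n. \<sigma> n \<in> named_actions" and close: "\<And>n. rho w (\<sigma> n) < (1/2)^n"
  shows "AE x in \<nu>. (\<lambda>n. name (\<sigma> n) x) \<longlonglongrightarrow> name w x"
    and "AE x in \<nu>. (\<lambda>n. snd (\<sigma> n) x) \<longlonglongrightarrow> snd w x"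
proof -
  have lim: "AE x in \<nu>. (\<lambda>n. orb (\<sigma> n) x) \<longlonglongrightarrow> orb w x" by (rule AE_orb_tendsto[OF assms])
  have c: "isCont (\<lambda>(y :: 'g \<Rightarrow> 'x \<times> 'z) k. snd (y (- k))) y'" for y'
    by (rule continuous_on_interior[of UNIV])
      (auto intro!: continuous_on_coordinatewise_then_product continuous_on_snd continuous_on_product_coordinates)
  show "AE x in \<nu>. (\<lambda>n. name (\<sigma> n) x) \<longlonglongrightarrow> name w x"
    using lim by eventually_elim (drule isCont_tendsto_compose[OF c], simp add: orb_def name_def)
  have "AE x in \<nu>. (\<forall>n. fst (\<sigma> n) 0 x = x) \<and> fst w 0 x = x"
    using A_mu_zero[OF named_actionsD(1)[OF \<sigma>]] A_mu_zero[OF named_actionsD(1)[OF w]]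
    by (simp add: AE_all_countable)
  then show "AE x in \<nu>. (\<lambda>n. snd (\<sigma> n) x) \<longlonglongrightarrow> snd w x"
    using lim by eventually_elim (drule orb_tendstoD(2)[of _ _ 0], simp add: orb_def)
qed

lemma measure_law:
  assumes "w \<in> named_actions" "B \<in> sets borel"
  shows "measure (law w) B = measure \<nu> (name w -` B)"
  unfolding law_def
  by (subst measure_distr[OF borel_measurable_\<nu>[OF name_measurable[OF assms(1)]]]) (use assms(2) in auto)

lemma sets_law [simp]: "sets (law w) = sets borel" by (simp add: law_def)

lemma prob_space_law: "w \<in> named_actions \<Longrightarrow> prob_space (law w)"
  unfolding law_def by (rule \<nu>.prob_space_distr[OF borel_measurable_\<nu>[OF name_measurable]])

lemma integral_law:
  fixes f :: "('g \<Rightarrow> 'z::polish_space) \<Rightarrow> real"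
  assumes "w \<in> named_actions" "f \<in> borel_measurable borel"
  shows "(\<integral>y. f y \<partial>law w) = (\<integral>x. f (name w x) \<partial>\<nu>)"
  unfolding law_def by (rule integral_distr[OF borel_measurable_\<nu>[OF name_measurable[OF assms(1)]] assms(2)])

lemma law_P_mu:
  fixes w :: "('g, 'x, 'z::polish_space) named_action"
  assumes w: "w \<in> named_actions"
  shows "law w \<in> P_mu \<mu>"
proof -
  have "stationary \<mu> (law w) shift_action"
    unfolding stationary_def
  proof
    fix E :: "('g \<Rightarrow> 'z) set" assume E: "E \<in> sets borel"
    have nE: "name w -` E \<in> sets borel" using measurable_sets[OF name_measurable[OF w] E] by simp
    have sE: "shift_action g -` E \<in> sets borel" for g
      using measurable_sets[OF shift_action_measurable E] by simp
    have "measure (law w) E = measure \<nu> (name w -` E)" by (rule measure_law[OF w E])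
    also have "\<dots> = (\<integral>g. measure \<nu> (fst w g -` (name w -` E)) \<partial>measure_pmf \<mu>)"
      using A_mu_stationary[OF named_actionsD(1)[OF w]] nE by (simp add: stationary_def)
    also have "\<dots> = (\<integral>g. measure (law w) (shift_action g -` E) \<partial>measure_pmf \<mu>)"
    proof (rule Bochner_Integration.integral_cong[OF refl])
      fix g
      have "measure \<nu> (fst w g -` (name w -` E)) = measure \<nu> (name w -` (shift_action g -` E))"
      proof (rule \<nu>.finite_measure_eq_AE)
        show "AE x in \<nu>. (x \<in> fst w g -` (name w -` E)) = (x \<in> name w -` (shift_action g -` E))"
          using name_equivariant[OF w, of g] by eventually_elim simp
        show "fst w g -` (name w -` E) \<in> sets \<nu>" by (rule A_mu_vimage[OF named_actionsD(1)[OF w] nE])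
        show "name w -` (shift_action g -` E) \<in> sets \<nu>"
          using measurable_sets[OF name_measurable[OF w] sE] by (simp add: sets_\<nu>)
      qed
      then show "measure \<nu> (fst w g -` (name w -` E)) = measure (law w) (shift_action g -` E)"
        by (simp add: measure_law[OF w sE])
    qed
    finally show "measure (law w) E = (\<integral>g. measure (law w) (shift_action g -` E) \<partial>measure_pmf \<mu>)" .
  qed
  then show ?thesis using prob_space_law[OF w] by (simp add: P_mu_iff)
qed

lemma continuous_map_law:
  "continuous_map (NA.pm_topology :: ('g, 'x, 'z::polish_space) named_action topology) (P_mu_topology \<mu>) law"
proof (rule continuous_map_into_P_mu)
  show "law w \<in> P_mu \<mu>" if "w \<in> topspace (NA.pm_topology :: ('g, 'x, 'z) named_action topology)" for w
    using that law_P_mu by simp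
  fix f :: "('g \<Rightarrow> 'z) \<Rightarrow> real" assume f: "continuous_on UNIV f" "bounded (range f)"
  then obtain b where b: "\<And>y. \<bar>f y\<bar> \<le> b" unfolding bounded_iff by auto
  have fm: "f \<in> borel_measurable borel" using f(1) by (rule borel_measurable_continuous_onI)
  show "continuous_map (NA.pm_topology :: ('g, 'x, 'z) named_action topology) euclideanreal
      (\<lambda>w. \<integral>y. f y \<partial>law w)"
  proof (rule NA.continuous_map_real_seqI)
    fix \<sigma> and w :: "('g, 'x, 'z) named_action"
    assume w: "w \<in> named_actions" and \<sigma>: "\<And>n. \<sigma> n \<in> named_actions" and c: "\<And>n. rho w (\<sigma> n) < (1/2)^n"
    have m: "(\<lambda>x. f (name w x)) \<in> borel_measurable \<nu>" if "w \<in> named_actions" for w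
      by (rule borel_measurable_\<nu>[OF measurable_compose[OF name_measurable[OF that] fm]])
    have "(\<lambda>n. \<integral>x. f (name (\<sigma> n) x) \<partial>\<nu>) \<longlonglongrightarrow> (\<integral>x. f (name w x) \<partial>\<nu>)"
    proof (rule integral_dominated_convergence[where w = "\<lambda>_. b"])
      have ic: "isCont f y" for y using f(1) by (simp add: continuous_on_eq_continuous_at)
      show "AE x in \<nu>. (\<lambda>n. f (name (\<sigma> n) x)) \<longlonglongrightarrow> f (name w x)"
        using AE_name_tendsto(1)[OF w \<sigma> c] by eventually_elim (rule isCont_tendsto_compose[OF ic])
    qed (use m w \<sigma> b in auto)
    then show "(\<lambda>n. \<integral>y. f y \<partial>law (\<sigma> n)) \<longlonglongrightarrow> (\<integral>y. f y \<partial>law w)"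
      by (simp add: integral_law[OF \<sigma> fm] integral_law[OF w fm])
  qed
qed

lemma law_surj: "topspace (P_mu_topology \<mu>) \<subseteq> law ` (named_actions :: ('g, 'x, 'z::polish_space) named_action set)"
proof
  fix \<eta> :: "('g \<Rightarrow> 'z) measure" assume "\<eta> \<in> topspace (P_mu_topology \<mu>)"
  then have "\<eta> \<in> P_mu \<mu>" by simp
  from realization[OF this, of "\<lambda>_. 0" "\<lambda>_. 0" 0]
  show "\<eta> \<in> law ` (named_actions :: ('g, 'x, 'z) named_action set)" by force
qed

text \<open>On the intersection of these sets over all \<open>r > 0\<close> the name determines the point.\<close>

definition recognisable :: "('x \<Rightarrow> real) \<Rightarrow> real \<Rightarrow> ('g, 'x, 'z::polish_space) named_action set" where
  "recognisable i r = {w\<in>named_actions. \<exists>f. continuous_on UNIV f \<and> range f \<subseteq> {0..1} \<and>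
     (\<integral>x. \<bar>f (snd w x) - i x\<bar> \<partial>\<nu>) < r}"

lemma open_recognisable:
  assumes i: "i \<in> borel_measurable borel" "\<And>x. 0 < i x" "\<And>x. i x < 1"
  shows "openin NA.pm_topology (recognisable i r :: ('g, 'x, 'z::polish_space) named_action set)"
proof -
  let ?T = "NA.pm_topology :: ('g, 'x, 'z) named_action topology"
  let ?C = "{f :: 'z \<Rightarrow> real. continuous_on UNIV f \<and> range f \<subseteq> {0..1}}"
  have "openin ?T {w\<in>topspace ?T. (\<integral>x. \<bar>f (snd w x) - i x\<bar> \<partial>\<nu>) \<in> {..<r}}" if f: "f \<in> ?C" for f
  proof (rule openin_continuous_map_preimage[OF NA.continuous_map_real_seqI])
    fix \<sigma> and w :: "('g, 'x, 'z) named_action"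
    assume w: "w \<in> named_actions" and \<sigma>: "\<And>n. \<sigma> n \<in> named_actions" and c: "\<And>n. rho w (\<sigma> n) < (1/2)^n"
    have fm: "f \<in> borel_measurable borel" using f by (auto intro: borel_measurable_continuous_onI)
    have m: "(\<lambda>x. \<bar>f (snd w x) - i x\<bar>) \<in> borel_measurable \<nu>" if "w \<in> named_actions" for w
      using borel_measurable_\<nu>[OF measurable_compose[OF named_actionsD(2)[OF that] fm]] borel_measurable_\<nu>[OF i(1)]
      by auto
    show "(\<lambda>n. \<integral>x. \<bar>f (snd (\<sigma> n) x) - i x\<bar> \<partial>\<nu>) \<longlonglongrightarrow> (\<integral>x. \<bar>f (snd w x) - i x\<bar> \<partial>\<nu>)"
    proof (rule integral_dominated_convergence[where w = "\<lambda>_. 1"])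
      have ic: "isCont f y" for y using f by (simp add: continuous_on_eq_continuous_at)
      show "AE x in \<nu>. (\<lambda>n. \<bar>f (snd (\<sigma> n) x) - i x\<bar>) \<longlonglongrightarrow> \<bar>f (snd w x) - i x\<bar>"
        using AE_name_tendsto(2)[OF w \<sigma> c]
        by eventually_elim (intro tendsto_rabs tendsto_diff tendsto_const isCont_tendsto_compose[OF ic])
      have "\<bar>f y - i x\<bar> \<le> 1" for x y
      proof -
        have "f y \<in> {0..1}" using f by blast
        then show ?thesis using i(2,3)[of x] by auto
      qed
      then show "AE x in \<nu>. norm \<bar>f (snd (\<sigma> n) x) - i x\<bar> \<le> 1" for n by simp
    qed (use m w \<sigma> in auto)
  qed simp
  then have "openin ?T (\<Union>f\<in>?C. {w\<in>topspace ?T. (\<integral>x. \<bar>f (snd w x) - i x\<bar> \<partial>\<nu>) \<in> {..<r}})"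
    by (intro openin_Union) auto
  also have "(\<Union>f\<in>?C. {w\<in>topspace ?T. (\<integral>x. \<bar>f (snd w x) - i x\<bar> \<partial>\<nu>) \<in> {..<r}}) = recognisable i r"
    by (auto simp: recognisable_def)
  finally show ?thesis .
qed

lemma nonsingular_shift:
  fixes \<eta> :: "('g \<Rightarrow> 'z::polish_space) measure"
  assumes \<eta>: "\<eta> \<in> P_mu \<mu>"
  shows "nonsingular_action \<eta> shift_action"
proof -
  have s: "sets \<eta> = sets borel" and "prob_space \<eta>" using \<eta> by (auto simp: P_mu_iff)
  then interpret prob_space \<eta> by simp
  have sp: "space \<eta> = UNIV" using sets_eq_imp_space_eq[OF s] by simp
  have "emeasure \<eta> (shift_action g -` A) = 0 \<longleftrightarrow> emeasure \<eta> A = 0" if A: "A \<in> sets borel" for g A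
  proof
    have sA: "shift_action g -` A \<in> sets borel"
      using measurable_sets[OF shift_action_measurable A, of g] by simp
    assume "emeasure \<eta> (shift_action g -` A) = 0"
    then have "measure \<eta> (shift_action (- g) -` (shift_action g -` A)) = 0"
      by (intro shift_null[OF \<eta> sA]) (simp add: measure_def)
    moreover have "shift_action (- g) -` (shift_action g -` A) = A"
    proof -
      have "shift_action g (shift_action (- g) z) = z" for z :: "'g \<Rightarrow> 'z"
        unfolding shift_action_plus[symmetric] by (simp add: shift_action_def)
      then show ?thesis by auto
    qed
    ultimately show "emeasure \<eta> A = 0" by (simp add: emeasure_eq_measure)
  next
    assume "emeasure \<eta> A = 0"
    then show "emeasure \<eta> (shift_action g -` A) = 0"
      using shift_null[OF \<eta> A, of g] by (simp add: emeasure_eq_measure)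
  qed
  moreover have "shift_action g \<in> measurable \<eta> \<eta>" for g
    using shift_action_measurable[of g] by (simp cong: measurable_cong_sets add: s)
  ultimately show ?thesis
    using borel_action_shift[of \<eta>] prob_space_axioms
    by (simp add: nonsingular_action_def borel_action_def s sp)
qed

lemma conjugate_if_recognisable:
  fixes w :: "('g, 'x, 'z::polish_space) named_action"
  assumes i: "i \<in> borel_measurable borel" "\<And>x. 0 < i x" "\<And>x. i x < 1"
    and \<psi>: "\<psi> \<in> borel_measurable borel" "\<And>x. \<psi> (i x) = x"
    and rec: "\<And>n. w \<in> recognisable i ((1/2)^n)"
  shows "conjugate \<nu> (fst w) (law w) shift_action"
proof -
  have w: "w \<in> named_actions" using rec[of 0] by (simp add: recognisable_def)
  have "\<forall>n. \<exists>f. continuous_on UNIV f \<and> range f \<subseteq> {0..1} \<and> (\<integral>x. \<bar>f (snd w x) - i x\<bar> \<partial>\<nu>) < (1/2)^n"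
    using rec by (auto simp: recognisable_def)
  then obtain f where f: "\<And>n. continuous_on UNIV (f n)" "\<And>n. range (f n) \<subseteq> {0..1}"
    "\<And>n. (\<integral>x. \<bar>f n (snd w x) - i x\<bar> \<partial>\<nu>) < (1/2)^n" by metis
  have fm: "f n \<in> borel_measurable borel" for n using f(1) by (rule borel_measurable_continuous_onI)
  have "AE x in \<nu>. summable (\<lambda>n. \<bar>f n (snd w x) - i x\<bar>)"
  proof (rule AE_summable_of_integrals[OF prob_\<nu>, where K = 1])
    show "(\<lambda>x. \<bar>f n (snd w x) - i x\<bar>) \<in> borel_measurable \<nu>" for n
      using borel_measurable_\<nu>[OF measurable_compose[OF named_actionsD(2)[OF w] fm]] borel_measurable_\<nu>[OF i(1)]
      by auto
    show "\<bar>f n (snd w x) - i x\<bar> \<le> 1" for n x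
    proof -
      have "f n (snd w x) \<in> {0..1}" using f(2) by blast
      then show ?thesis using i(2,3)[of x] by auto
    qed
  qed (use f(3) in auto)
  then have lim: "AE x in \<nu>. (\<lambda>n. f n (snd w x)) \<longlonglongrightarrow> i x"
  proof eventually_elim
    case (elim x)
    from summable_LIMSEQ_zero[OF elim] have "(\<lambda>n. f n (snd w x) - i x) \<longlonglongrightarrow> 0"
      by (simp add: tendsto_rabs_zero_iff)
    then show ?case by (simp add: LIM_zero_iff)
  qed
  obtain \<gamma> where \<gamma>: "\<gamma> \<in> borel_measurable borel" "\<And>z. Cauchy (\<lambda>n. f n z) \<Longrightarrow> (\<lambda>n. f n z) \<longlonglongrightarrow> \<gamma> z"
    using borel_limit_selection[of f borel, OF fm] by auto
  define inv where "inv z = \<psi> (\<gamma> (z 0))" for z :: "'g \<Rightarrow> 'z"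
  have inv_m: "inv \<in> borel_measurable borel"
    unfolding inv_def
    by (rule measurable_compose[OF measurable_compose[OF measurable_product_coordinates \<gamma>(1)] \<psi>(1)])
  have nw: "name w \<in> borel_measurable borel" by (rule name_measurable[OF w])
  have inv1: "AE x in \<nu>. inv (name w x) = x"
    using lim A_mu_zero[OF named_actionsD(1)[OF w]]
  proof eventually_elim
    case (elim x)
    have "\<gamma> (snd w x) = i x"
      using LIMSEQ_unique[OF \<gamma>(2)[OF LIMSEQ_imp_Cauchy[OF elim(1)]] elim(1)] .
    then show ?case using elim(2) by (simp add: inv_def name_def \<psi>(2))
  qed
  have inv2: "AE y in law w. name w (inv y) = y"
    unfolding law_def
  proof (subst AE_distr_iff[OF borel_measurable_\<nu>[OF nw]])
    note [measurable] = nw inv_m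
    show "{y \<in> space borel. name w (inv y) = y} \<in> sets borel" by measurable
    show "AE x in \<nu>. name w (inv (name w x)) = name w x"
      using inv1 by eventually_elim simp
  qed
  have m1: "name w \<in> measurable \<nu> (law w)" and m2: "inv \<in> measurable (law w) \<nu>"
    using nw inv_m by (simp_all cong: measurable_cong_sets add: sets_\<nu>)
  have "distr \<nu> (law w) (name w) = law w"
    unfolding law_def by (rule distr_cong) auto
  then show ?thesis
    unfolding conjugate_def
    using A_mu_nonsingular_action[OF named_actionsD(1)[OF w]] nonsingular_shift[OF law_P_mu[OF w]]
      m1 m2 inv1 inv2 name_equivariant[OF w] by blast
qed

lemma integral_min_le:
  fixes D :: "'x \<Rightarrow> real"
  assumes "\<And>x. x \<notin> Bad \<Longrightarrow> D x \<le> c" "Bad \<in> sets \<nu>" "0 \<le> c"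
  shows "(\<integral>x. min 1 (D x) \<partial>\<nu>) \<le> c + measure \<nu> Bad"
proof (cases "integrable \<nu> (\<lambda>x. min 1 (D x))")
  case True
  have i: "integrable \<nu> (\<lambda>x. indicator Bad x :: real)"
    using assms(2) by (simp add: \<nu>.emeasure_eq_measure)
  have "(\<integral>x. min 1 (D x) \<partial>\<nu>) \<le> (\<integral>x. c + indicator Bad x \<partial>\<nu>)"
  proof (rule integral_mono[OF True])
    show "integrable \<nu> (\<lambda>x. c + indicator Bad x)" using i by simp
    show "min 1 (D x) \<le> c + indicator Bad x" for x
      using assms(1)[of x] assms(3) by (cases "x \<in> Bad") (auto simp: min_def)
  qed
  also have "\<dots> = c + measure \<nu> Bad"
    using i \<nu>.prob_space by simp
  finally show ?thesis .
next
  case False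
  then show ?thesis using assms(3) by (simp add: not_integrable_integral_eq)
qed

lemma finite_naming:
  fixes w :: "('g, 'x, 'z::{polish_space,perfect_space}) named_action" and v :: "'x \<Rightarrow> real"
  assumes w: "w \<in> named_actions" and v: "v \<in> borel_measurable borel" and e: "e > 0"
  shows "\<exists>(k :: 'x \<Rightarrow> nat) m z. k \<in> measurable borel (count_space UNIV) \<and> (\<forall>x. k x \<le> m) \<and> inj_on z {..m} \<and>
    measure \<nu> {x. k x = 0} < e \<and> (\<forall>x. k x \<noteq> 0 \<longrightarrow> dist (snd w x) (z (k x)) < e) \<and>
    (\<forall>x y. k x = k y \<longrightarrow> k x \<noteq> 0 \<longrightarrow> dist x y < e \<and> dist (v x) (v y) < e)"
proof -
  define u where "u x = (x, snd w x, v x)" for x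
  have "u \<in> borel_measurable borel"
    unfolding u_def by (intro borel_measurable_Pair named_actionsD(2)[OF w] v measurable_ident_sets refl)
  from finite_small_partition[OF \<nu>.finite_measure_axioms borel_measurable_\<nu>[OF this], of "e/2"] e
  obtain k :: "'x \<Rightarrow> nat" and m where k: "k \<in> measurable \<nu> (count_space UNIV)" "\<And>x. k x \<le> m"
    "measure \<nu> {x\<in>space \<nu>. k x = 0} < e/2" "\<And>x y. k x = k y \<Longrightarrow> k x \<noteq> 0 \<Longrightarrow> dist (u x) (u y) < e/2"
    by auto
  have kb: "k \<in> measurable borel (count_space UNIV)" using k(1) by (simp cong: measurable_cong_sets add: sets_\<nu>)
  define p where "p j = snd w (SOME x. k x = j)" for j
  have p: "k (SOME y. k y = k x) = k x" for x by (rule someI) simp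
  obtain z where z: "inj_on z {..<Suc m}" "\<And>j. j < Suc m \<Longrightarrow> dist (p j) (z j) < e/2"
    using distinct_approximation[of "e/2" "Suc m" p] e by auto
  have comp: "dist x y \<le> dist (u x) (u y)" "dist (snd w x) (snd w y) \<le> dist (u x) (u y)"
    "dist (v x) (v y) \<le> dist (u x) (u y)" for x y
    using dist_fst_le[of "u x" "u y"] dist_snd_le[of "u x" "u y"]
      dist_fst_le[of "snd (u x)" "snd (u y)"] dist_snd_le[of "snd (u x)" "snd (u y)"]
    by (auto simp: u_def)
  have "dist (snd w x) (z (k x)) < e" if "k x \<noteq> 0" for x
  proof -
    have "dist (snd w x) (p (k x)) < e/2"
      using k(4)[of x "SOME y. k y = k x"] p[of x] that comp(2)[of x "SOME y. k y = k x"] by (simp add: p_def)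
    moreover have "dist (p (k x)) (z (k x)) < e/2" using z(2) k(2)[of x] by simp
    ultimately show ?thesis using dist_triangle[of "snd w x" "z (k x)" "p (k x)"] by linarith
  qed
  moreover have "dist x y < e \<and> dist (v x) (v y) < e" if "k x = k y" "k x \<noteq> 0" for x y
    using k(4)[OF that] comp(1,3)[of x y] e by auto
  moreover have "measure \<nu> {x. k x = 0} < e" using k(3) e by simp
  moreover have "inj_on z {..m}" using z(1) by (simp add: lessThan_Suc_atMost)
  ultimately show ?thesis using kb k(2) by blast
qed

lemma dense_recognisable:
  assumes i: "i \<in> borel_measurable borel" "\<And>x. 0 < i x" "\<And>x. i x < 1" and r: "r > 0"
  shows "NA.pm_topology closure_of (recognisable i r :: ('g, 'x, 'z::{polish_space,perfect_space}) named_action set)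
    = named_actions"
proof -
  let ?T = "NA.pm_topology :: ('g, 'x, 'z) named_action topology"
  have main: "\<exists>w'\<in>NA.pball w e. w' \<in> recognisable i r" if w: "w \<in> named_actions" and e: "e > 0"
    for w :: "('g, 'x, 'z) named_action" and e
  proof -
    obtain F :: "'g set" and e0 where F: "finite F" "e0 > 0"
      and Fe: "\<And>w' :: ('g, 'x, 'z) named_action. w' \<in> named_actions \<Longrightarrow>
        (\<forall>g\<in>F. (\<integral>x. min 1 (dist (orb w x g) (orb w' x g)) \<partial>\<nu>) < e0) \<Longrightarrow> rho w w' < e"
      using rho_lessI[OF e, where 'z='z] w by blast
    define C where "C = 1 + (\<Sum>g\<in>F. cst g)"
    have C: "1 \<le> C" "\<And>g. g \<in> F \<Longrightarrow> cst g \<le> C - 1"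
      using member_le_sum[OF _ _ F(1), of _ cst] by (auto simp: C_def cst_nonneg sum_nonneg)
    define e' where "e' = min (e0 / (2 * C)) (r / 2)"
    have e': "e' > 0" "e' \<le> e0 / (2 * C)" "e' \<le> r/2" using F(2) r C(1) by (auto simp: e'_def)
    obtain k :: "'x \<Rightarrow> nat" and m and z :: "nat \<Rightarrow> 'z"
      where k: "k \<in> measurable borel (count_space UNIV)" "\<And>x. k x \<le> m" and z: "inj_on z {..m}"
      and k0: "measure \<nu> {x. k x = 0} < e'" and kz: "\<And>x. k x \<noteq> 0 \<Longrightarrow> dist (snd w x) (z (k x)) < e'"
      and ki: "\<And>x y. k x = k y \<Longrightarrow> k x \<noteq> 0 \<Longrightarrow> dist x y < e' \<and> dist (i x) (i y) < e'"
      using finite_naming[OF w i(1) e'(1)] by blast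
    have k0_sets: "{x. k x = 0} \<in> sets borel"
      using measurable_sets[OF k(1), of "{0}"] by (simp add: vimage_def)
    have zk: "(\<lambda>x. z (k x)) \<in> borel_measurable borel"
      by (rule measurable_compose[OF k(1)]) simp
    define w' where "w' = (fst w, \<lambda>x. z (k x))"
    have w': "w' \<in> named_actions" using named_actionsD(1)[OF w] zk by (simp add: named_actions_def w'_def)
    have "(\<integral>x. min 1 (dist (orb w x g) (orb w' x g)) \<partial>\<nu>) < e0" if g: "g \<in> F" for g
    proof -
      have "(\<integral>x. min 1 (dist (orb w x g) (orb w' x g)) \<partial>\<nu>) \<le> e' + measure \<nu> (fst w g -` {x. k x = 0})"
      proof (rule integral_min_le)
        show "fst w g -` {x. k x = 0} \<in> sets \<nu>" by (rule A_mu_vimage[OF named_actionsD(1)[OF w] k0_sets])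
        fix x assume "x \<notin> fst w g -` {x. k x = 0}"
        then have "dist (snd w (fst w g x)) (z (k (fst w g x))) < e'" by (intro kz) simp
        then show "dist (orb w x g) (orb w' x g) \<le> e'" by (simp add: orb_def w'_def dist_Pair_Pair)
      qed (use e' in simp)
      also have "measure \<nu> (fst w g -` {x. k x = 0}) \<le> cst g * measure \<nu> {x. k x = 0}"
        by (rule A_mu_bound[OF named_actionsD(1)[OF w] k0_sets])
      also have "\<dots> \<le> (C - 1) * e'" using C k0 g e' by (intro mult_mono) auto
      also have "e' + (C - 1) * e' = C * e'" by (simp add: algebra_simps)
      also have "\<dots> \<le> C * (e0 / (2 * C))" using e'(2) C(1) by (intro mult_left_mono) auto
      also have "\<dots> < e0" using C(1) F(2) by simp
      finally show ?thesis by simp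
    qed
    then have "w' \<in> NA.pball w e" using Fe w' by (simp add: NA.pball_def)
    moreover have "w' \<in> recognisable i r"
    proof -
      obtain s where s: "s > 0" "\<And>y a b. a \<le> m \<Longrightarrow> b \<le> m \<Longrightarrow> dist y (z a) < s \<Longrightarrow> dist y (z b) < s \<Longrightarrow> a = b"
        using finite_separation[OF z zero_less_one] by blast
      define t where "t j = i (SOME x. k x = j)" for j
      define f where "f y = max 0 (min 1 (\<Sum>j\<le>m. t j * bump (z j) s y))" for y
      have "continuous_on UNIV f"
        unfolding f_def by (intro continuous_intros bump(1) s(1))
      moreover have "range f \<subseteq> {0..1}" by (auto simp: f_def)
      moreover have "(\<integral>x. \<bar>f (z (k x)) - i x\<bar> \<partial>\<nu>) < r"
      proof -
        have fk: "f (z (k x)) = t (k x)" for x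
        proof -
          have "(\<Sum>j\<le>m. t j * bump (z j) s (z (k x))) = (\<Sum>j\<in>{k x}. t j * bump (z j) s (z (k x)))"
          proof (rule sum.mono_neutral_right)
            show "\<forall>j\<in>{..m} - {k x}. t j * bump (z j) s (z (k x)) = 0"
            proof
              fix j assume j: "j \<in> {..m} - {k x}"
              then have "s \<le> dist (z (k x)) (z j)"
                using s(2)[of j "k x" "z (k x)"] k(2)[of x] s(1) by force
              then show "t j * bump (z j) s (z (k x)) = 0" by (simp add: bump(5)[OF s(1)])
            qed
          qed (use k(2) in auto)
          then show ?thesis using i(2,3)[of "SOME y. k y = k x"]
            by (simp add: f_def t_def bump(4)[OF s(1)])
        qed
        have le1: "\<bar>f y - i x\<bar> \<le> 1" for x y using i(2,3)[of x] by (auto simp: f_def)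
        have "(\<integral>x. min 1 \<bar>f (z (k x)) - i x\<bar> \<partial>\<nu>) \<le> e' + measure \<nu> {x. k x = 0}"
        proof (rule integral_min_le)
          fix x assume "x \<notin> {x. k x = 0}"
          moreover have "k (SOME y. k y = k x) = k x" by (rule someI) simp
          ultimately show "\<bar>f (z (k x)) - i x\<bar> \<le> e'"
            using ki[of "SOME y. k y = k x" x] unfolding fk t_def by (simp add: dist_real_def less_imp_le)
        qed (use e' k0_sets in \<open>auto simp: sets_\<nu>\<close>)
        also have "\<dots> < r" using k0 e'(3) by simp
        finally show ?thesis using le1 by (simp add: min_absorb2)
      qed
      ultimately show ?thesis using w' by (auto simp: recognisable_def w'_def)
    qed
    ultimately show ?thesis by blast
  qed
  have sub: "(recognisable i r :: ('g, 'x, 'z) named_action set) \<subseteq> topspace ?T" by (auto simp: recognisable_def)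
  have "\<exists>x\<in>G. x \<in> recognisable i r" if G: "openin ?T G \<and> G \<noteq> {}" for G
  proof -
    obtain w where wG: "w \<in> G" using G by blast
    have "\<forall>x\<in>G. \<exists>e>0. NA.pball x e \<subseteq> G" using G by (simp add: NA.openin_pm)
    with wG obtain e where w: "w \<in> G" "e > 0" "NA.pball w e \<subseteq> G" by blast
    have "w \<in> named_actions" using w(1) openin_subset[of ?T G] G by auto
    from main[OF this w(2)] obtain w' where "w' \<in> NA.pball w e" "w' \<in> recognisable i r" ..
    moreover from this(1) have "w' \<in> G" by (rule subsetD[OF w(3)])
    ultimately show ?thesis by (intro bexI[of _ w'])
  qed
  then have "?T closure_of recognisable i r = topspace ?T"
    unfolding dense_in_iff_meets_open[OF sub] by (intro allI impI)
  then show ?thesis by simp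
qed

end

context stationary_setup
begin

text \<open>Replacing \<open>\<phi>\<close> by a finite-valued name with small level sets, a weak neighbourhood of the law
  controls the measures of finitely many cylinders. A realization of a nearby \<open>\<eta>\<close> with almost matching
  cylinders is then close to the given pair.\<close>

lemma law_somewhere_open:
  fixes w :: "('g, 'x, 'z::{polish_space,perfect_space}) named_action"
  assumes w: "w \<in> named_actions" and e: "e > 0"
  shows "\<exists>V. openin (P_mu_topology \<mu>) V \<and> V \<noteq> {} \<and> V \<subseteq> law ` NA.pball w e"
proof -
  obtain F :: "'g set" and e0 where F: "finite F" "e0 > 0"
    and Fe: "\<And>w' :: ('g, 'x, 'z) named_action. w' \<in> named_actions \<Longrightarrow>
      (\<forall>g\<in>F. (\<integral>x. min 1 (dist (orb w x g) (orb w' x g)) \<partial>\<nu>) < e0) \<Longrightarrow> rho w w' < e"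
    using rho_lessI[OF e, where 'z='z] w by blast
  define C where "C = 1 + (\<Sum>g\<in>F. cst g)"
  have C: "1 \<le> C" "\<And>g. g \<in> F \<Longrightarrow> cst g \<le> C - 1"
    using member_le_sum[OF _ _ F(1), of _ cst] by (auto simp: C_def cst_nonneg sum_nonneg)
  define e' where "e' = e0 / (8 * C)"
  have e': "e' > 0" using F(2) C(1) by (simp add: e'_def)
  have zero_m: "(\<lambda>_. 0 :: real) \<in> borel_measurable (borel :: 'x measure)" by simp
  obtain k :: "'x \<Rightarrow> nat" and m and z :: "nat \<Rightarrow> 'z"
    where k: "k \<in> measurable borel (count_space UNIV)" "\<And>x. k x \<le> m" and z: "inj_on z {..m}"
    and k0: "measure \<nu> {x. k x = 0} < e'" and kz: "\<And>x. k x \<noteq> 0 \<Longrightarrow> dist (snd w x) (z (k x)) < e'"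
    and kk: "\<And>x y. k x = k y \<Longrightarrow> k x \<noteq> 0 \<Longrightarrow> dist x y < e'"
    using finite_naming[OF w zero_m e'] by blast
  have k0_sets: "{x. k x = 0} \<in> sets borel"
    using measurable_sets[OF k(1), of "{0}"] by (simp add: vimage_def)
  obtain r where r: "r > 0" "r \<le> e'"
    and sep: "\<And>y a b. a \<le> m \<Longrightarrow> b \<le> m \<Longrightarrow> dist y (z a) < r \<Longrightarrow> dist y (z b) < r \<Longrightarrow> a = b"
    using finite_separation[OF z e'] by blast
  define w1 where "w1 = (fst w, \<lambda>x. z (k x))"
  have zk: "(\<lambda>x. z (k x)) \<in> borel_measurable borel" by (rule measurable_compose[OF k(1)]) simp
  have w1: "w1 \<in> named_actions" using named_actionsD(1)[OF w] zk by (simp add: named_actions_def w1_def)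
  define cell where "cell y = (LEAST j. j = Suc m \<or> j \<le> m \<and> dist y (z j) < r)" for y
  have cell_eq: "cell y = j" if "j \<le> m" "dist y (z j) < r" for y j
    unfolding cell_def
  proof (rule Least_equality)
    fix i assume "i = Suc m \<or> i \<le> m \<and> dist y (z i) < r"
    then show "j \<le> i" using sep[of j i y] that by auto
  qed (use that in simp)
  have cell_P: "cell y = Suc m \<or> cell y \<le> m \<and> dist y (z (cell y)) < r" for y
    unfolding cell_def by (rule LeastI[of _ "Suc m"]) simp
  have cell_m: "cell \<in> measurable borel (count_space UNIV)" unfolding cell_def by measurable
  obtain gs where gs: "set gs = insert 0 F" using finite_list[of "insert 0 F"] F(1) by auto
  define l1 where "l1 x = list_encode (map (\<lambda>g. k (fst w g x)) gs)" for x
  define l2 where "l2 y = list_encode (map (\<lambda>g. cell (y (- g))) gs)" for y :: "'g \<Rightarrow> 'z"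
  have l1_m: "l1 \<in> measurable borel (count_space UNIV)"
    unfolding l1_def by (intro list_encode_measurable measurable_compose[OF named_actionsD(3)[OF w] k(1)])
  have l2_m: "l2 \<in> measurable borel (count_space UNIV)"
    unfolding l2_def by (intro list_encode_measurable measurable_compose[OF measurable_product_coordinates cell_m])
  have l_eq: "l1 x = l2 y \<longleftrightarrow> (\<forall>g\<in>insert 0 F. k (fst w g x) = cell (y (- g)))" for x y
    unfolding l1_def l2_def by (simp add: inj_on_eq_iff[OF inj_list_encode[of UNIV]] map_eq_conv gs)
  have l11: "l1 x = l1 x' \<longleftrightarrow> (\<forall>g\<in>insert 0 F. k (fst w g x) = k (fst w g x'))" for x x'
    unfolding l1_def by (simp add: inj_on_eq_iff[OF inj_list_encode[of UNIV]] map_eq_conv gs)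
  obtain n where n: "\<And>xs. set xs \<subseteq> {..Suc m} \<Longrightarrow> length xs = length gs \<Longrightarrow> list_encode xs \<le> n"
    using list_encode_bounded[of "Suc m" "length gs"] by blast
  have l1_n: "l1 x \<le> n" for x unfolding l1_def using k(2) by (intro n) (auto simp: le_SucI)
  have l2_n: "l2 y \<le> n" for y
  proof -
    have "cell u \<le> Suc m" for u using cell_P[of u] by auto
    then show ?thesis unfolding l2_def by (intro n) auto
  qed
  define N where "N = Suc n"
  define d where "d = e' / (real N * real N)"
  have d: "d > 0" using e' by (simp add: d_def N_def)
  have cyl: "\<exists>f :: ('g \<Rightarrow> 'z) \<Rightarrow> real. continuous_on UNIV f \<and> range f \<subseteq> {0..1} \<and>
      (\<forall>y. l2 y \<noteq> j \<longrightarrow> f y = 0) \<and> (\<forall>x. l1 x = j \<longrightarrow> f (name w1 x) = 1)" for j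
  proof (cases "\<exists>x0. l1 x0 = j")
    case False
    then show ?thesis by (intro exI[of _ "\<lambda>_. 0"]) auto
  next
    case True
    then obtain x0 where x0: "l1 x0 = j" by auto
    define f where "f y = (\<Prod>g\<in>insert 0 F. bump (z (k (fst w g x0))) r (y (- g)))" for y :: "'g \<Rightarrow> 'z"
    have "continuous_on UNIV f"
      unfolding f_def
      by (intro continuous_on_prod continuous_on_compose2[OF bump(1)[OF r(1), of UNIV]] continuous_on_product_coordinates) auto
    moreover have "f y \<in> {0..1}" for y
      unfolding f_def using bump(2,3)[OF r(1)] by (auto intro!: prod_nonneg prod_le_1)
    moreover have "f y = 0" if y: "l2 y \<noteq> j" for y
    proof -
      obtain g where g: "g \<in> insert 0 F" "k (fst w g x0) \<noteq> cell (y (- g))" 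
      proof -
        have "\<not> (\<forall>g\<in>insert 0 F. k (fst w g x0) = cell (y (- g)))" using y l_eq[of x0 y] x0 by metis
        then show thesis using that by blast
      qed
      then have "\<not> dist (y (- g)) (z (k (fst w g x0))) < r" using cell_eq[OF k(2)] by metis
      then have "bump (z (k (fst w g x0))) r (y (- g)) = 0" by (intro bump(5)[OF r(1)]) simp
      with g(1) F(1) show ?thesis unfolding f_def by (intro prod_zero) auto
    qed
    moreover have "f (name w1 x) = 1" if "l1 x = j" for x
    proof -
      have "k (fst w g x) = k (fst w g x0)" if "g \<in> insert 0 F" for g
        using l11[of x x0] x0 \<open>l1 x = j\<close> that by auto
      then show ?thesis unfolding f_def
        by (intro prod.neutral ballI) (simp add: name_def w1_def bump(4)[OF r(1)])
    qed
    ultimately show ?thesis by (intro exI[of _ f]) auto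
  qed
  then obtain f :: "nat \<Rightarrow> ('g \<Rightarrow> 'z) \<Rightarrow> real" where f: "\<And>j. continuous_on UNIV (f j)" "\<And>j. range (f j) \<subseteq> {0..1}"
    and f0: "\<And>j y. l2 y \<noteq> j \<Longrightarrow> f j y = 0" and f1: "\<And>j x. l1 x = j \<Longrightarrow> f j (name w1 x) = 1"
    by metis
  have f_range: "0 \<le> f j y" "f j y \<le> 1" for j y using f(2)[of j] by (auto simp: image_subset_iff)
  have fm: "f j \<in> borel_measurable borel" for j using f(1) by (rule borel_measurable_continuous_onI)
  have l1_sets: "{x. l1 x = j} \<in> sets borel" for j
    using measurable_sets[OF l1_m, of "{j}"] by (simp add: vimage_def)
  have l2_sets: "{y. l2 y = j} \<in> sets borel" for j
    using measurable_sets[OF l2_m, of "{j}"] by (simp add: vimage_def)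
  let ?T = "P_mu_topology \<mu> :: ('g \<Rightarrow> 'z) measure topology"
  define V where "V = topspace ?T \<inter> (\<Inter>j\<in>{..n}. {\<eta>\<in>topspace ?T. (\<integral>y. f j y \<partial>\<eta>) \<in> {measure \<nu> {x. l1 x = j} - d<..}})"
  have "openin ?T V"
    unfolding V_def
  proof (rule openin_Int_Inter)
    fix X assume "X \<in> (\<lambda>j. {\<eta>\<in>topspace ?T. (\<integral>y. f j y \<partial>\<eta>) \<in> {measure \<nu> {x. l1 x = j} - d<..}}) ` {..n}"
    then obtain j where X: "X = {\<eta>\<in>topspace ?T. (\<integral>y. f j y \<partial>\<eta>) \<in> {measure \<nu> {x. l1 x = j} - d<..}}" by auto
    have "bounded (range (f j))" unfolding bounded_iff using f_range[of j] by (intro exI[of _ 1]) auto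
    then show "openin ?T X" unfolding X
      by (intro openin_continuous_map_preimage[OF continuous_map_P_mu_coord[OF f(1)]]) simp_all
  next
    show "openin ?T (topspace ?T)" by (rule openin_topspace)
  qed simp
  moreover have "law w1 \<in> V"
  proof -
    have le: "measure \<nu> {x. l1 x = j} \<le> (\<integral>y. f j y \<partial>law w1)" for j
    proof -
      have "measure \<nu> {x. l1 x = j} = (\<integral>x. indicator {x. l1 x = j} x \<partial>\<nu>)"
        using l1_sets[of j] by simp
      also have "\<dots> \<le> (\<integral>x. f j (name w1 x) \<partial>\<nu>)"
      proof (rule integral_mono)
        show "integrable \<nu> (\<lambda>x. indicator {x. l1 x = j} x :: real)"
          using l1_sets[of j] by (simp add: sets_\<nu> \<nu>.emeasure_eq_measure)
        show "integrable \<nu> (\<lambda>x. f j (name w1 x))"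
          by (rule \<nu>.integrable_const_bound[of _ 1])
            (use f_range borel_measurable_\<nu>[OF measurable_compose[OF name_measurable[OF w1] fm]] in auto)
        show "indicator {x. l1 x = j} x \<le> f j (name w1 x)" for x
          using f1[of x j] f_range[of j] by (auto simp: indicator_def)
      qed
      finally show ?thesis by (simp add: integral_law[OF w1 fm])
    qed
    have "measure \<nu> {x. l1 x = j} - d < (\<integral>y. f j y \<partial>law w1)" for j
      using le[of j] d by linarith
    then show ?thesis using law_P_mu[OF w1] by (simp add: V_def)
  qed
  moreover have "V \<subseteq> law ` NA.pball w e"
  proof
    fix \<eta> assume V: "\<eta> \<in> V"
    then have \<eta>: "\<eta> \<in> P_mu \<mu>" by (simp add: V_def)
    then have \<eta>s: "sets \<eta> = sets borel" and \<eta>p: "prob_space \<eta>" by (auto simp: P_mu_iff)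
    interpret \<eta>: prob_space \<eta> by (rule \<eta>p)
    have \<eta>sp: "space \<eta> = UNIV" using sets_eq_imp_space_eq[OF \<eta>s] by simp
    have l1\<nu>: "l1 \<in> measurable \<nu> (count_space UNIV)" using l1_m unfolding measurable_cong_sets[OF sets_\<nu> refl] .
    have l2\<eta>: "l2 \<in> measurable \<eta> (count_space UNIV)" using l2_m unfolding measurable_cong_sets[OF \<eta>s refl] .
    have f\<eta>: "f j \<in> borel_measurable \<eta>" for j using fm[of j] unfolding measurable_cong_sets[OF \<eta>s refl] .
    let ?p = "\<lambda>j. measure \<nu> {x. l1 x = j}" and ?q = "\<lambda>j. measure \<eta> {y. l2 y = j}"
    have pq: "?p j - ?q j \<le> d" for j
    proof (cases "j \<le> n")
      case True
      then have "?p j - d < (\<integral>y. f j y \<partial>\<eta>)" using V by (auto simp: V_def)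
      also have "\<dots> \<le> (\<integral>y. indicator {y. l2 y = j} y \<partial>\<eta>)"
      proof (rule integral_mono)
        show "integrable \<eta> (f j)"
          by (rule \<eta>.integrable_const_bound[of _ 1])
            (use f_range f\<eta> in auto)
        show "integrable \<eta> (\<lambda>y. indicator {y. l2 y = j} y :: real)"
          using l2_sets[of j] by (simp add: \<eta>s \<eta>.emeasure_eq_measure)
        show "f j y \<le> indicator {y. l2 y = j} y" for y
          using f0[of y j] f_range[of j y] by (auto simp: indicator_def)
      qed
      also have "\<dots> = ?q j" using \<eta>sp by simp
      finally show ?thesis by simp
    next
      case False
      then have "{x. l1 x = j} = {}" using l1_n by auto
      then have "?p j = 0" by simp
      then show ?thesis using d measure_nonneg[of \<eta> "{y. l2 y = j}"] by linarith
    qed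
    have sum1: "(\<Sum>i<N. ?p i) = 1"
    proof -
      have "{x. l1 x < N} = space \<nu>" using l1_n by (auto simp: N_def less_Suc_eq_le)
      then show ?thesis
        using measure_label_less[OF \<nu>.finite_measure_axioms l1\<nu> space_\<nu>, of N] \<nu>.prob_space by simp
    qed
    have sum2: "(\<Sum>i<N. ?q i) = 1"
    proof -
      have "{y. l2 y < N} = space \<eta>" using l2_n by (auto simp: N_def less_Suc_eq_le \<eta>sp)
      then show ?thesis
        using measure_label_less[OF \<eta>.finite_measure_axioms l2\<eta> \<eta>sp, of N] \<eta>.prob_space by simp
    qed
    have cum: "\<bar>measure \<nu> {x. l1 x < j} - measure \<eta> {y. l2 y < j}\<bar> \<le> real N * d" if "j \<le> n" for j
      unfolding measure_label_less[OF \<nu>.finite_measure_axioms l1\<nu> space_\<nu>]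
        measure_label_less[OF \<eta>.finite_measure_axioms l2\<eta> \<eta>sp]
      by (rule cumulative_close[of _ N]) (use sum1 sum2 pq d that in \<open>auto simp: N_def\<close>)
    obtain w' :: "('g, 'x, 'z) named_action" where w': "w' \<in> named_actions" and law: "law w' = \<eta>"
      and bad0: "measure \<nu> {x. l1 x \<noteq> l2 (name w' x)} \<le>
        (\<Sum>j\<le>n. \<bar>measure \<nu> {x. l1 x < j} - measure \<eta> {y. l2 y < j}\<bar>)"
      using realization[OF \<eta> l1_m l2_m l1_n l2_n] by blast
    let ?B = "{x. l1 x \<noteq> l2 (name w' x)}" and ?H = "{y. k y \<noteq> cell (snd w' y)}"
    have "(\<Sum>j\<le>n. \<bar>measure \<nu> {x. l1 x < j} - measure \<eta> {y. l2 y < j}\<bar>) \<le> (\<Sum>j\<le>n. real N * d)"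
      by (rule sum_mono) (use cum in auto)
    also have "\<dots> = e'" by (simp add: d_def N_def)
    finally have bad: "measure \<nu> ?B \<le> e'" using bad0 by linarith
    have B_sets: "?B \<in> sets \<nu>"
      using sets_label_neq[OF l1_m measurable_compose[OF name_measurable[OF w'] l2_m]] by (simp add: sets_\<nu>)
    have H_sets: "?H \<in> sets borel"
      using sets_label_neq[OF k(1) measurable_compose[OF named_actionsD(2)[OF w'] cell_m]] by simp
    have "AE y in \<nu>. y \<in> ?H \<longrightarrow> y \<in> ?B"
      using A_mu_zero[OF named_actionsD(1)[OF w]] A_mu_zero[OF named_actionsD(1)[OF w']]
    proof eventually_elim
      case (elim y)
      show ?case
      proof (intro impI CollectI notI)
        assume "y \<in> ?H" "l1 y = l2 (name w' y)"
        then show False using l_eq[of y "name w' y"] elim by (simp add: name_def)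
      qed
    qed
    then have "measure \<nu> ?H \<le> measure \<nu> ?B"
      by (rule \<nu>.finite_measure_mono_AE) (rule B_sets)
    with bad have H: "measure \<nu> ?H \<le> e'" by linarith
    have "(\<integral>x. min 1 (dist (orb w x g) (orb w' x g)) \<partial>\<nu>) < e0" if g: "g \<in> F" for g
    proof -
      let ?K = "fst w g -` {x. k x = 0}" and ?H' = "fst w' g -` ?H"
      have K_sets: "?K \<in> sets \<nu>" by (rule A_mu_vimage[OF named_actionsD(1)[OF w] k0_sets])
      have H'_sets: "?H' \<in> sets \<nu>" by (rule A_mu_vimage[OF named_actionsD(1)[OF w'] H_sets])
      have "(\<integral>x. min 1 (dist (orb w x g) (orb w' x g)) \<partial>\<nu>) \<le> 3 * e' + measure \<nu> (?B \<union> (?K \<union> ?H'))"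
      proof (rule integral_min_le)
        show "?B \<union> (?K \<union> ?H') \<in> sets \<nu>" using B_sets K_sets H'_sets by auto
        fix x assume x: "x \<notin> ?B \<union> (?K \<union> ?H')"
        let ?u = "fst w g x" and ?v = "fst w' g x"
        have j: "k ?u = cell (snd w' ?v)"
          using x l_eq[of x "name w' x"] g by (simp add: name_def)
        have kv: "k ?v = k ?u" using x j by simp
        have ku: "k ?u \<noteq> 0" using x by simp
        have "dist (snd w ?u) (z (k ?u)) < e'" using kz[OF ku] .
        moreover have "dist (snd w' ?v) (z (k ?u)) < r"
          using cell_P[of "snd w' ?v"] k(2)[of ?u] j by auto
        ultimately have "dist (snd w ?u) (snd w' ?v) < 2 * e'"
          using dist_triangle2[of "snd w ?u" "snd w' ?v" "z (k ?u)"] r(2) by linarith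
        moreover have "dist ?u ?v < e'" using kk[OF kv[symmetric] ku] .
        moreover have "dist (orb w x g) (orb w' x g) \<le> dist ?u ?v + dist (snd w ?u) (snd w' ?v)"
          unfolding orb_def dist_Pair_Pair by (rule sqrt_sum_squares_le_sum) auto
        ultimately show "dist (orb w x g) (orb w' x g) \<le> 3 * e'" by linarith
      qed (use e' in simp)
      also have "measure \<nu> (?B \<union> (?K \<union> ?H')) \<le> measure \<nu> ?B + measure \<nu> (?K \<union> ?H')"
        by (rule measure_subadditive) (use B_sets K_sets H'_sets in \<open>auto simp: \<nu>.emeasure_eq_measure\<close>)
      also have "measure \<nu> (?K \<union> ?H') \<le> measure \<nu> ?K + measure \<nu> ?H'"
        by (rule measure_subadditive) (use K_sets H'_sets in \<open>auto simp: \<nu>.emeasure_eq_measure\<close>)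
      also have "measure \<nu> ?K \<le> cst g * measure \<nu> {x. k x = 0}"
        by (rule A_mu_bound[OF named_actionsD(1)[OF w] k0_sets])
      also have "\<dots> \<le> (C - 1) * e'" using C k0 g e' by (intro mult_mono) auto
      also have "measure \<nu> ?H' \<le> cst g * measure \<nu> ?H"
        by (rule A_mu_bound[OF named_actionsD(1)[OF w'] H_sets])
      also have "\<dots> \<le> (C - 1) * e'" using C H g e' by (intro mult_mono) auto
      also have "measure \<nu> ?B \<le> e'" by (rule bad)
      finally have "(\<integral>x. min 1 (dist (orb w x g) (orb w' x g)) \<partial>\<nu>) \<le> 2 * e' + 2 * (C * e')"
        by (simp add: algebra_simps)
      also have "\<dots> \<le> 4 * (C * e')" using C(1) e' mult_right_mono[of 1 C e'] by linarith
      also have "\<dots> < e0" using C(1) F(2) by (simp add: e'_def)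
      finally show ?thesis .
    qed
    then have "w' \<in> NA.pball w e" using Fe w' by (simp add: NA.pball_def)
    then show "\<eta> \<in> law ` NA.pball w e" using law by blast
  qed
  ultimately show ?thesis by blast
qed

lemma indistinguishable_actions:
  assumes a: "a \<in> A_mu \<mu> \<nu>" and b: "b \<in> A_mu \<mu> \<nu>"
    and ind: "\<And>U. openin (A_mu_topology \<mu> \<nu>) U \<Longrightarrow> b \<in> U \<Longrightarrow> a \<in> U"
  shows "AE x in \<nu>. a g x = b g x"
proof (rule AE_eq_if_vimages_eq[OF sets_\<nu> prob_\<nu> A_mu_measurable[OF a] A_mu_measurable[OF b] A_mu_bound[OF a] cst_nonneg])
  fix B :: "'x set" assume B: "B \<in> sets borel"
  let ?T = "A_mu_topology \<mu> \<nu>"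
  have S: "b g -` B \<in> sets borel" using A_mu_vimage[OF b B] by (simp add: sets_\<nu>)
  let ?c = "\<lambda>a. measure \<nu> (sym_diff (b g -` B) (a g -` B))"
  show "measure \<nu> (sym_diff (a g -` B) (b g -` B)) = 0"
  proof (rule ccontr)
    assume "measure \<nu> (sym_diff (a g -` B) (b g -` B)) \<noteq> 0"
    then have pos: "?c a > 0" by (simp add: Un_commute zero_less_measure_iff)
    have "openin ?T {a'\<in>topspace ?T. ?c a' \<in> {..<?c a}}"
      by (rule openin_continuous_map_preimage[OF continuous_map_sym_diff[OF S B]]) simp
    moreover have "b \<in> {a'\<in>topspace ?T. ?c a' \<in> {..<?c a}}" using b pos by simp
    ultimately have "a \<in> {a'\<in>topspace ?T. ?c a' \<in> {..<?c a}}" by (rule ind)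
    then show False by simp
  qed
qed

lemma conjugate_AE_eq:
  assumes a: "a \<in> A_mu \<mu> \<nu>" and b: "b \<in> A_mu \<mu> \<nu>" and eq: "\<And>g. AE x in \<nu>. a g x = b g x"
  shows "conjugate \<nu> a \<nu> b"
  unfolding conjugate_def
proof (intro conjI exI[of _ "\<lambda>x. x"] allI)
  show "distr \<nu> \<nu> (\<lambda>x. x) = \<nu>" by (rule distr_id)
qed (use A_mu_nonsingular_action[OF a] A_mu_nonsingular_action[OF b] eq in auto)

lemma indistinguishable_laws:
  fixes \<eta> \<eta>' :: "('g \<Rightarrow> 'z::polish_space) measure"
  assumes \<eta>: "\<eta> \<in> P_mu \<mu>" and \<eta>': "\<eta>' \<in> P_mu \<mu>"
    and ind: "\<And>U. openin (P_mu_topology \<mu>) U \<Longrightarrow> \<eta>' \<in> U \<Longrightarrow> \<eta> \<in> U"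
  shows "\<eta> = \<eta>'"
proof (rule finite_borel_measure_eqI)
  show "sets \<eta> = sets borel" "sets \<eta>' = sets borel" using \<eta> \<eta>' by (auto simp: P_mu_iff)
  show "finite_measure \<eta>" "finite_measure \<eta>'"
    using \<eta> \<eta>' by (auto simp: P_mu_iff intro: prob_space.finite_measure)
  let ?T = "P_mu_topology \<mu> :: ('g \<Rightarrow> 'z) measure topology"
  fix f :: "('g \<Rightarrow> 'z) \<Rightarrow> real" assume f: "continuous_on UNIV f" "bounded (range f)"
  show "(\<integral>y. f y \<partial>\<eta>) = (\<integral>y. f y \<partial>\<eta>')"
  proof (rule ccontr)
    assume ne: "(\<integral>y. f y \<partial>\<eta>) \<noteq> (\<integral>y. f y \<partial>\<eta>')"
    have "openin ?T {\<zeta>\<in>topspace ?T. (\<integral>y. f y \<partial>\<zeta>) \<in> - {\<integral>y. f y \<partial>\<eta>}}"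
      by (rule openin_continuous_map_preimage[OF continuous_map_P_mu_coord[OF f]]) (simp add: open_Compl)
    moreover have "\<eta>' \<in> {\<zeta>\<in>topspace ?T. (\<integral>y. f y \<partial>\<zeta>) \<in> - {\<integral>y. f y \<partial>\<eta>}}" using \<eta>' ne by simp
    ultimately have "\<eta> \<in> {\<zeta>\<in>topspace ?T. (\<integral>y. f y \<partial>\<zeta>) \<in> - {\<integral>y. f y \<partial>\<eta>}}" by (rule ind)
    then show False by simp
  qed
qed

end

lemma (in complete_pseudometric) residual_transfer:
  assumes f1: "continuous_map pm_topology Y1 f1"
      "\<And>x e. x \<in> W \<Longrightarrow> e > 0 \<Longrightarrow> \<exists>V. openin Y1 V \<and> V \<noteq> {} \<and> V \<subseteq> f1 ` pball x e"
    and f2: "continuous_map pm_topology Y2 f2" "topspace Y2 \<subseteq> f2 ` W"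
      "\<And>x e. x \<in> W \<Longrightarrow> e > 0 \<Longrightarrow> \<exists>V. openin Y2 V \<and> V \<noteq> {} \<and> V \<subseteq> f2 ` pball x e"
    and D: "\<And>n::nat. openin pm_topology (D n)" "\<And>n. pm_topology closure_of (D n) = W"
    and res: "residual_in Y1 S1"
    and S2: "\<And>x y. x \<in> W \<Longrightarrow> (\<And>n. x \<in> D n) \<Longrightarrow> f1 x \<in> S1 \<Longrightarrow> y \<in> topspace Y2 \<Longrightarrow>
      (\<And>U. openin Y2 U \<Longrightarrow> f2 x \<in> U \<Longrightarrow> y \<in> U) \<Longrightarrow> y \<in> S2"
  shows "residual_in Y2 S2"
proof -
  obtain U where U': "\<forall>n::nat. openin Y1 (U n) \<and> Y1 closure_of (U n) = topspace Y1" and U3: "(\<Inter>n. U n) \<subseteq> S1"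
    using res unfolding residual_in_def by (elim exE conjE) (rule that)
  then have U: "openin Y1 (U n)" "Y1 closure_of (U n) = topspace Y1" for n by simp_all
  let ?U = "\<lambda>n. {x\<in>W. f1 x \<in> U n} \<inter> D n"
  have 1: "openin pm_topology {x\<in>W. f1 x \<in> U n}" "pm_topology closure_of {x\<in>W. f1 x \<in> U n} = W" for n
    using dense_preimage[OF f1 U(1,2)] by auto
  have 2: "openin pm_topology (?U n)" for n using 1(1) D(1) by blast
  have 3: "pm_topology closure_of (?U n) = W" for n
    using dense_Int_open[of pm_topology, OF 1(1) _ D(1)] 1(2) D(2) by simp
  have ex: "\<exists>V. (\<forall>n::nat. openin Y2 (V n) \<and> Y2 closure_of (V n) = topspace Y2) \<and>
    (\<forall>y\<in>(\<Inter>n. V n). \<exists>x\<in>W. (\<forall>n. x \<in> ?U n) \<and> (\<forall>Op. openin Y2 Op \<longrightarrow> f2 x \<in> Op \<longrightarrow> y \<in> Op))"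
    by (rule residual_image[OF f2 2 3])
  obtain V where V: "\<forall>n::nat. openin Y2 (V n) \<and> Y2 closure_of (V n) = topspace Y2"
    and pre: "\<forall>y\<in>(\<Inter>n. V n). \<exists>x\<in>W. (\<forall>n. x \<in> ?U n) \<and> (\<forall>Op. openin Y2 Op \<longrightarrow> f2 x \<in> Op \<longrightarrow> y \<in> Op)"
    using ex by (elim exE conjE) (rule that)
  have "(\<Inter>n. V n) \<subseteq> S2"
  proof
    fix y assume y: "y \<in> (\<Inter>n. V n)"
    from bspec[OF pre y] obtain x
      where x: "x \<in> W" "\<forall>n. x \<in> ?U n" "\<forall>Op. openin Y2 Op \<longrightarrow> f2 x \<in> Op \<longrightarrow> y \<in> Op"
      by (elim bexE conjE)
    have "y \<in> topspace Y2" using y openin_subset[of Y2 "V 0"] V by auto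
    moreover have "f1 x \<in> S1" by (rule subsetD[OF U3]) (use x(2) in simp)
    ultimately show "y \<in> S2" using x by (intro S2[of x y]) simp_all
  qed
  with V show ?thesis unfolding residual_in_def by (intro exI[of _ V] conjI allI) simp_all
qed

theorem (in stationary_setup) generic_correspondence:
  fixes PX :: "'x measure \<Rightarrow> ('g \<Rightarrow> 'x \<Rightarrow> 'x) \<Rightarrow> bool"
    and PZ :: "('g \<Rightarrow> 'z::{polish_space,perfect_space}) measure \<Rightarrow> ('g \<Rightarrow> ('g \<Rightarrow> 'z) \<Rightarrow> ('g \<Rightarrow> 'z)) \<Rightarrow> bool"
  assumes P: "dynamical_property PX PZ"
  shows "residual_in (A_mu_topology \<mu> \<nu>) {a \<in> A_mu \<mu> \<nu>. PX \<nu> a}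
     \<longleftrightarrow> residual_in (P_mu_topology \<mu>) {\<eta> \<in> P_mu \<mu>. PZ \<eta> shift_action}"
proof -
  obtain i :: "'x \<Rightarrow> real" and \<psi> where i: "i \<in> borel_measurable borel" "\<And>x. 0 < i x" "\<And>x. i x < 1"
    and \<psi>: "\<psi> \<in> borel_measurable borel" "\<And>x. \<psi> (i x) = x"
    using polish_real_retract[where 'a='x] by blast
  let ?W = "named_actions :: ('g, 'x, 'z) named_action set"
  let ?D = "\<lambda>n::nat. recognisable i ((1/2)^n) :: ('g, 'x, 'z) named_action set"
  have D: "openin NA.pm_topology (?D n)" "NA.pm_topology closure_of (?D n) = ?W" for n
    by (rule open_recognisable[OF i], rule dense_recognisable[OF i]) simp
  have conj: "conjugate \<nu> (fst w) (law w) shift_action" if "\<And>n. w \<in> ?D n" for w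
    by (rule conjugate_if_recognisable[OF i \<psi> that])
  have PX: "PX M1 \<alpha>1 \<longleftrightarrow> PX M2 \<alpha>2" if "conjugate M1 \<alpha>1 M2 \<alpha>2" for M1 \<alpha>1 M2 \<alpha>2
    using P that unfolding dynamical_property_def by blast
  have PXZ: "PX M1 \<alpha>1 \<longleftrightarrow> PZ M2 \<alpha>2" if "conjugate M1 \<alpha>1 M2 \<alpha>2" for M1 \<alpha>1 M2 \<alpha>2
    using P that unfolding dynamical_property_def by blast
  show ?thesis
  proof
    assume res: "residual_in (A_mu_topology \<mu> \<nu>) {a \<in> A_mu \<mu> \<nu>. PX \<nu> a}"
    show "residual_in (P_mu_topology \<mu>) {\<eta> \<in> P_mu \<mu>. PZ \<eta> shift_action}"
    proof (rule NA.residual_transfer[OF continuous_map_fst fst_somewhere_open continuous_map_law law_surj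
          law_somewhere_open D res])
      fix w :: "('g, 'x, 'z) named_action" and \<eta>
      assume w: "w \<in> ?W" "\<And>n. w \<in> ?D n" "fst w \<in> {a \<in> A_mu \<mu> \<nu>. PX \<nu> a}"
        and \<eta>: "\<eta> \<in> topspace (P_mu_topology \<mu>)"
        and ind: "\<And>U. openin (P_mu_topology \<mu>) U \<Longrightarrow> law w \<in> U \<Longrightarrow> \<eta> \<in> U"
      have "\<eta> = law w" by (rule indistinguishable_laws[OF _ law_P_mu[OF w(1)] ind]) (use \<eta> in simp)
      then show "\<eta> \<in> {\<eta> \<in> P_mu \<mu>. PZ \<eta> shift_action}"
        using w(3) PXZ[OF conj[OF w(2)]] \<eta> by simp
    qed
  next
    assume res: "residual_in (P_mu_topology \<mu>) {\<eta> \<in> P_mu \<mu>. PZ \<eta> shift_action}"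
    show "residual_in (A_mu_topology \<mu> \<nu>) {a \<in> A_mu \<mu> \<nu>. PX \<nu> a}"
    proof (rule NA.residual_transfer[OF continuous_map_law law_somewhere_open continuous_map_fst fst_surj
          fst_somewhere_open D res])
      fix w :: "('g, 'x, 'z) named_action" and a
      assume w: "w \<in> ?W" "\<And>n. w \<in> ?D n" "law w \<in> {\<eta> \<in> P_mu \<mu>. PZ \<eta> shift_action}"
        and a: "a \<in> topspace (A_mu_topology \<mu> \<nu>)"
        and ind: "\<And>U. openin (A_mu_topology \<mu> \<nu>) U \<Longrightarrow> fst w \<in> U \<Longrightarrow> a \<in> U"
      have aA: "a \<in> A_mu \<mu> \<nu>" using a by simp
      have "conjugate \<nu> a \<nu> (fst w)"
        by (intro conjugate_AE_eq aA named_actionsD(1)[OF w(1)]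
            indistinguishable_actions[OF aA named_actionsD(1)[OF w(1)] ind])
      then show "a \<in> {a \<in> A_mu \<mu> \<nu>. PX \<nu> a}"
        using w(3) PXZ[OF conj[OF w(2)]] PX aA by simp
    qed
  qed
qed

theorem theorem1p7:
  fixes \<mu> :: "'g::{group_add,countable} pmf"
    and \<nu> :: "'x::polish_space measure"
    and PX :: "'x measure \<Rightarrow> ('g \<Rightarrow> 'x \<Rightarrow> 'x) \<Rightarrow> bool"
    and PZ :: "('g \<Rightarrow> 'z::{polish_space,perfect_space}) measure \<Rightarrow> ('g \<Rightarrow> ('g \<Rightarrow> 'z) \<Rightarrow> ('g \<Rightarrow> 'z)) \<Rightarrow> bool"
  assumes "gen_semigroup (set_pmf \<mu>) = UNIV"
    and "sets \<nu> = sets borel" and "prob_space \<nu>" and "\<forall>x. emeasure \<nu> {x} = 0"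
    and "dynamical_property PX PZ"
  shows "residual_in (A_mu_topology \<mu> \<nu>) {a \<in> A_mu \<mu> \<nu>. PX \<nu> a}
     \<longleftrightarrow> residual_in (P_mu_topology \<mu>) {\<eta> \<in> P_mu \<mu>. PZ \<eta> shift_action}"
proof -
  have "stationary_setup \<mu> \<nu>"
    using assms(1-4) by (intro stationary_setup.intro) simp_all
  then show ?thesis using assms(5) by (rule stationary_setup.generic_correspondence)
qed

end
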